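(* Let $\mathcal{D}=\langle\mathcal{A},\mathcal{B}\rangle$ be a triangulated category with a semiorthogonal decomposition, and suppose $\mathcal{A}$ and $\mathcal{B}$ are equipped with $t$-structures with hearts $\mathcal{A}_0$ and $\mathcal{B}_0$ such that $\mathrm{Hom}_{\mathcal{D}}(A,B[i])=0$ for all $A\in\mathcal{A}_0$, $B\in\mathcal{B}_0$ and all $i\le 0$. Let $\mathrm{gl}(\mathcal{A}_0,\mathcal{B}_0)\subset\mathcal{D}$ be the heart of the glued $t$-structure. Then $\mathrm{gl}(\mathcal{A}_0,\mathcal{B}_0)$ is equivalent to the category $\mathcal{A}_0\times_{M_0}\mathcal{B}_0$ obtained by gluing $\mathcal{A}_0$ and $\mathcal{B}_0$ along the bimodule $$M_0\colon\mathcal{A}_0^{\mathrm{op}}\times\mathcal{B}_0\longrightarrow\mathbf{Ab},\qquad M_0(A,B)=\mathrm{Ext}^1_{\mathrm{gl}(\mathcal{A}_0,\mathcal{B}_0)}(A,B).$$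
   Context: Semiorthogonal decomposition $\mathcal{D}=\langle\mathcal{A},\mathcal{B}\rangle$: $\mathcal{A},\mathcal{B}$ are full triangulated subcategories with $\mathrm{Hom}_{\mathcal{D}}(B,A)=0$ for $B\in\mathcal{B}$, $A\in\mathcal{A}$, and every $E\in\mathcal{D}$ fits in a distinguished triangle $B\to E\to A\to B[1]$ with $A\in\mathcal{A}$, $B\in\mathcal{B}$. Let $i_{\mathcal{A}}^*\colon\mathcal{D}\to\mathcal{A}$ be the left adjoint of the inclusion of $\mathcal{A}$ and $i_{\mathcal{B}}^!\colon\mathcal{D}\to\mathcal{B}$ the right adjoint of the inclusion of $\mathcal{B}$. Glued heart (Collins–Polishchuk): if $\mathrm{Hom}_{\mathcal{D}}(\mathcal{A}_0,\mathcal{B}_0[i])=0$ for all $i\leq0$, then $\mathrm{gl}(\mathcal{A}_0,\mathcal{B}_0):=\{E\in\mathcal{D}\mid i_{\mathcal{A}}^*(E)\in\mathcal{A}_0,\ i_{\mathcal{B}}^!(E)\in\mathcal{B}_0\}$, which equals the extension closure of $\mathcal{A}_0$ and $\mathcal{B}_0$, is the heart of a $t$-structure on $\mathcal{D}$, and $(\mathcal{B}_0,\mathcal{A}_0)$ is a torsion pair in it (torsion part $\mathcal{B}_0$). Gluing along a bimodule: $\mathcal{A}_0\times_{M_0}\mathcal{B}_0$ has objects triples $(A,B,\mu)$ with $A\in\mathcal{A}_0$, $B\in\mathcal{B}_0$, $\mu\in M_0(A,B)$; a morphism $(A,B,\mu)\to(A',B',\mu')$ is a pair $(f\colon A\to A',\,g\colon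 B\to B')$ with $M_0(\mathrm{id}_A,g)(\mu)=M_0(f,\mathrm{id}_{B'})(\mu')$ in $M_0(A,B')$; composition is componentwise. *)

theory Defs
  imports "HOL-Algebra.Group"
begin

section \<open>Categories, functors, equivalences, adjunctions\<close>

record ('o, 'm) cat =
  Obj :: "'o set"
  Arr :: "'m set"
  Dom :: "'m \<Rightarrow> 'o"
  Cod :: "'m \<Rightarrow> 'o"
  Ident :: "'o \<Rightarrow> 'm"
  Comp :: "'m \<Rightarrow> 'm \<Rightarrow> 'm"  (infixr "\<cdot>\<index>" 70)

definition Hom :: "('o, 'm, 'z) cat_scheme \<Rightarrow> 'o \<Rightarrow> 'o \<Rightarrow> 'm set" where
  "Hom C X Y = {f \<in> Arr C. Dom C f = X \<and> Cod C f = Y}"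

locale category =
  fixes C :: "('o, 'm, 'z) cat_scheme" (structure)
  assumes Dom_in: "f \<in> Arr C \<Longrightarrow> Dom C f \<in> Obj C"
    and Cod_in: "f \<in> Arr C \<Longrightarrow> Cod C f \<in> Obj C"
    and Ident_in: "X \<in> Obj C \<Longrightarrow> Ident C X \<in> Hom C X X"
    and Comp_in: "\<lbrakk>f \<in> Hom C X Y; g \<in> Hom C Y Z\<rbrakk> \<Longrightarrow> g \<cdot> f \<in> Hom C X Z"
    and Comp_Ident: "f \<in> Hom C X Y \<Longrightarrow> f \<cdot> Ident C X = f"
    and Ident_Comp: "f \<in> Hom C X Y \<Longrightarrow> Ident C Y \<cdot> f = f"
    and Comp_assoc: "\<lbrakk>f \<in> Hom C X Y; g \<in> Hom C Y Z; h \<in> Hom C Z W\<rbrakk>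
      \<Longrightarrow> (h \<cdot> g) \<cdot> f = h \<cdot> (g \<cdot> f)"

definition is_iso :: "('o, 'm, 'z) cat_scheme \<Rightarrow> 'm \<Rightarrow> bool" where
  "is_iso C f \<longleftrightarrow> f \<in> Arr C \<and> (\<exists>g \<in> Hom C (Cod C f) (Dom C f).
     g \<cdot>\<^bsub>C\<^esub> f = Ident C (Dom C f) \<and> f \<cdot>\<^bsub>C\<^esub> g = Ident C (Cod C f))"

definition isomorphic :: "('o, 'm, 'z) cat_scheme \<Rightarrow> 'o \<Rightarrow> 'o \<Rightarrow> bool" where
  "isomorphic C X Y \<longleftrightarrow> (\<exists>f \<in> Hom C X Y. is_iso C f)"

definition full_subcat :: "('o, 'm, 'z) cat_scheme \<Rightarrow> 'o set \<Rightarrow> ('o, 'm, 'z) cat_scheme" where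
  "full_subcat C S = C\<lparr>Obj := S, Arr := {f \<in> Arr C. Dom C f \<in> S \<and> Cod C f \<in> S}\<rparr>"

record ('o, 'm, 'p, 'n) func =
  fobj :: "'o \<Rightarrow> 'p"
  fmap :: "'m \<Rightarrow> 'n"

locale covariant_functor = source: category C + target: category C'
  for C :: "('o, 'm, 'z) cat_scheme" and C' :: "('p, 'n, 'y) cat_scheme" +
  fixes F :: "('o, 'm, 'p, 'n) func"
  assumes fobj_in: "X \<in> Obj C \<Longrightarrow> fobj F X \<in> Obj C'"
    and fmap_in: "f \<in> Hom C X Y \<Longrightarrow> fmap F f \<in> Hom C' (fobj F X) (fobj F Y)"
    and fmap_Ident: "X \<in> Obj C \<Longrightarrow> fmap F (Ident C X) = Ident C' (fobj F X)"
    and fmap_Comp: "\<lbrakk>f \<in> Hom C X Y; g \<in> Hom C Y Z\<rbrakk>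
      \<Longrightarrow> fmap F (g \<cdot>\<^bsub>C\<^esub> f) = fmap F g \<cdot>\<^bsub>C'\<^esub> fmap F f"

definition id_func :: "('o, 'm, 'o, 'm) func" where
  "id_func = \<lparr>fobj = (\<lambda>X. X), fmap = (\<lambda>f. f)\<rparr>"

definition comp_func ::
  "('p, 'n, 'q, 'k) func \<Rightarrow> ('o, 'm, 'p, 'n) func \<Rightarrow> ('o, 'm, 'q, 'k) func" where
  "comp_func G F = \<lparr>fobj = fobj G \<circ> fobj F, fmap = fmap G \<circ> fmap F\<rparr>"

definition naturally_isomorphic ::
  "('o, 'm, 'z) cat_scheme \<Rightarrow> ('p, 'n, 'y) cat_scheme
    \<Rightarrow> ('o, 'm, 'p, 'n) func \<Rightarrow> ('o, 'm, 'p, 'n) func \<Rightarrow> bool" where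
  "naturally_isomorphic C C' F G \<longleftrightarrow> (\<exists>\<eta>.
     (\<forall>X \<in> Obj C. \<eta> X \<in> Hom C' (fobj F X) (fobj G X) \<and> is_iso C' (\<eta> X)) \<and>
     (\<forall>f \<in> Arr C. \<eta> (Cod C f) \<cdot>\<^bsub>C'\<^esub> fmap F f = fmap G f \<cdot>\<^bsub>C'\<^esub> \<eta> (Dom C f)))"

definition equivalence ::
  "('o, 'm, 'z) cat_scheme \<Rightarrow> ('p, 'n, 'y) cat_scheme \<Rightarrow> ('o, 'm, 'p, 'n) func \<Rightarrow> bool" where
  "equivalence C C' F \<longleftrightarrow> covariant_functor C C' F \<and> (\<exists>G. covariant_functor C' C G \<and>
     naturally_isomorphic C C (comp_func G F) id_func \<and>
     naturally_isomorphic C' C' (comp_func F G) id_func)"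

definition equivalent_categories ::
  "('o, 'm, 'z) cat_scheme \<Rightarrow> ('p, 'n, 'y) cat_scheme \<Rightarrow> bool" where
  "equivalent_categories C C' \<longleftrightarrow> (\<exists>F. equivalence C C' F)"

text \<open>\<open>F : C \<rightarrow> C'\<close> is left adjoint to \<open>G : C' \<rightarrow> C\<close>.\<close>

definition adjoint ::
  "('o, 'm, 'z) cat_scheme \<Rightarrow> ('p, 'n, 'y) cat_scheme
    \<Rightarrow> ('o, 'm, 'p, 'n) func \<Rightarrow> ('p, 'n, 'o, 'm) func \<Rightarrow> bool" where
  "adjoint C C' F G \<longleftrightarrow> covariant_functor C C' F \<and> covariant_functor C' C G \<and> (\<exists>\<phi>.
     (\<forall>X \<in> Obj C. \<forall>Y \<in> Obj C'.
        bij_betw (\<phi> X Y) (Hom C' (fobj F X) Y) (Hom C X (fobj G Y))) \<and>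
     (\<forall>u \<in> Arr C. \<forall>v \<in> Arr C'. \<forall>h \<in> Hom C' (fobj F (Cod C u)) (Dom C' v).
        \<phi> (Dom C u) (Cod C' v) (v \<cdot>\<^bsub>C'\<^esub> h \<cdot>\<^bsub>C'\<^esub> fmap F u)
          = fmap G v \<cdot>\<^bsub>C\<^esub> \<phi> (Cod C u) (Dom C' v) h \<cdot>\<^bsub>C\<^esub> u))"


section \<open>Additive categories\<close>

record ('o, 'm) add_cat = "('o, 'm) cat" +
  Plus :: "'m \<Rightarrow> 'm \<Rightarrow> 'm"
  Zero :: "'o \<Rightarrow> 'o \<Rightarrow> 'm"

definition hom_group :: "('o, 'm, 'z) add_cat_scheme \<Rightarrow> 'o \<Rightarrow> 'o \<Rightarrow> 'm monoid" where
  "hom_group C X Y = \<lparr>carrier = Hom C X Y, mult = Plus C, one = Zero C X Y\<rparr>"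

definition Neg :: "('o, 'm, 'z) add_cat_scheme \<Rightarrow> 'm \<Rightarrow> 'm" where
  "Neg C f = inv\<^bsub>hom_group C (Dom C f) (Cod C f)\<^esub> f"

definition zero_object :: "('o, 'm, 'z) cat_scheme \<Rightarrow> 'o \<Rightarrow> bool" where
  "zero_object C Z \<longleftrightarrow> Z \<in> Obj C \<and>
     (\<forall>X \<in> Obj C. (\<exists>!f. f \<in> Hom C X Z) \<and> (\<exists>!f. f \<in> Hom C Z X))"

locale preadditive_category = category C
  for C :: "('o, 'm, 'z) add_cat_scheme" (structure) +
  assumes hom_comm_group: "\<lbrakk>X \<in> Obj C; Y \<in> Obj C\<rbrakk> \<Longrightarrow> comm_group (hom_group C X Y)"
    and Comp_Plus: "\<lbrakk>f \<in> Hom C X Y; f' \<in> Hom C X Y; g \<in> Hom C Y Z\<rbrakk>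
      \<Longrightarrow> g \<cdot> Plus C f f' = Plus C (g \<cdot> f) (g \<cdot> f')"
    and Plus_Comp: "\<lbrakk>f \<in> Hom C X Y; g \<in> Hom C Y Z; g' \<in> Hom C Y Z\<rbrakk>
      \<Longrightarrow> Plus C g g' \<cdot> f = Plus C (g \<cdot> f) (g' \<cdot> f)"

locale additive_category = preadditive_category +
  assumes ex_zero_object: "\<exists>Z. zero_object C Z"
    and ex_biproduct: "\<lbrakk>X \<in> Obj C; Y \<in> Obj C\<rbrakk> \<Longrightarrow>
      \<exists>P \<in> Obj C. \<exists>i \<in> Hom C X P. \<exists>j \<in> Hom C Y P. \<exists>p \<in> Hom C P X. \<exists>q \<in> Hom C P Y.
        p \<cdot> i = Ident C X \<and> q \<cdot> j = Ident C Y \<and> q \<cdot> i = Zero C X Y \<and> p \<cdot> j = Zero C Y X \<and>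
        Plus C (i \<cdot> p) (j \<cdot> q) = Ident C P"


section \<open>Triangulated categories\<close>

text \<open>A candidate triangle \<open>X \<rightarrow> Y \<rightarrow> Z \<rightarrow> X[1]\<close> is the triple of its arrows \<open>(f, g, h)\<close>.
  The shift is only required to be an autoequivalence, not an automorphism.\<close>

record ('o, 'm) tri_cat = "('o, 'm) add_cat" +
  Shift :: "('o, 'm, 'o, 'm) func"
  Dist :: "('m \<times> 'm \<times> 'm) set"

definition triangle :: "('o, 'm, 'z) tri_cat_scheme \<Rightarrow> 'm \<Rightarrow> 'm \<Rightarrow> 'm \<Rightarrow> bool" where
  "triangle D f g h \<longleftrightarrow> f \<in> Arr D \<and> g \<in> Arr D \<and> h \<in> Arr D \<and>
     Cod D f = Dom D g \<and> Cod D g = Dom D h \<and> Cod D h = fobj (Shift D) (Dom D f)"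

locale triangulated_category = additive_category D
  for D :: "('o, 'm, 'z) tri_cat_scheme" (structure) +
  assumes Shift_equivalence: "equivalence D D (Shift D)"
    and Shift_additive: "\<lbrakk>f \<in> Hom D X Y; g \<in> Hom D X Y\<rbrakk>
      \<Longrightarrow> fmap (Shift D) (Plus D f g) = Plus D (fmap (Shift D) f) (fmap (Shift D) g)"
    and Dist_triangle: "(f, g, h) \<in> Dist D \<Longrightarrow> triangle D f g h"
    and TR1_iso: "\<lbrakk>(f, g, h) \<in> Dist D; triangle D f' g' h';
        a \<in> Hom D (Dom D f) (Dom D f'); b \<in> Hom D (Dom D g) (Dom D g');
        c \<in> Hom D (Dom D h) (Dom D h'); is_iso D a; is_iso D b; is_iso D c;
        b \<cdot> f = f' \<cdot> a; c \<cdot> g = g' \<cdot> b; fmap (Shift D) a \<cdot> h = h' \<cdot> c\<rbrakk>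
      \<Longrightarrow> (f', g', h') \<in> Dist D"
    and TR1_Ident: "X \<in> Obj D \<Longrightarrow> \<exists>Z. zero_object D Z \<and>
        (Ident D X, Zero D X Z, Zero D Z (fobj (Shift D) X)) \<in> Dist D"
    and TR1_cone: "f \<in> Arr D \<Longrightarrow> \<exists>g h. (f, g, h) \<in> Dist D"
    and TR2: "triangle D f g h \<Longrightarrow>
        (f, g, h) \<in> Dist D \<longleftrightarrow> (g, h, Neg D (fmap (Shift D) f)) \<in> Dist D"
    and TR3: "\<lbrakk>(f, g, h) \<in> Dist D; (f', g', h') \<in> Dist D;
        a \<in> Hom D (Dom D f) (Dom D f'); b \<in> Hom D (Dom D g) (Dom D g'); b \<cdot> f = f' \<cdot> a\<rbrakk>
      \<Longrightarrow> \<exists>c \<in> Hom D (Dom D h) (Dom D h').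
        c \<cdot> g = g' \<cdot> b \<and> fmap (Shift D) a \<cdot> h = h' \<cdot> c"
    and TR4: "\<lbrakk>f \<in> Hom D X Y; g \<in> Hom D Y Z;
        (f, j, k) \<in> Dist D; (g \<cdot> f, r, s) \<in> Dist D; (g, t, w) \<in> Dist D\<rbrakk>
      \<Longrightarrow> \<exists>u \<in> Hom D (Cod D j) (Cod D r). \<exists>v \<in> Hom D (Cod D r) (Cod D t).
        (u, v, fmap (Shift D) j \<cdot> w) \<in> Dist D \<and>
        u \<cdot> j = r \<cdot> g \<and> s \<cdot> u = k \<and> v \<cdot> r = t \<and> w \<cdot> v = fmap (Shift D) f \<cdot> s"

text \<open>\<open>X[i]\<close> for \<open>i :: int\<close>; as the shift is an autoequivalence, \<open>X[-1]\<close> is an object chosen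
  with \<open>X[-1][1] \<cong> X\<close>.\<close>

definition unshift :: "('o, 'm, 'z) tri_cat_scheme \<Rightarrow> 'o \<Rightarrow> 'o" where
  "unshift D X = (SOME Y. Y \<in> Obj D \<and> isomorphic D (fobj (Shift D) Y) X)"

definition shift_by :: "('o, 'm, 'z) tri_cat_scheme \<Rightarrow> int \<Rightarrow> 'o \<Rightarrow> 'o" where
  "shift_by D i X =
     (if i \<ge> 0 then (fobj (Shift D) ^^ nat i) X else (unshift D ^^ nat (- i)) X)"

definition tri_subcat :: "('o, 'm, 'z) tri_cat_scheme \<Rightarrow> 'o set \<Rightarrow> ('o, 'm, 'z) tri_cat_scheme" where
  "tri_subcat D S = (full_subcat D S)
     \<lparr>Dist := {(f, g, h) \<in> Dist D. Dom D f \<in> S \<and> Dom D g \<in> S \<and> Dom D h \<in> S}\<rparr>"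

text \<open>Full triangulated subcategories are not required to be closed under isomorphism.\<close>

definition full_triangulated_subcategory :: "('o, 'm, 'z) tri_cat_scheme \<Rightarrow> 'o set \<Rightarrow> bool" where
  "full_triangulated_subcategory D S \<longleftrightarrow>
     S \<subseteq> Obj D \<and> triangulated_category (tri_subcat D S)"

locale semiorthogonal_decomposition = triangulated_category D
  for D :: "('o, 'm, 'z) tri_cat_scheme" and A :: "'o set" and B :: "'o set" +
  assumes A_subcat: "full_triangulated_subcategory D A"
    and B_subcat: "full_triangulated_subcategory D B"
    and semiorthogonal: "\<lbrakk>Y \<in> B; X \<in> A\<rbrakk> \<Longrightarrow> Hom D Y X = {Zero D Y X}"
    and decomposition: "E \<in> Obj D \<Longrightarrow>
      \<exists>f g h. (f, g, h) \<in> Dist D \<and> Dom D f \<in> B \<and> Dom D g = E \<and> Dom D h \<in> A"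

text \<open>A \<open>t\<close>-structure \<open>(T\<^sup>\<le>\<^sup>0, T\<^sup>\<ge>\<^sup>0) = (L, G)\<close>; since \<open>L\<close> and \<open>G\<close> are closed under isomorphism,
  \<open>T\<^sup>\<ge>\<^sup>1 = T\<^sup>\<ge>\<^sup>0[-1]\<close> consists of the objects \<open>Y\<close> with \<open>Y[1] \<in> G\<close>.\<close>

locale t_structure = triangulated_category T
  for T :: "('o, 'm, 'z) tri_cat_scheme" and L :: "'o set" and G :: "'o set" +
  assumes L_subset: "L \<subseteq> Obj T"
    and G_subset: "G \<subseteq> Obj T"
    and L_iso: "\<lbrakk>X \<in> L; isomorphic T X Y\<rbrakk> \<Longrightarrow> Y \<in> L"
    and G_iso: "\<lbrakk>X \<in> G; isomorphic T X Y\<rbrakk> \<Longrightarrow> Y \<in> G"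
    and L_shift: "X \<in> L \<Longrightarrow> fobj (Shift T) X \<in> L"
    and G_shift: "\<lbrakk>Y \<in> Obj T; fobj (Shift T) Y \<in> G\<rbrakk> \<Longrightarrow> Y \<in> G"
    and Hom_vanish: "\<lbrakk>X \<in> L; Y \<in> Obj T; fobj (Shift T) Y \<in> G\<rbrakk> \<Longrightarrow> Hom T X Y = {Zero T X Y}"
    and truncation: "E \<in> Obj T \<Longrightarrow>
      \<exists>f g h. (f, g, h) \<in> Dist T \<and> Dom T f \<in> L \<and> Dom T g = E \<and> fobj (Shift T) (Dom T h) \<in> G"

definition heart :: "'o set \<Rightarrow> 'o set \<Rightarrow> 'o set" where
  "heart L G = L \<inter> G"

definition left_adjoint_of_inclusion ::
  "('o, 'm, 'z) tri_cat_scheme \<Rightarrow> 'o set \<Rightarrow> ('o, 'm, 'o, 'm) func" where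
  "left_adjoint_of_inclusion D A = (SOME F. adjoint D (full_subcat D A) F id_func)"

definition right_adjoint_of_inclusion ::
  "('o, 'm, 'z) tri_cat_scheme \<Rightarrow> 'o set \<Rightarrow> ('o, 'm, 'o, 'm) func" where
  "right_adjoint_of_inclusion D B = (SOME G. adjoint (full_subcat D B) D id_func G)"

definition glued_heart ::
  "('o, 'm, 'z) tri_cat_scheme \<Rightarrow> 'o set \<Rightarrow> 'o set \<Rightarrow> 'o set \<Rightarrow> 'o set \<Rightarrow> 'o set" where
  "glued_heart D A B A\<^sub>0 B\<^sub>0 = {E \<in> Obj D.
     fobj (left_adjoint_of_inclusion D A) E \<in> A\<^sub>0 \<and>
     fobj (right_adjoint_of_inclusion D B) E \<in> B\<^sub>0}"


section \<open>Bimodules and gluing\<close>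

text \<open>For \<open>f : A' \<rightarrow> A\<close> and \<open>g : B \<rightarrow> B'\<close>, \<open>bact M f g\<close> is the map
  \<open>M(f, g) : M(A, B) \<rightarrow> M(A', B')\<close>.\<close>

record ('o, 'm, 'p, 'n, 'e) bimod =
  bgrp :: "'o \<Rightarrow> 'p \<Rightarrow> 'e monoid"
  bact :: "'m \<Rightarrow> 'n \<Rightarrow> 'e \<Rightarrow> 'e"

locale bimodule = left: category C + right: category C'
  for C :: "('o, 'm, 'z) cat_scheme" and C' :: "('p, 'n, 'y) cat_scheme" +
  fixes M :: "('o, 'm, 'p, 'n, 'e) bimod"
  assumes bgrp_comm_group: "\<lbrakk>X \<in> Obj C; Y \<in> Obj C'\<rbrakk> \<Longrightarrow> comm_group (bgrp M X Y)"
    and bact_hom: "\<lbrakk>f \<in> Arr C; g \<in> Arr C'\<rbrakk>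
      \<Longrightarrow> bact M f g \<in> hom (bgrp M (Cod C f) (Dom C' g)) (bgrp M (Dom C f) (Cod C' g))"
    and bact_Ident: "\<lbrakk>X \<in> Obj C; Y \<in> Obj C'; \<mu> \<in> carrier (bgrp M X Y)\<rbrakk>
      \<Longrightarrow> bact M (Ident C X) (Ident C' Y) \<mu> = \<mu>"
    and bact_Comp: "\<lbrakk>f' \<in> Hom C X'' X'; f \<in> Hom C X' X; g \<in> Hom C' Y Y'; g' \<in> Hom C' Y' Y'';
        \<mu> \<in> carrier (bgrp M X Y)\<rbrakk>
      \<Longrightarrow> bact M (f \<cdot>\<^bsub>C\<^esub> f') (g' \<cdot>\<^bsub>C'\<^esub> g) \<mu> = bact M f' g' (bact M f g \<mu>)"

text \<open>An arrow of the glued category records its domain and codomain besides the pair \<open>(f, g)\<close>.\<close>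

definition glued_category ::
  "('o, 'm, 'z) cat_scheme \<Rightarrow> ('p, 'n, 'y) cat_scheme \<Rightarrow> ('o, 'm, 'p, 'n, 'e) bimod
    \<Rightarrow> ('o \<times> 'p \<times> 'e, ('o \<times> 'p \<times> 'e) \<times> ('o \<times> 'p \<times> 'e) \<times> 'm \<times> 'n) cat" where
  "glued_category C C' M = (let
      Ob = {(X, Y, \<mu>). X \<in> Obj C \<and> Y \<in> Obj C' \<and> \<mu> \<in> carrier (bgrp M X Y)}
    in \<lparr>Obj = Ob,
      Arr = {((X, Y, \<mu>), (X', Y', \<mu>'), f, g).
        (X, Y, \<mu>) \<in> Ob \<and> (X', Y', \<mu>') \<in> Ob \<and> f \<in> Hom C X X' \<and> g \<in> Hom C' Y Y' \<and>
        bact M (Ident C X) g \<mu> = bact M f (Ident C' Y') \<mu>'},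
      Dom = (\<lambda>(P, Q, f, g). P),
      Cod = (\<lambda>(P, Q, f, g). Q),
      Ident = (\<lambda>(X, Y, \<mu>). ((X, Y, \<mu>), (X, Y, \<mu>), Ident C X, Ident C' Y)),
      Comp = (\<lambda>(P', Q', f', g') (P, Q, f, g). (P, Q', f' \<cdot>\<^bsub>C\<^esub> f, g' \<cdot>\<^bsub>C'\<^esub> g))\<rparr>)"


section \<open>The bimodule of Yoneda extensions\<close>

definition is_kernel :: "('o, 'm, 'z) add_cat_scheme \<Rightarrow> 'm \<Rightarrow> 'm \<Rightarrow> bool" where
  "is_kernel C k f \<longleftrightarrow> f \<in> Arr C \<and> k \<in> Arr C \<and> Cod C k = Dom C f \<and>
     f \<cdot>\<^bsub>C\<^esub> k = Zero C (Dom C k) (Cod C f) \<and>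
     (\<forall>g \<in> Arr C. Cod C g = Dom C f \<and> f \<cdot>\<^bsub>C\<^esub> g = Zero C (Dom C g) (Cod C f)
        \<longrightarrow> (\<exists>!u. u \<in> Hom C (Dom C g) (Dom C k) \<and> k \<cdot>\<^bsub>C\<^esub> u = g))"

definition is_cokernel :: "('o, 'm, 'z) add_cat_scheme \<Rightarrow> 'm \<Rightarrow> 'm \<Rightarrow> bool" where
  "is_cokernel C c f \<longleftrightarrow> f \<in> Arr C \<and> c \<in> Arr C \<and> Dom C c = Cod C f \<and>
     c \<cdot>\<^bsub>C\<^esub> f = Zero C (Dom C f) (Cod C c) \<and>
     (\<forall>g \<in> Arr C. Dom C g = Cod C f \<and> g \<cdot>\<^bsub>C\<^esub> f = Zero C (Dom C f) (Cod C g)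
        \<longrightarrow> (\<exists>!u. u \<in> Hom C (Cod C c) (Cod C g) \<and> u \<cdot>\<^bsub>C\<^esub> c = g))"

text \<open>\<open>(h, q)\<close> is a pullback of the cospan \<open>(p, f)\<close>, with \<open>p \<cdot> h = f \<cdot> q\<close>.\<close>

definition is_pullback :: "('o, 'm, 'z) cat_scheme \<Rightarrow> 'm \<Rightarrow> 'm \<Rightarrow> 'm \<Rightarrow> 'm \<Rightarrow> bool" where
  "is_pullback C p f h q \<longleftrightarrow> {p, f, h, q} \<subseteq> Arr C \<and>
     Cod C p = Cod C f \<and> Dom C h = Dom C q \<and> Cod C h = Dom C p \<and> Cod C q = Dom C f \<and>
     p \<cdot>\<^bsub>C\<^esub> h = f \<cdot>\<^bsub>C\<^esub> q \<and>
     (\<forall>a \<in> Arr C. \<forall>b \<in> Arr C. Dom C a = Dom C b \<and> Cod C a = Dom C p \<and> Cod C b = Dom C f \<and>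
        p \<cdot>\<^bsub>C\<^esub> a = f \<cdot>\<^bsub>C\<^esub> b
        \<longrightarrow> (\<exists>!u. u \<in> Hom C (Dom C a) (Dom C h) \<and> h \<cdot>\<^bsub>C\<^esub> u = a \<and> q \<cdot>\<^bsub>C\<^esub> u = b))"

text \<open>\<open>(h, j)\<close> is a pushout of the span \<open>(i, g)\<close>, with \<open>h \<cdot> i = j \<cdot> g\<close>.\<close>

definition is_pushout :: "('o, 'm, 'z) cat_scheme \<Rightarrow> 'm \<Rightarrow> 'm \<Rightarrow> 'm \<Rightarrow> 'm \<Rightarrow> bool" where
  "is_pushout C i g h j \<longleftrightarrow> {i, g, h, j} \<subseteq> Arr C \<and>
     Dom C i = Dom C g \<and> Cod C h = Cod C j \<and> Dom C h = Cod C i \<and> Dom C j = Cod C g \<and>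
     h \<cdot>\<^bsub>C\<^esub> i = j \<cdot>\<^bsub>C\<^esub> g \<and>
     (\<forall>a \<in> Arr C. \<forall>b \<in> Arr C. Cod C a = Cod C b \<and> Dom C a = Cod C i \<and> Dom C b = Cod C g \<and>
        a \<cdot>\<^bsub>C\<^esub> i = b \<cdot>\<^bsub>C\<^esub> g
        \<longrightarrow> (\<exists>!u. u \<in> Hom C (Cod C h) (Cod C a) \<and> u \<cdot>\<^bsub>C\<^esub> h = a \<and> u \<cdot>\<^bsub>C\<^esub> j = b))"

text \<open>A short exact sequence \<open>0 \<rightarrow> B \<rightarrow> E \<rightarrow> A \<rightarrow> 0\<close> is the pair of its arrows \<open>(i, p)\<close>.\<close>

definition extensions :: "('o, 'm, 'z) add_cat_scheme \<Rightarrow> 'o \<Rightarrow> 'o \<Rightarrow> ('m \<times> 'm) set" where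
  "extensions C A B =
     {(i, p). Dom C i = B \<and> Cod C p = A \<and> is_kernel C i p \<and> is_cokernel C p i}"

definition ext_equiv :: "('o, 'm, 'z) add_cat_scheme \<Rightarrow> 'o \<Rightarrow> 'o \<Rightarrow> (('m \<times> 'm) \<times> ('m \<times> 'm)) set" where
  "ext_equiv C A B = {((i, p), (i', p')).
     (i, p) \<in> extensions C A B \<and> (i', p') \<in> extensions C A B \<and>
     (\<exists>h \<in> Hom C (Cod C i) (Cod C i'). is_iso C h \<and> h \<cdot>\<^bsub>C\<^esub> i = i' \<and> p' \<cdot>\<^bsub>C\<^esub> h = p)}"

definition Ext1 :: "('o, 'm, 'z) add_cat_scheme \<Rightarrow> 'o \<Rightarrow> 'o \<Rightarrow> ('m \<times> 'm) set set" where
  "Ext1 C A B = extensions C A B // ext_equiv C A B"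

text \<open>The operations on classes below are given as the set of all extensions arising from
  some representatives and some choice of the (co)limits involved; in an abelian category
  this set is precisely one equivalence class.\<close>

definition ext_pull :: "('o, 'm, 'z) add_cat_scheme \<Rightarrow> 'm \<Rightarrow> ('m \<times> 'm) set \<Rightarrow> ('m \<times> 'm) set" where
  "ext_pull C f x = {(i', p'). \<exists>i p h. (i, p) \<in> x \<and>
     (i', p') \<in> extensions C (Dom C f) (Dom C i) \<and>
     is_pullback C p f h p' \<and> h \<cdot>\<^bsub>C\<^esub> i' = i}"

definition ext_push :: "('o, 'm, 'z) add_cat_scheme \<Rightarrow> 'm \<Rightarrow> ('m \<times> 'm) set \<Rightarrow> ('m \<times> 'm) set" where
  "ext_push C g x = {(i', p'). \<exists>i p h. (i, p) \<in> x \<and>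
     (i', p') \<in> extensions C (Cod C p) (Cod C g) \<and>
     is_pushout C i g h i' \<and> p' \<cdot>\<^bsub>C\<^esub> h = p}"

text \<open>Baer sum: the quotient \<open>c\<close> of the fibre product \<open>E\<^sub>1 \<times>\<^sub>A E\<^sub>2\<close> (projections \<open>q\<^sub>1, q\<^sub>2\<close>)
  by the skew diagonal \<open>k = (i\<^sub>1, -i\<^sub>2)\<close>; the sub-object is the image of \<open>j = (i\<^sub>1, 0)\<close>.\<close>

definition baer_sum ::
  "('o, 'm, 'z) add_cat_scheme \<Rightarrow> ('m \<times> 'm) set \<Rightarrow> ('m \<times> 'm) set \<Rightarrow> ('m \<times> 'm) set" where
  "baer_sum C x y = {(i, p). \<exists>i\<^sub>1 p\<^sub>1 i\<^sub>2 p\<^sub>2 q\<^sub>1 q\<^sub>2 k j c.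
     (i\<^sub>1, p\<^sub>1) \<in> x \<and> (i\<^sub>2, p\<^sub>2) \<in> y \<and> is_pullback C p\<^sub>1 p\<^sub>2 q\<^sub>1 q\<^sub>2 \<and>
     k \<in> Hom C (Dom C i\<^sub>1) (Dom C q\<^sub>1) \<and> q\<^sub>1 \<cdot>\<^bsub>C\<^esub> k = i\<^sub>1 \<and> q\<^sub>2 \<cdot>\<^bsub>C\<^esub> k = Neg C i\<^sub>2 \<and>
     j \<in> Hom C (Dom C i\<^sub>1) (Dom C q\<^sub>1) \<and> q\<^sub>1 \<cdot>\<^bsub>C\<^esub> j = i\<^sub>1 \<and>
     q\<^sub>2 \<cdot>\<^bsub>C\<^esub> j = Zero C (Dom C i\<^sub>1) (Cod C q\<^sub>2) \<and>
     is_cokernel C c k \<and>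
     (i, p) \<in> extensions C (Cod C p\<^sub>1) (Dom C i\<^sub>1) \<and> i = c \<cdot>\<^bsub>C\<^esub> j \<and> p \<cdot>\<^bsub>C\<^esub> c = p\<^sub>1 \<cdot>\<^bsub>C\<^esub> q\<^sub>1}"

definition split_class :: "('o, 'm, 'z) add_cat_scheme \<Rightarrow> 'o \<Rightarrow> 'o \<Rightarrow> ('m \<times> 'm) set" where
  "split_class C A B =
     {(i, p) \<in> extensions C A B. \<exists>s \<in> Hom C A (Dom C p). p \<cdot>\<^bsub>C\<^esub> s = Ident C A}"

definition ext1_bimodule ::
  "('o, 'm, 'z) add_cat_scheme \<Rightarrow> ('o, 'm, 'o, 'm, ('m \<times> 'm) set) bimod" where
  "ext1_bimodule C = \<lparr>
     bgrp = (\<lambda>A B. \<lparr>carrier = Ext1 C A B, mult = baer_sum C, one = split_class C A B\<rparr>),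
     bact = (\<lambda>f g x. ext_push C g (ext_pull C f x))\<rparr>"

end

theory Submission
  imports Defs
begin

text \<open>Write \<open>\<Sigma>\<close> for the shift and \<open>H\<close> for the glued heart. An object \<open>E\<close> of \<open>D\<close> lies in \<open>H\<close> iff it sits in a
  triangle \<open>B \<rightarrow> E \<rightarrow> A \<rightarrow> \<Sigma> B\<close> with \<open>A\<close> in \<open>A\<^sub>0\<close> and \<open>B\<close> in \<open>B\<^sub>0\<close>, and \<open>Hom (\<Sigma> X) Y = 0\<close> for \<open>X\<close>, \<open>Y\<close>
  in \<open>H\<close>. Hence in such a triangle the first two arrows are a kernel-cokernel pair of \<open>H\<close>; conversely,
  since there are no arrows from \<open>B\<^sub>0\<close> to \<open>A\<^sub>0\<close>, every extension of \<open>A\<close> by \<open>B\<close> in \<open>H\<close> is isomorphic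
  to the decomposition triangle of its middle term. So an extension is determined up to
  equivalence by its connecting arrow \<open>A \<rightarrow> \<Sigma> B\<close>, and \<open>Ext\<^sup>1 A B\<close> is \<open>Hom A (\<Sigma> B)\<close> as a bimodule.
  Sending \<open>E\<close> to the outer terms and the class of its triangle is then a functor to the glued
  category; it is full because a morphism of the outer terms compatible with the connecting
  arrows extends to the middle, faithful because \<open>Hom A B = 0\<close> makes this extension unique, and
  essentially surjective because every \<open>A \<rightarrow> \<Sigma> B\<close> is part of a triangle.\<close>

section \<open>Categories and equivalences\<close>

text \<open>Three features of the definitions shape the work. The shift is only an equivalence, so
  arrows are moved across it by full faithfulness, and desuspensions exist only up to isomorphism.
  The adjoints defining the glued heart are Hilbert choices, so their existence is proved and their
  values are read off, up to isomorphism, from decomposition triangles. The groups Ext^1 consist of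
  Yoneda classes in \<open>gl\<close>, with pullback, pushout and Baer sum given by universal
  properties inside \<open>gl\<close>; these are matched with composition and addition of connecting
  arrows. The universal properties are verified on triangles: weak kernels and cokernels give
  candidates, a correction term adjusts them, vanishing gives uniqueness. The group laws of Ext^1
  are then inherited from hom groups of \<open>D\<close>. The hypothesis on Hom(A, B[i]) enters at i
  = 0 as Hom(A, B) = 0, which makes middle arrows unique, and at i = -1 as Hom(\<Sigma> A, B) = 0,
  one of the pieces of the vanishing of Hom(\<Sigma> X, Y) on the heart.\<close>

lemma in_Hom_iff [simp]: "f \<in> Hom C X Y \<longleftrightarrow> f \<in> Arr C \<and> Dom C f = X \<and> Cod C f = Y"
  by (simp add: Hom_def)

context category
begin

declare Dom_in [simp] Cod_in [simp]

lemma Ident_Arr [simp]: "X \<in> Obj C \<Longrightarrow> Ident C X \<in> Arr C"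
  and Dom_Ident [simp]: "X \<in> Obj C \<Longrightarrow> Dom C (Ident C X) = X"
  and Cod_Ident [simp]: "X \<in> Obj C \<Longrightarrow> Cod C (Ident C X) = X"
  using Ident_in by auto

lemma Comp_Arr [simp]: "\<lbrakk>f \<in> Arr C; g \<in> Arr C; Cod C f = Dom C g\<rbrakk> \<Longrightarrow> g \<cdot> f \<in> Arr C"
  and Dom_Comp [simp]: "\<lbrakk>f \<in> Arr C; g \<in> Arr C; Cod C f = Dom C g\<rbrakk> \<Longrightarrow> Dom C (g \<cdot> f) = Dom C f"
  and Cod_Comp [simp]: "\<lbrakk>f \<in> Arr C; g \<in> Arr C; Cod C f = Dom C g\<rbrakk> \<Longrightarrow> Cod C (g \<cdot> f) = Cod C g"
  using Comp_in [of f "Dom C f" "Cod C f" g "Cod C g"] by auto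

lemma Comp_Ident' [simp]: "\<lbrakk>f \<in> Arr C; Dom C f = X\<rbrakk> \<Longrightarrow> f \<cdot> Ident C X = f"
  and Ident_Comp' [simp]: "\<lbrakk>f \<in> Arr C; Cod C f = Y\<rbrakk> \<Longrightarrow> Ident C Y \<cdot> f = f"
  using Comp_Ident [of f X "Cod C f"] Ident_Comp [of f "Dom C f" Y] by auto

lemma assoc: "\<lbrakk>f \<in> Arr C; g \<in> Arr C; h \<in> Arr C; Cod C f = Dom C g; Cod C g = Dom C h\<rbrakk>
    \<Longrightarrow> (h \<cdot> g) \<cdot> f = h \<cdot> (g \<cdot> f)"
  using Comp_assoc [of f "Dom C f" "Cod C f" g "Cod C g" h "Cod C h"] by auto

lemma is_isoI: "\<lbrakk>f \<in> Hom C X Y; g \<in> Hom C Y X; g \<cdot> f = Ident C X; f \<cdot> g = Ident C Y\<rbrakk> \<Longrightarrow> is_iso C f"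
  unfolding is_iso_def by auto

lemma is_isoE:
  assumes "is_iso C f" "f \<in> Hom C X Y"
  obtains g where "g \<in> Hom C Y X" "g \<cdot> f = Ident C X" "f \<cdot> g = Ident C Y"
  using assms unfolding is_iso_def by auto

lemma Ident_is_iso: "X \<in> Obj C \<Longrightarrow> is_iso C (Ident C X)"
  by (rule is_isoI [where g = "Ident C X"]) auto

lemma isomorphicI: "\<lbrakk>f \<in> Hom C X Y; g \<in> Hom C Y X; g \<cdot> f = Ident C X; f \<cdot> g = Ident C Y\<rbrakk>
    \<Longrightarrow> isomorphic C X Y"
  unfolding isomorphic_def using is_isoI by blast

lemma isomorphicE:
  assumes "isomorphic C X Y"
  obtains f g where "f \<in> Hom C X Y" "g \<in> Hom C Y X" "g \<cdot> f = Ident C X" "f \<cdot> g = Ident C Y"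
  using assms is_isoE unfolding isomorphic_def by metis

lemma isomorphic_sym: "isomorphic C X Y \<Longrightarrow> isomorphic C Y X"
  by (metis isomorphicE isomorphicI)

lemma isomorphic_trans:
  assumes "isomorphic C X Y" "isomorphic C Y Z"
  shows "isomorphic C X Z"
proof -
  obtain f g where f: "f \<in> Hom C X Y" "g \<in> Hom C Y X" "g \<cdot> f = Ident C X" "f \<cdot> g = Ident C Y"
    using assms(1) by (rule isomorphicE)
  obtain f' g' where f': "f' \<in> Hom C Y Z" "g' \<in> Hom C Z Y" "g' \<cdot> f' = Ident C Y" "f' \<cdot> g' = Ident C Z"
    using assms(2) by (rule isomorphicE)
  have "(g \<cdot> g') \<cdot> (f' \<cdot> f) = g \<cdot> ((g' \<cdot> f') \<cdot> f)" "(f' \<cdot> f) \<cdot> (g \<cdot> g') = f' \<cdot> ((f \<cdot> g) \<cdot> g')"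
    using f(1,2) f'(1,2) by (auto simp: assoc)
  then show ?thesis
    using f f' by (intro isomorphicI [of "f' \<cdot> f" _ _ "g \<cdot> g'"]) auto
qed

lemma iso_cancel_left:
  assumes "is_iso C h" "f \<in> Hom C X (Dom C h)" "g \<in> Hom C X (Dom C h)" "h \<cdot> f = h \<cdot> g"
  shows "f = g"
proof -
  have h: "h \<in> Arr C" using assms(1) by (simp add: is_iso_def)
  obtain k where k: "k \<in> Hom C (Cod C h) (Dom C h)" "k \<cdot> h = Ident C (Dom C h)"
    using assms(1) by (rule is_isoE) (use h in auto)
  have "f = (k \<cdot> h) \<cdot> f" "g = (k \<cdot> h) \<cdot> g"
    using k assms by auto
  then show ?thesis
    using assms k(1) h by (simp add: assoc)
qed

lemma full_subcat_category:
  assumes "S \<subseteq> Obj C"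
  shows "category (full_subcat C S)"
  using assms by unfold_locales (auto simp: full_subcat_def assoc)

end

lemma full_subcat_simps [simp]:
  "Obj (full_subcat C S) = S"
  "f \<in> Arr (full_subcat C S) \<longleftrightarrow> f \<in> Arr C \<and> Dom C f \<in> S \<and> Cod C f \<in> S"
  "Dom (full_subcat C S) = Dom C" "Cod (full_subcat C S) = Cod C"
  "Ident (full_subcat C S) = Ident C" "Comp (full_subcat C S) = Comp C"
  by (auto simp: full_subcat_def)

lemma Hom_full_subcat: "\<lbrakk>X \<in> S; Y \<in> S\<rbrakk> \<Longrightarrow> Hom (full_subcat C S) X Y = Hom C X Y"
  by auto

lemma isomorphic_full_subcat:
  "\<lbrakk>X \<in> S; Y \<in> S\<rbrakk> \<Longrightarrow> isomorphic (full_subcat C S) X Y \<longleftrightarrow> isomorphic C X Y"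
  unfolding isomorphic_def is_iso_def Bex_def in_Hom_iff full_subcat_simps
  by (intro iffI; elim exE conjE; intro exI conjI) (assumption | simp)+

context covariant_functor
begin

lemma fmap_Arr [simp]: "f \<in> Arr C \<Longrightarrow> fmap F f \<in> Arr C'"
  and Dom_fmap [simp]: "f \<in> Arr C \<Longrightarrow> Dom C' (fmap F f) = fobj F (Dom C f)"
  and Cod_fmap [simp]: "f \<in> Arr C \<Longrightarrow> Cod C' (fmap F f) = fobj F (Cod C f)"
  using fmap_in [of f "Dom C f" "Cod C f"] by auto

lemma fmap_Comp': "\<lbrakk>f \<in> Arr C; g \<in> Arr C; Cod C f = Dom C g\<rbrakk>
    \<Longrightarrow> fmap F (g \<cdot>\<^bsub>C\<^esub> f) = fmap F g \<cdot>\<^bsub>C'\<^esub> fmap F f"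
  using fmap_Comp [of f "Dom C f" "Cod C f" g "Cod C g"] by auto

declare fobj_in [simp]

lemma fobj_isomorphic:
  assumes "isomorphic C X Y"
  shows "isomorphic C' (fobj F X) (fobj F Y)"
proof -
  obtain f g where f: "f \<in> Hom C X Y" "g \<in> Hom C Y X" "g \<cdot>\<^bsub>C\<^esub> f = Ident C X" "f \<cdot>\<^bsub>C\<^esub> g = Ident C Y"
    using assms by (rule source.isomorphicE)
  then have "X \<in> Obj C" "Y \<in> Obj C" by auto
  then have "fmap F g \<cdot>\<^bsub>C'\<^esub> fmap F f = Ident C' (fobj F X)" "fmap F f \<cdot>\<^bsub>C'\<^esub> fmap F g = Ident C' (fobj F Y)"
    using f fmap_Comp fmap_Ident by metis+
  then show ?thesis
    using f by (intro target.isomorphicI [of "fmap F f" _ _ "fmap F g"]) auto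
qed

text \<open>A quasi-inverse is assembled from choices: \<open>g Z\<close> with an isomorphism
  \<open>e Z\<close> from its image to \<open>Z\<close> and inverse \<open>d Z\<close>. Arrows are
  conjugated by these and lifted along the bijection on hom sets; faithfulness makes the lifts
  functorial.\<close>

theorem fully_faithful_essentially_surjective_equivalence:
  assumes ff: "\<And>X Y h. \<lbrakk>X \<in> Obj C; Y \<in> Obj C; h \<in> Hom C' (fobj F X) (fobj F Y)\<rbrakk>
      \<Longrightarrow> \<exists>!f. f \<in> Hom C X Y \<and> fmap F f = h"
    and es: "\<And>Z. Z \<in> Obj C' \<Longrightarrow> \<exists>X \<in> Obj C. isomorphic C' (fobj F X) Z"
  shows "equivalence C C' F"
proof -
  have "\<forall>Z. \<exists>X e d. Z \<in> Obj C' \<longrightarrow> X \<in> Obj C \<and> e \<in> Hom C' (fobj F X) Z \<and> d \<in> Hom C' Z (fobj F X) \<and>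
      d \<cdot>\<^bsub>C'\<^esub> e = Ident C' (fobj F X) \<and> e \<cdot>\<^bsub>C'\<^esub> d = Ident C' Z"
    using es target.isomorphicE by metis
  then obtain g e d where *: "\<And>Z. Z \<in> Obj C' \<Longrightarrow> g Z \<in> Obj C \<and> e Z \<in> Hom C' (fobj F (g Z)) Z \<and>
      d Z \<in> Hom C' Z (fobj F (g Z)) \<and>
      d Z \<cdot>\<^bsub>C'\<^esub> e Z = Ident C' (fobj F (g Z)) \<and> e Z \<cdot>\<^bsub>C'\<^esub> d Z = Ident C' Z"
    by metis
  then have g [simp]: "Z \<in> Obj C' \<Longrightarrow> g Z \<in> Obj C"
    and e [simp]: "Z \<in> Obj C' \<Longrightarrow> e Z \<in> Arr C'"
      "Z \<in> Obj C' \<Longrightarrow> Dom C' (e Z) = fobj F (g Z)" "Z \<in> Obj C' \<Longrightarrow> Cod C' (e Z) = Z"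
    and d [simp]: "Z \<in> Obj C' \<Longrightarrow> d Z \<in> Arr C'"
      "Z \<in> Obj C' \<Longrightarrow> Dom C' (d Z) = Z" "Z \<in> Obj C' \<Longrightarrow> Cod C' (d Z) = fobj F (g Z)"
    and de: "Z \<in> Obj C' \<Longrightarrow> d Z \<cdot>\<^bsub>C'\<^esub> e Z = Ident C' (fobj F (g Z))"
    and ed: "Z \<in> Obj C' \<Longrightarrow> e Z \<cdot>\<^bsub>C'\<^esub> d Z = Ident C' Z" for Z
    by auto
  have ed': "e (Cod C' h) \<cdot>\<^bsub>C'\<^esub> (d (Cod C' h) \<cdot>\<^bsub>C'\<^esub> h) = h" if "h \<in> Arr C'" for h
    using that by (simp add: target.assoc [symmetric] ed)
  define lift where "lift X Y h = (THE f. f \<in> Hom C X Y \<and> fmap F f = h)" for X Y h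
  have lift: "lift X Y h \<in> Hom C X Y \<and> fmap F (lift X Y h) = h"
    if "X \<in> Obj C" "Y \<in> Obj C" "h \<in> Hom C' (fobj F X) (fobj F Y)" for X Y h
    unfolding lift_def using ff [OF that] by (rule theI')
  have faithful: "f = f'" if "f \<in> Arr C" "f' \<in> Arr C" "Dom C f = Dom C f'" "Cod C f = Cod C f'"
    "fmap F f = fmap F f'" for f f'
    using ff [of "Dom C f" "Cod C f" "fmap F f"] that by auto
  \<comment> \<open>Conjugation by \<open>e\<close> is exactly what makes \<open>e\<close> natural
    from the composite of \<open>F\<close> and \<open>G\<close> to the identity.\<close>
  define conj where "conj h = d (Cod C' h) \<cdot>\<^bsub>C'\<^esub> (h \<cdot>\<^bsub>C'\<^esub> e (Dom C' h))" for h
  have conj: "conj h \<in> Hom C' (fobj F (g (Dom C' h))) (fobj F (g (Cod C' h)))" if "h \<in> Arr C'" for h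
    unfolding conj_def using that by auto
  define G where "G = \<lparr>fobj = g, fmap = (\<lambda>h. lift (g (Dom C' h)) (g (Cod C' h)) (conj h))\<rparr>"
  have G [simp]: "fobj G = g" by (simp add: G_def)
  have Gmap: "fmap G h \<in> Hom C (g (Dom C' h)) (g (Cod C' h)) \<and> fmap F (fmap G h) = conj h"
    if "h \<in> Arr C'" for h
    using lift [OF _ _ conj [OF that]] that by (simp add: G_def)
  then have GArr [simp]: "fmap G h \<in> Arr C" "Dom C (fmap G h) = g (Dom C' h)" "Cod C (fmap G h) = g (Cod C' h)"
    and FG: "fmap F (fmap G h) = conj h" if "h \<in> Arr C'" for h
    using that by auto
  have G_functor: "covariant_functor C' C G"
  proof unfold_locales
    fix X assume X: "X \<in> Obj C'"
    then have "conj (Ident C' X) = Ident C' (fobj F (g X))"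
      by (simp add: conj_def de)
    with X show "fmap G (Ident C' X) = Ident C (fobj G X)"
      by (intro faithful) (auto simp: FG fmap_Ident)
  next
    fix f h X Y Z assume f: "f \<in> Hom C' X Y" and h: "h \<in> Hom C' Y Z"
    then have "conj (h \<cdot>\<^bsub>C'\<^esub> f) = conj h \<cdot>\<^bsub>C'\<^esub> conj f"
      using ed' [of "f \<cdot>\<^bsub>C'\<^esub> e X"] by (auto simp: conj_def target.assoc)
    then show "fmap G (h \<cdot>\<^bsub>C'\<^esub> f) = fmap G h \<cdot>\<^bsub>C\<^esub> fmap G f"
      using f h by (intro faithful) (auto simp: FG fmap_Comp')
  qed auto
  have "naturally_isomorphic C' C' (comp_func F G) id_func"
    unfolding naturally_isomorphic_def
  proof (rule exI [of _ e], intro conjI ballI)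
    fix X assume X: "X \<in> Obj C'"
    then show "e X \<in> Hom C' (fobj (comp_func F G) X) (fobj id_func X)"
      by (simp add: comp_func_def id_func_def)
    from X show "is_iso C' (e X)"
      by (intro target.is_isoI [where g = "d X"]) (auto simp: de ed)
  next
    fix f assume f: "f \<in> Arr C'"
    then show "e (Cod C' f) \<cdot>\<^bsub>C'\<^esub> fmap (comp_func F G) f = fmap id_func f \<cdot>\<^bsub>C'\<^esub> e (Dom C' f)"
      using ed' [of "f \<cdot>\<^bsub>C'\<^esub> e (Dom C' f)"] by (simp add: comp_func_def id_func_def FG conj_def)
  qed
  \<comment> \<open>The component at \<open>X\<close> is the preimage of
    \<open>e (fobj F X)\<close>; its naturality and invertibility are tested after applying the
    faithful \<open>F\<close>.\<close>
  moreover have "naturally_isomorphic C C (comp_func G F) id_func"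
    unfolding naturally_isomorphic_def
  proof (rule exI [of _ "\<lambda>X. lift (g (fobj F X)) X (e (fobj F X))"], intro conjI ballI)
    fix X assume X: "X \<in> Obj C"
    have 1: "lift (g (fobj F X)) X (e (fobj F X)) \<in> Hom C (g (fobj F X)) X \<and>
        fmap F (lift (g (fobj F X)) X (e (fobj F X))) = e (fobj F X)"
      using X by (intro lift) auto
    have 2: "lift X (g (fobj F X)) (d (fobj F X)) \<in> Hom C X (g (fobj F X)) \<and>
        fmap F (lift X (g (fobj F X)) (d (fobj F X))) = d (fobj F X)"
      using X by (intro lift) auto
    show "lift (g (fobj F X)) X (e (fobj F X)) \<in> Hom C (fobj (comp_func G F) X) (fobj id_func X)"
      using 1 by (simp add: comp_func_def id_func_def)
    show "is_iso C (lift (g (fobj F X)) X (e (fobj F X)))"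
      using 1 2 X by (intro source.is_isoI [where g = "lift X (g (fobj F X)) (d (fobj F X))"] faithful)
        (auto simp: fmap_Comp' de ed fmap_Ident)
  next
    fix f assume f: "f \<in> Arr C"
    have 1: "lift (g (fobj F X)) X (e (fobj F X)) \<in> Hom C (g (fobj F X)) X \<and>
        fmap F (lift (g (fobj F X)) X (e (fobj F X))) = e (fobj F X)" if "X \<in> Obj C" for X
      using that by (intro lift) auto
    note 1 [of "Dom C f"] 1 [of "Cod C f"]
    moreover have "e (fobj F (Cod C f)) \<cdot>\<^bsub>C'\<^esub> conj (fmap F f) = fmap F f \<cdot>\<^bsub>C'\<^esub> e (fobj F (Dom C f))"
      using f ed' [of "fmap F f \<cdot>\<^bsub>C'\<^esub> e (fobj F (Dom C f))"] by (simp add: conj_def)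
    ultimately show "lift (g (fobj F (Cod C f))) (Cod C f) (e (fobj F (Cod C f))) \<cdot>\<^bsub>C\<^esub> fmap (comp_func G F) f
        = fmap id_func f \<cdot>\<^bsub>C\<^esub> lift (g (fobj F (Dom C f))) (Dom C f) (e (fobj F (Dom C f)))"
      using f by (intro faithful) (auto simp: comp_func_def id_func_def fmap_Comp' FG)
  qed
  ultimately show ?thesis
    unfolding equivalence_def using G_functor covariant_functor_axioms by blast
qed

end

lemma ex1_eqI: "\<lbrakk>\<exists>!x. P x; P a; P b\<rbrakk> \<Longrightarrow> a = b"
  by blast

lemma bij_betw_ex1: "\<lbrakk>bij_betw f A B; y \<in> B\<rbrakk> \<Longrightarrow> \<exists>!x. x \<in> A \<and> f x = y"
  unfolding bij_betw_def inj_on_def by blast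

text \<open>Naturality of \<eta> conjugates the composite of \<open>F\<close> and \<open>G\<close>
  to the identity, so \<open>F\<close> reflects equality of arrows; \<epsilon> does the same for
  \<open>G\<close>. Fullness rests on the second fact: the image of the candidate preimage agrees
  with \<open>h\<close> after applying \<open>G\<close>. This is what allows arrows and objects to
  be pulled back along the shift.\<close>

lemma equivalence_properties:
  assumes "equivalence C C' F"
  shows equivalence_faithful: "\<And>f f'. \<lbrakk>f \<in> Arr C; f' \<in> Arr C; Dom C f = Dom C f'; Cod C f = Cod C f';
      fmap F f = fmap F f'\<rbrakk> \<Longrightarrow> f = f'"
    and equivalence_full: "\<And>h X Y. \<lbrakk>X \<in> Obj C; Y \<in> Obj C; h \<in> Hom C' (fobj F X) (fobj F Y)\<rbrakk>
      \<Longrightarrow> \<exists>f \<in> Hom C X Y. fmap F f = h"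
    and equivalence_ess_surj: "\<And>Z. Z \<in> Obj C' \<Longrightarrow> \<exists>X \<in> Obj C. isomorphic C' (fobj F X) Z"
proof -
  obtain G where F: "covariant_functor C C' F" and G: "covariant_functor C' C G"
    and GF: "naturally_isomorphic C C (comp_func G F) id_func"
    and FG: "naturally_isomorphic C' C' (comp_func F G) id_func"
    using assms by (auto simp: equivalence_def)
  interpret F: covariant_functor C C' F by (rule F)
  interpret G: covariant_functor C' C G by (rule G)
  obtain \<eta> where \<eta>: "\<And>X. X \<in> Obj C \<Longrightarrow> \<eta> X \<in> Hom C (fobj G (fobj F X)) X \<and> is_iso C (\<eta> X)"
      "\<And>f. f \<in> Arr C \<Longrightarrow> \<eta> (Cod C f) \<cdot>\<^bsub>C\<^esub> fmap G (fmap F f) = f \<cdot>\<^bsub>C\<^esub> \<eta> (Dom C f)"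
    using GF unfolding naturally_isomorphic_def by (auto simp: comp_func_def id_func_def)
  obtain \<epsilon> where \<epsilon>: "\<And>X. X \<in> Obj C' \<Longrightarrow> \<epsilon> X \<in> Hom C' (fobj F (fobj G X)) X \<and> is_iso C' (\<epsilon> X)"
      "\<And>f. f \<in> Arr C' \<Longrightarrow> \<epsilon> (Cod C' f) \<cdot>\<^bsub>C'\<^esub> fmap F (fmap G f) = f \<cdot>\<^bsub>C'\<^esub> \<epsilon> (Dom C' f)"
    using FG unfolding naturally_isomorphic_def by (auto simp: comp_func_def id_func_def)
  have cancel: "f = f'" if "f \<in> Arr C" "f' \<in> Arr C" "Dom C f = X" "Dom C f' = X" "Cod C f = Cod C f'"
    "f \<cdot>\<^bsub>C\<^esub> \<eta> X = f' \<cdot>\<^bsub>C\<^esub> \<eta> X" for f f' X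
  proof -
    have \<eta>X: "\<eta> X \<in> Hom C (fobj G (fobj F X)) X" "is_iso C (\<eta> X)"
      using \<eta>(1) [of X] that by auto
    obtain k where k: "k \<in> Hom C X (fobj G (fobj F X))" "\<eta> X \<cdot>\<^bsub>C\<^esub> k = Ident C X"
      using F.source.is_isoE [OF \<eta>X(2,1)] by metis
    have "(f \<cdot>\<^bsub>C\<^esub> \<eta> X) \<cdot>\<^bsub>C\<^esub> k = f" "(f' \<cdot>\<^bsub>C\<^esub> \<eta> X) \<cdot>\<^bsub>C\<^esub> k = f'"
      using k \<eta>X(1) that(1-5) by (auto simp: F.source.assoc)
    then show ?thesis using that(6) by metis
  qed
  show faithful: "f = f'" if "f \<in> Arr C" "f' \<in> Arr C" "Dom C f = Dom C f'" "Cod C f = Cod C f'"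
    "fmap F f = fmap F f'" for f f'
  proof (rule cancel [of _ _ "Dom C f"])
    show "f \<cdot>\<^bsub>C\<^esub> \<eta> (Dom C f) = f' \<cdot>\<^bsub>C\<^esub> \<eta> (Dom C f)"
      using \<eta>(2) that by metis
  qed (use that in auto)
  have G_faithful: "f = f'" if "f \<in> Arr C'" "f' \<in> Arr C'" "Dom C' f = Dom C' f'" "Cod C' f = Cod C' f'"
    "fmap G f = fmap G f'" for f f'
  proof -
    define X where "X = Dom C' f"
    have \<epsilon>X: "\<epsilon> X \<in> Hom C' (fobj F (fobj G X)) X" "is_iso C' (\<epsilon> X)"
      using \<epsilon>(1) [of X] that by (auto simp: X_def)
    obtain k where k: "k \<in> Hom C' X (fobj F (fobj G X))" "\<epsilon> X \<cdot>\<^bsub>C'\<^esub> k = Ident C' X"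
      using F.target.is_isoE [OF \<epsilon>X(2,1)] by metis
    have "(f \<cdot>\<^bsub>C'\<^esub> \<epsilon> X) \<cdot>\<^bsub>C'\<^esub> k = f" "(f' \<cdot>\<^bsub>C'\<^esub> \<epsilon> X) \<cdot>\<^bsub>C'\<^esub> k = f'"
      using k \<epsilon>X(1) that by (auto simp: F.target.assoc X_def)
    moreover have "f \<cdot>\<^bsub>C'\<^esub> \<epsilon> X = f' \<cdot>\<^bsub>C'\<^esub> \<epsilon> X"
      using \<epsilon>(2) that unfolding X_def by metis
    ultimately show ?thesis by metis
  qed
  show "\<exists>f \<in> Hom C X Y. fmap F f = h" if "X \<in> Obj C" "Y \<in> Obj C" "h \<in> Hom C' (fobj F X) (fobj F Y)"
    for h X Y
  proof -
    have \<eta>X: "\<eta> X \<in> Hom C (fobj G (fobj F X)) X" "is_iso C (\<eta> X)"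
      and \<eta>Y: "\<eta> Y \<in> Hom C (fobj G (fobj F Y)) Y" "is_iso C (\<eta> Y)"
      using \<eta>(1) that by auto
    obtain k where k: "k \<in> Hom C X (fobj G (fobj F X))" "k \<cdot>\<^bsub>C\<^esub> \<eta> X = Ident C (fobj G (fobj F X))"
      using F.source.is_isoE [OF \<eta>X(2,1)] by metis
    \<comment> \<open>The image of \<open>h\<close> under \<open>G\<close>, transported along \<eta>
      to an arrow from \<open>X\<close> to \<open>Y\<close>.\<close>
    define f where "f = (\<eta> Y \<cdot>\<^bsub>C\<^esub> fmap G h) \<cdot>\<^bsub>C\<^esub> k"
    have f: "f \<in> Hom C X Y"
      using k \<eta>Y that by (auto simp: f_def)
    have "f \<cdot>\<^bsub>C\<^esub> \<eta> X = \<eta> Y \<cdot>\<^bsub>C\<^esub> fmap G h"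
      unfolding f_def using k \<eta>Y \<eta>X that by (auto simp: F.source.assoc)
    moreover have "\<eta> Y \<cdot>\<^bsub>C\<^esub> fmap G (fmap F f) = f \<cdot>\<^bsub>C\<^esub> \<eta> X"
      using \<eta>(2) [of f] f by simp
    ultimately have "fmap G (fmap F f) = fmap G h"
      using F.source.iso_cancel_left [OF \<eta>Y(2), of "fmap G (fmap F f)" "fobj G (fobj F X)" "fmap G h"]
        f \<eta>Y that by auto
    then have "fmap F f = h"
      using G_faithful [of "fmap F f" h] f that by auto
    with f show ?thesis by blast
  qed
  show "\<exists>X \<in> Obj C. isomorphic C' (fobj F X) Z" if "Z \<in> Obj C'" for Z
    using \<epsilon>(1) [OF that] that G.fobj_in unfolding isomorphic_def by blast
qed

section \<open>Adjoints of inclusions\<close>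

context category
begin

text \<open>A universal arrow from \<open>E\<close> to the full subcategory on \<open>S\<close>,
  that is, the unit of an adjunction at the single object \<open>E\<close>. The objectwise form is
  what a decomposition triangle delivers.\<close>

definition left_universal :: "'o set \<Rightarrow> 'o \<Rightarrow> 'o \<Rightarrow> 'm \<Rightarrow> bool" where
  "left_universal S E X a \<longleftrightarrow> X \<in> S \<and> a \<in> Hom C E X \<and>
     (\<forall>Y \<in> S. \<forall>f \<in> Hom C E Y. \<exists>!u. u \<in> Hom C X Y \<and> u \<cdot> a = f)"

definition right_universal :: "'o set \<Rightarrow> 'o \<Rightarrow> 'o \<Rightarrow> 'm \<Rightarrow> bool" where
  "right_universal S E X b \<longleftrightarrow> X \<in> S \<and> b \<in> Hom C X E \<and>
     (\<forall>Y \<in> S. \<forall>f \<in> Hom C Y E. \<exists>!u. u \<in> Hom C Y X \<and> b \<cdot> u = f)"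

lemma id_func_full_subcat:
  assumes "S \<subseteq> Obj C"
  shows "covariant_functor (full_subcat C S) C id_func"
proof -
  interpret S: category "full_subcat C S" by (rule full_subcat_category [OF assms])
  show ?thesis
    using assms by unfold_locales (auto simp: id_func_def)
qed

lemma left_universal_isomorphic:
  assumes "left_universal S E X a" "left_universal S E X' a'" "S \<subseteq> Obj C"
  shows "isomorphic C X X'"
proof -
  have X: "X \<in> S" "a \<in> Hom C E X" and X': "X' \<in> S" "a' \<in> Hom C E X'"
    using assms by (auto simp: left_universal_def)
  have ex: "\<exists>!u. u \<in> Hom C X Y \<and> u \<cdot> a = f" if "Y \<in> S" "f \<in> Hom C E Y" for Y f
    using assms(1) that unfolding left_universal_def by blast
  have ex': "\<exists>!u. u \<in> Hom C X' Y \<and> u \<cdot> a' = f" if "Y \<in> S" "f \<in> Hom C E Y" for Y f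
    using assms(2) that unfolding left_universal_def by blast
  obtain u where u: "u \<in> Hom C X X'" "u \<cdot> a = a'" using ex [OF X'] by blast
  obtain v where v: "v \<in> Hom C X' X" "v \<cdot> a' = a" using ex' [OF X] by blast
  have "(v \<cdot> u) \<cdot> a = Ident C X \<cdot> a" "(u \<cdot> v) \<cdot> a' = Ident C X' \<cdot> a'"
    using u v X X' by (auto simp: assoc)
  moreover have "v \<cdot> u \<in> Hom C X X" "u \<cdot> v \<in> Hom C X' X'"
    "Ident C X \<in> Hom C X X" "Ident C X' \<in> Hom C X' X'"
    using u v X X' assms(3) by auto
  ultimately have "v \<cdot> u = Ident C X" "u \<cdot> v = Ident C X'"
    using ex [OF X] ex' [OF X'] X X' by (metis Ident_Comp)+
  with u v show ?thesis by (metis isomorphicI)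
qed

lemma right_universal_isomorphic:
  assumes "right_universal S E X b" "right_universal S E X' b'" "S \<subseteq> Obj C"
  shows "isomorphic C X X'"
proof -
  have X: "X \<in> S" "b \<in> Hom C X E" and X': "X' \<in> S" "b' \<in> Hom C X' E"
    using assms by (auto simp: right_universal_def)
  have ex: "\<exists>!u. u \<in> Hom C Y X \<and> b \<cdot> u = f" if "Y \<in> S" "f \<in> Hom C Y E" for Y f
    using assms(1) that unfolding right_universal_def by blast
  have ex': "\<exists>!u. u \<in> Hom C Y X' \<and> b' \<cdot> u = f" if "Y \<in> S" "f \<in> Hom C Y E" for Y f
    using assms(2) that unfolding right_universal_def by blast
  obtain u where u: "u \<in> Hom C X' X" "b \<cdot> u = b'" using ex [OF X'] by blast
  obtain v where v: "v \<in> Hom C X X'" "b' \<cdot> v = b" using ex' [OF X] by blast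
  have "b \<cdot> (u \<cdot> v) = b \<cdot> Ident C X" "b' \<cdot> (v \<cdot> u) = b' \<cdot> Ident C X'"
    using u v X X' by (auto simp: assoc [symmetric])
  moreover have "v \<cdot> u \<in> Hom C X' X'" "u \<cdot> v \<in> Hom C X X"
    "Ident C X \<in> Hom C X X" "Ident C X' \<in> Hom C X' X'"
    using u v X X' assms(3) by auto
  ultimately have "v \<cdot> u = Ident C X'" "u \<cdot> v = Ident C X"
    using ex [OF X] ex' [OF X'] X X' by (metis Comp_Ident)+
  with u v show ?thesis by (metis isomorphicI)
qed

text \<open>Yoneda: naturality of \<phi> gives \<open>\<phi> E Y u = u \<cdot> a\<close> for
  \<open>a\<close> the image of the identity, so bijectivity of \<phi> is the universal property of
  \<open>a\<close>.\<close>

lemma adjoint_left_universal: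
  assumes "adjoint C (full_subcat C S) F id_func" "S \<subseteq> Obj C" "E \<in> Obj C"
  shows "\<exists>a. left_universal S E (fobj F E) a"
proof -
  have F: "covariant_functor C (full_subcat C S) F"
    using assms(1) by (simp add: adjoint_def)
  obtain \<phi> where bij': "\<forall>X \<in> Obj C. \<forall>Y \<in> S.
       bij_betw (\<phi> X Y) (Hom (full_subcat C S) (fobj F X) Y) (Hom C X Y)"
    and nat': "\<forall>u \<in> Arr C. \<forall>v \<in> Arr (full_subcat C S).
       \<forall>h \<in> Hom (full_subcat C S) (fobj F (Cod C u)) (Dom C v).
        \<phi> (Dom C u) (Cod C v) (v \<cdot> h \<cdot> fmap F u) = v \<cdot> \<phi> (Cod C u) (Dom C v) h \<cdot> u"
    using assms(1) by (auto simp: adjoint_def id_func_def)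
  note bij = bij' [rule_format] and nat = nat' [rule_format]
  interpret F: covariant_functor C "full_subcat C S" F by (rule F)
  define X where "X = fobj F E"
  have X: "X \<in> S" using F.fobj_in assms(3) by (simp add: X_def)
  then have XO: "X \<in> Obj C" using assms(2) by blast
  define a where "a = \<phi> E X (Ident C X)"
  have a: "a \<in> Hom C E X"
    using bij_betwE [OF bij [OF assms(3) X]] X XO by (simp add: a_def X_def)
  have comp: "\<phi> E Y u = u \<cdot> a" if "u \<in> Hom C X Y" "Y \<in> S" for u Y
  proof -
    have "\<phi> E Y (u \<cdot> Ident C X \<cdot> Ident C X) = u \<cdot> a \<cdot> Ident C E"
      using nat [of "Ident C E" u "Ident C X"] that assms(3) X XO F.fmap_Ident [OF assms(3)]
      by (simp add: a_def X_def)
    then show ?thesis using that a X XO assms(3) by auto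
  qed
  have "\<exists>!u. u \<in> Hom C X Y \<and> u \<cdot> a = f" if "Y \<in> S" "f \<in> Hom C E Y" for Y f
  proof -
    have "bij_betw (\<phi> E Y) (Hom C X Y) (Hom C E Y)"
      using bij [OF assms(3) that(1)] X that(1) by (simp add: X_def Hom_full_subcat del: in_Hom_iff)
    then have "\<exists>!u. u \<in> Hom C X Y \<and> \<phi> E Y u = f"
      using that(2) by (rule bij_betw_ex1)
    then show ?thesis using comp that(1) by metis
  qed
  then show ?thesis
    using X a unfolding left_universal_def X_def by metis
qed

text \<open>Dual Yoneda argument: the counit is now the preimage of the identity, and \<phi> sends
  an arrow to its factorization through the counit.\<close>

lemma adjoint_right_universal:
  assumes "adjoint (full_subcat C S) C id_func G" "S \<subseteq> Obj C" "E \<in> Obj C"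
  shows "\<exists>b. right_universal S E (fobj G E) b"
proof -
  have G: "covariant_functor C (full_subcat C S) G"
    using assms(1) by (simp add: adjoint_def)
  obtain \<phi> where bij0: "\<forall>X \<in> S. \<forall>Y \<in> Obj C.
       bij_betw (\<phi> X Y) (Hom C X Y) (Hom (full_subcat C S) X (fobj G Y))"
    and nat0: "\<forall>u \<in> Arr (full_subcat C S). \<forall>v \<in> Arr C. \<forall>h \<in> Hom C (Cod C u) (Dom C v).
        \<phi> (Dom C u) (Cod C v) (v \<cdot> h \<cdot> u) = fmap G v \<cdot> \<phi> (Cod C u) (Dom C v) h \<cdot> u"
    using assms(1) by (auto simp: adjoint_def id_func_def)
  note bij = bij0 [rule_format] and nat = nat0 [rule_format]
  interpret G: covariant_functor C "full_subcat C S" G by (rule G)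
  define X where "X = fobj G E"
  have X: "X \<in> S" using G.fobj_in assms(3) by (simp add: X_def)
  then have XO: "X \<in> Obj C" using assms(2) by blast
  have bij': "bij_betw (\<phi> Y E) (Hom C Y E) (Hom C Y X)" if "Y \<in> S" for Y
    using bij [OF that assms(3)] X that by (simp add: X_def Hom_full_subcat del: in_Hom_iff)
  obtain b where b: "b \<in> Hom C X E" "\<phi> X E b = Ident C X"
    using bij_betw_ex1 [OF bij' [OF X] Ident_in [OF XO]] by blast
  have comp: "\<phi> Y E (b \<cdot> u) = u" if "u \<in> Hom C Y X" "Y \<in> S" for u Y
  proof -
    have "\<phi> Y E (Ident C E \<cdot> b \<cdot> u) = Ident C X \<cdot> Ident C X \<cdot> u"
      using nat [of u "Ident C E" b] that assms(3) X XO G.fmap_Ident [OF assms(3)] b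
      by (simp add: X_def)
    then show ?thesis using that b X XO assms(3) by auto
  qed
  have "\<exists>!u. u \<in> Hom C Y X \<and> b \<cdot> u = f" if "Y \<in> S" "f \<in> Hom C Y E" for Y f
  proof (rule ex1I [of _ "\<phi> Y E f"])
    have \<phi>: "\<phi> Y E f \<in> Hom C Y X" using bij_betwE [OF bij' [OF that(1)]] that(2) by blast
    moreover have "b \<cdot> \<phi> Y E f = f"
    proof (rule inj_onD [OF bij_betw_imp_inj_on [OF bij' [OF that(1)]]])
      show "\<phi> Y E (b \<cdot> \<phi> Y E f) = \<phi> Y E f" using comp \<phi> that(1) by blast
      show "b \<cdot> \<phi> Y E f \<in> Hom C Y E" using \<phi> b by auto
    qed (rule that(2))
    ultimately show "\<phi> Y E f \<in> Hom C Y X \<and> b \<cdot> \<phi> Y E f = f" ..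
  next
    fix u assume "u \<in> Hom C Y X \<and> b \<cdot> u = f"
    then show "u = \<phi> Y E f" using comp that(1) by auto
  qed
  then show ?thesis
    using X b unfolding right_universal_def X_def by metis
qed

text \<open>\<open>left_adjoint_of_inclusion\<close> is a \<open>SOME\<close> term and says nothing
  until an adjoint is known to exist. Universal arrows at all objects assemble to a functor, whose
  value on an arrow is forced by compatibility with the units.\<close>

lemma left_adjoint_exists:
  assumes S: "S \<subseteq> Obj C" and univ: "\<And>E. E \<in> Obj C \<Longrightarrow> \<exists>X a. left_universal S E X a"
  shows "\<exists>F. adjoint C (full_subcat C S) F id_func"
proof -
  interpret S: category "full_subcat C S" by (rule full_subcat_category [OF S])
  obtain R a where R: "\<And>E. E \<in> Obj C \<Longrightarrow> left_universal S E (R E) (a E)"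
    using univ by metis
  then have RS [simp]: "E \<in> Obj C \<Longrightarrow> R E \<in> S"
    and aA [simp]: "E \<in> Obj C \<Longrightarrow> a E \<in> Arr C" "E \<in> Obj C \<Longrightarrow> Dom C (a E) = E"
      "E \<in> Obj C \<Longrightarrow> Cod C (a E) = R E" for E
    by (auto simp: left_universal_def)
  have RO [simp]: "E \<in> Obj C \<Longrightarrow> R E \<in> Obj C" for E using RS S by blast
  have ex1: "\<exists>!u. u \<in> Hom C (R E) Y \<and> u \<cdot> a E = f" if "E \<in> Obj C" "Y \<in> S" "f \<in> Hom C E Y" for E Y f
    using R [OF that(1)] that unfolding left_universal_def by blast
  have eqI: "u = v" if "E \<in> Obj C" "u \<in> Arr C" "v \<in> Arr C" "Dom C u = R E" "Dom C v = R E"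
    "Cod C u = Cod C v" "Cod C v \<in> S" "u \<cdot> a E = v \<cdot> a E" for E u v
    using ex1 [of E "Cod C v" "v \<cdot> a E"] that by auto
  define F where "F = \<lparr>fobj = R, fmap = \<lambda>f. THE u. u \<in> Hom C (R (Dom C f)) (R (Cod C f)) \<and>
      u \<cdot> a (Dom C f) = a (Cod C f) \<cdot> f\<rparr>"
  have [simp]: "fobj F = R" by (simp add: F_def)
  have F: "fmap F f \<in> Hom C (R (Dom C f)) (R (Cod C f)) \<and> fmap F f \<cdot> a (Dom C f) = a (Cod C f) \<cdot> f"
    if "f \<in> Arr C" for f
  proof -
    have "\<exists>!u. u \<in> Hom C (R (Dom C f)) (R (Cod C f)) \<and> u \<cdot> a (Dom C f) = a (Cod C f) \<cdot> f"
      using that by (intro ex1) auto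
    then show ?thesis unfolding F_def func.simps by (rule theI')
  qed
  then have [simp]: "fmap F f \<in> Arr C" "Dom C (fmap F f) = R (Dom C f)" "Cod C (fmap F f) = R (Cod C f)"
    and Fa: "fmap F f \<cdot> a (Dom C f) = a (Cod C f) \<cdot> f" if "f \<in> Arr C" for f
    using that by auto
  have fu: "covariant_functor C (full_subcat C S) F"
  proof unfold_locales
    fix X assume X: "X \<in> Obj C"
    then show "fmap F (Ident C X) = Ident (full_subcat C S) (fobj F X)"
      using Fa [of "Ident C X"] by - (rule eqI [of X], auto)
  next
    fix f g X Y Z assume f: "f \<in> Hom C X Y" and g: "g \<in> Hom C Y Z"
    have "(fmap F g \<cdot> fmap F f) \<cdot> a X = fmap F g \<cdot> (a Y \<cdot> f)"
      using f g Fa [of f] by (auto simp: assoc)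
    also have "\<dots> = (fmap F g \<cdot> a Y) \<cdot> f"
      using f g by (auto simp: assoc)
    also have "\<dots> = (a Z \<cdot> g) \<cdot> f"
      using f g Fa [of g] by auto
    also have "\<dots> = a Z \<cdot> (g \<cdot> f)"
      using f g by (auto simp: assoc)
    also have "\<dots> = fmap F (g \<cdot> f) \<cdot> a X"
      using Fa [of "g \<cdot> f"] f g by auto
    finally show "fmap F (g \<cdot> f) = fmap F g \<cdot>\<^bsub>full_subcat C S\<^esub> fmap F f"
      using f g by - (rule eqI [of X], auto)
  qed auto
  have "bij_betw (\<lambda>u. u \<cdot> a X) (Hom (full_subcat C S) (R X) Y) (Hom C X Y)"
    if "X \<in> Obj C" "Y \<in> S" for X Y
    unfolding bij_betw_def
  proof
    show "inj_on (\<lambda>u. u \<cdot> a X) (Hom (full_subcat C S) (R X) Y)"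
      using that by - (rule inj_onI, rule eqI [of X], auto)
    have "f \<in> (\<lambda>u. u \<cdot> a X) ` Hom (full_subcat C S) (R X) Y" if f: "f \<in> Hom C X Y" for f
    proof -
      obtain u where "u \<in> Hom C (R X) Y" "u \<cdot> a X = f"
        using ex1 [OF \<open>X \<in> Obj C\<close> \<open>Y \<in> S\<close> f] by blast
      then show ?thesis
        using \<open>X \<in> Obj C\<close> \<open>Y \<in> S\<close> by (intro image_eqI [of _ _ u]) auto
    qed
    then show "(\<lambda>u. u \<cdot> a X) ` Hom (full_subcat C S) (R X) Y = Hom C X Y"
      using that by auto
  qed
  moreover have "(v \<cdot> h \<cdot> fmap F u) \<cdot> a (Dom C u) = v \<cdot> (h \<cdot> a (Cod C u)) \<cdot> u"
    if "u \<in> Arr C" "v \<in> Arr C" "h \<in> Hom C (R (Cod C u)) (Dom C v)" for u v h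
    using that by (auto simp: assoc Fa)
  ultimately have "adjoint C (full_subcat C S) F id_func"
    unfolding adjoint_def using fu id_func_full_subcat [OF S]
    by (intro conjI exI [of _ "\<lambda>X Y u. u \<cdot> a X"]) (auto simp: id_func_def)
  then show ?thesis ..
qed

lemma right_adjoint_exists:
  assumes S: "S \<subseteq> Obj C" and univ: "\<And>E. E \<in> Obj C \<Longrightarrow> \<exists>X b. right_universal S E X b"
  shows "\<exists>G. adjoint (full_subcat C S) C id_func G"
proof -
  interpret S: category "full_subcat C S" by (rule full_subcat_category [OF S])
  obtain R b where R: "\<And>E. E \<in> Obj C \<Longrightarrow> right_universal S E (R E) (b E)"
    using univ by metis
  then have RS [simp]: "E \<in> Obj C \<Longrightarrow> R E \<in> S"
    and bA [simp]: "E \<in> Obj C \<Longrightarrow> b E \<in> Arr C" "E \<in> Obj C \<Longrightarrow> Dom C (b E) = R E"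
      "E \<in> Obj C \<Longrightarrow> Cod C (b E) = E" for E
    by (auto simp: right_universal_def)
  have RO [simp]: "E \<in> Obj C \<Longrightarrow> R E \<in> Obj C" for E using RS S by blast
  have ex1: "\<exists>!u. u \<in> Hom C Y (R E) \<and> b E \<cdot> u = f" if "E \<in> Obj C" "Y \<in> S" "f \<in> Hom C Y E" for E Y f
    using R [OF that(1)] that unfolding right_universal_def by blast
  have eqI: "u = v" if "E \<in> Obj C" "u \<in> Arr C" "v \<in> Arr C" "Cod C u = R E" "Cod C v = R E"
    "Dom C u = Dom C v" "Dom C v \<in> S" "b E \<cdot> u = b E \<cdot> v" for E u v
    using ex1 [of E "Dom C v" "b E \<cdot> v"] that by auto
  define lift where "lift E Y f = (THE u. u \<in> Hom C Y (R E) \<and> b E \<cdot> u = f)" for E Y f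
  have lift: "lift E Y f \<in> Hom C Y (R E) \<and> b E \<cdot> lift E Y f = f"
    if "E \<in> Obj C" "Y \<in> S" "f \<in> Hom C Y E" for E Y f
    unfolding lift_def using ex1 [OF that] by (rule theI')
  define G where "G = \<lparr>fobj = R, fmap = \<lambda>f. lift (Cod C f) (R (Dom C f)) (f \<cdot> b (Dom C f))\<rparr>"
  have [simp]: "fobj G = R" by (simp add: G_def)
  have G: "fmap G f \<in> Hom C (R (Dom C f)) (R (Cod C f)) \<and> b (Cod C f) \<cdot> fmap G f = f \<cdot> b (Dom C f)"
    if "f \<in> Arr C" for f
    unfolding G_def func.simps using that by (intro lift) auto
  then have [simp]: "fmap G f \<in> Arr C" "Dom C (fmap G f) = R (Dom C f)" "Cod C (fmap G f) = R (Cod C f)"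
    and bG: "b (Cod C f) \<cdot> fmap G f = f \<cdot> b (Dom C f)" if "f \<in> Arr C" for f
    using that by auto
  have bG': "b (Cod C f) \<cdot> (fmap G f \<cdot> x) = f \<cdot> (b (Dom C f) \<cdot> x)"
    if "f \<in> Arr C" "x \<in> Arr C" "Cod C x = R (Dom C f)" for f x
    using that bG [OF that(1)] assoc [of x "fmap G f" "b (Cod C f)"] assoc [of x "b (Dom C f)" f] by simp
  have fu: "covariant_functor C (full_subcat C S) G"
  proof unfold_locales
    fix X assume X: "X \<in> Obj C"
    then show "fmap G (Ident C X) = Ident (full_subcat C S) (fobj G X)"
      using bG [of "Ident C X"] by - (rule eqI [of X], auto)
  next
    fix f g X Y Z assume f: "f \<in> Hom C X Y" and g: "g \<in> Hom C Y Z"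
    have "b Z \<cdot> (fmap G g \<cdot> fmap G f) = g \<cdot> (f \<cdot> b X)"
      using f g bG' [of g "fmap G f"] bG [of f] by auto
    also have "\<dots> = b Z \<cdot> fmap G (g \<cdot> f)"
      using bG [of "g \<cdot> f"] f g by (auto simp: assoc)
    finally show "fmap G (g \<cdot> f) = fmap G g \<cdot>\<^bsub>full_subcat C S\<^esub> fmap G f"
      using f g by - (rule eqI [of Z], auto)
  qed auto
  \<comment> \<open>The orientation of \<open>adjoint\<close> requires a map from arrows into
    \<open>Y\<close> to arrows into \<open>R Y\<close>, so the bijection is factorization through
    the counit, with composition as its inverse.\<close>
  have "bij_betw (lift Y X) (Hom C X Y) (Hom (full_subcat C S) X (R Y))"
    if "X \<in> S" "Y \<in> Obj C" for X Y
  proof (rule bij_betw_byWitness [where f' = "\<lambda>u. b Y \<cdot> u"])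
    have "lift Y X (b Y \<cdot> u) = u" if u: "u \<in> Hom C X (R Y)" for u
      using lift [OF \<open>Y \<in> Obj C\<close> \<open>X \<in> S\<close>, of "b Y \<cdot> u"] \<open>Y \<in> Obj C\<close> \<open>X \<in> S\<close> u by - (rule eqI [of Y], auto)
    with that show "\<forall>u \<in> Hom (full_subcat C S) X (R Y). lift Y X (b Y \<cdot> u) = u"
      by auto
  qed (use lift [OF that(2,1)] that in auto)
  moreover have "lift (Cod C v) (Dom C u) (v \<cdot> h \<cdot> u) = fmap G v \<cdot> lift (Dom C v) (Cod C u) h \<cdot> u"
    if "u \<in> Arr C" "Dom C u \<in> S" "Cod C u \<in> S" "v \<in> Arr C" "h \<in> Hom C (Cod C u) (Dom C v)" for u v h
  proof -
    have 1: "lift (Cod C v) (Dom C u) (v \<cdot> h \<cdot> u) \<in> Hom C (Dom C u) (R (Cod C v)) \<and>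
        b (Cod C v) \<cdot> lift (Cod C v) (Dom C u) (v \<cdot> h \<cdot> u) = v \<cdot> h \<cdot> u"
      using that by (intro lift) auto
    have 2: "lift (Dom C v) (Cod C u) h \<in> Hom C (Cod C u) (R (Dom C v)) \<and>
        b (Dom C v) \<cdot> lift (Dom C v) (Cod C u) h = h"
      using that by (intro lift) auto
    have "b (Dom C v) \<cdot> lift (Dom C v) (Cod C u) h \<cdot> u = h \<cdot> u"
      using 2 that assoc [of u "lift (Dom C v) (Cod C u) h" "b (Dom C v)"] by auto
    with 1 2 that show ?thesis
      by - (rule eqI [of "Cod C v"], auto simp: bG')
  qed
  ultimately have "adjoint (full_subcat C S) C id_func G"
    unfolding adjoint_def using fu id_func_full_subcat [OF S]
    by (intro conjI exI [of _ "\<lambda>X Y. lift Y X"]) (auto simp: id_func_def)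
  then show ?thesis ..
qed

end

section \<open>Values of the chosen adjoints\<close>

context triangulated_category
begin

text \<open>Any adjoint that \<open>SOME\<close> may return carries a universal arrow at
  \<open>E\<close>, and universal arrows are unique up to isomorphism; so its value can be computed
  from any universal arrow at hand.\<close>

lemma left_adjoint_of_inclusion_isomorphic:
  assumes S: "S \<subseteq> Obj D" and univ: "\<And>E. E \<in> Obj D \<Longrightarrow> \<exists>X a. left_universal S E X a"
    and "left_universal S E X a" "E \<in> Obj D"
  shows "fobj (left_adjoint_of_inclusion D S) E \<in> S"
    "isomorphic D (fobj (left_adjoint_of_inclusion D S) E) X"
proof -
  have "adjoint D (full_subcat D S) (left_adjoint_of_inclusion D S) id_func"
    unfolding left_adjoint_of_inclusion_def using left_adjoint_exists [OF S univ] by (rule someI_ex)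
  then obtain a' where "left_universal S E (fobj (left_adjoint_of_inclusion D S) E) a'"
    using adjoint_left_universal assms(4) S by blast
  then show "fobj (left_adjoint_of_inclusion D S) E \<in> S"
    by (simp add: left_universal_def)
  show "isomorphic D (fobj (left_adjoint_of_inclusion D S) E) X"
    by (rule left_universal_isomorphic) fact+
qed

lemma right_adjoint_of_inclusion_isomorphic:
  assumes S: "S \<subseteq> Obj D" and univ: "\<And>E. E \<in> Obj D \<Longrightarrow> \<exists>X b. right_universal S E X b"
    and "right_universal S E X b" "E \<in> Obj D"
  shows "fobj (right_adjoint_of_inclusion D S) E \<in> S"
    "isomorphic D (fobj (right_adjoint_of_inclusion D S) E) X"
proof -
  have "adjoint (full_subcat D S) D id_func (right_adjoint_of_inclusion D S)"
    unfolding right_adjoint_of_inclusion_def using right_adjoint_exists [OF S univ] by (rule someI_ex)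
  then obtain b' where "right_universal S E (fobj (right_adjoint_of_inclusion D S) E) b'"
    using adjoint_right_universal assms(4) S by blast
  then show "fobj (right_adjoint_of_inclusion D S) E \<in> S"
    by (simp add: right_universal_def)
  show "isomorphic D (fobj (right_adjoint_of_inclusion D S) E) X"
    by (rule right_universal_isomorphic) fact+
qed

end

section \<open>Preadditive and triangulated categories\<close>

context preadditive_category
begin

lemma carrier_hom_group [simp]: "carrier (hom_group C X Y) = Hom C X Y"
  and mult_hom_group [simp]: "mult (hom_group C X Y) = Plus C"
  and one_hom_group [simp]: "one (hom_group C X Y) = Zero C X Y"
  by (simp_all add: hom_group_def)

lemma Zero_Arr [simp]: "\<lbrakk>X \<in> Obj C; Y \<in> Obj C\<rbrakk> \<Longrightarrow> Zero C X Y \<in> Arr C"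
  and Dom_Zero [simp]: "\<lbrakk>X \<in> Obj C; Y \<in> Obj C\<rbrakk> \<Longrightarrow> Dom C (Zero C X Y) = X"
  and Cod_Zero [simp]: "\<lbrakk>X \<in> Obj C; Y \<in> Obj C\<rbrakk> \<Longrightarrow> Cod C (Zero C X Y) = Y"
proof -
  assume "X \<in> Obj C" "Y \<in> Obj C"
  then interpret comm_group "hom_group C X Y" by (rule hom_comm_group)
  show "Zero C X Y \<in> Arr C" "Dom C (Zero C X Y) = X" "Cod C (Zero C X Y) = Y"
    using one_closed by auto
qed

context
  fixes f g
  assumes f: "f \<in> Arr C" and g: "g \<in> Arr C" and D: "Dom C f = Dom C g" and C: "Cod C f = Cod C g"
begin

interpretation comm_group "hom_group C (Dom C g) (Cod C g)"
  by (rule hom_comm_group) (use g in auto)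

lemma Plus_Arr [simp]: "Plus C f g \<in> Arr C"
  and Dom_Plus [simp]: "Dom C (Plus C f g) = Dom C g"
  and Cod_Plus [simp]: "Cod C (Plus C f g) = Cod C g"
  using m_closed [of f g] f g D C by auto

lemma Plus_commute: "Plus C f g = Plus C g f"
  using m_comm [of f g] f g D C by auto

lemma Plus_assoc:
  "\<lbrakk>h \<in> Arr C; Dom C h = Dom C g; Cod C h = Cod C g\<rbrakk> \<Longrightarrow> Plus C (Plus C f g) h = Plus C f (Plus C g h)"
  using m_assoc [of f g h] f g D C by auto

end

context
  fixes f
  assumes f: "f \<in> Arr C"
begin

interpretation comm_group "hom_group C (Dom C f) (Cod C f)"
  by (rule hom_comm_group) (use f in auto)

lemma Neg_Arr [simp]: "Neg C f \<in> Arr C"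
  and Dom_Neg [simp]: "Dom C (Neg C f) = Dom C f"
  and Cod_Neg [simp]: "Cod C (Neg C f) = Cod C f"
  using inv_closed [of f] f by (auto simp: Neg_def)

lemma Plus_Neg [simp]: "Plus C f (Neg C f) = Zero C (Dom C f) (Cod C f)"
  using r_inv [of f] f by (simp add: Neg_def)

lemma Neg_Plus [simp]: "Plus C (Neg C f) f = Zero C (Dom C f) (Cod C f)"
  using l_inv [of f] f by (simp add: Neg_def)

lemma Plus_Zero: "\<lbrakk>Dom C f = X; Cod C f = Y\<rbrakk> \<Longrightarrow> Plus C f (Zero C X Y) = f"
  using r_one [of f] f by simp

lemma Zero_Plus: "\<lbrakk>Dom C f = X; Cod C f = Y\<rbrakk> \<Longrightarrow> Plus C (Zero C X Y) f = f"
  using l_one [of f] f by simp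

lemma Neg_unique:
  "\<lbrakk>g \<in> Arr C; Dom C g = Dom C f; Cod C g = Cod C f; Plus C g f = Zero C (Dom C f) (Cod C f)\<rbrakk>
    \<Longrightarrow> g = Neg C f"
  using inv_equality [of g f] f by (simp add: Neg_def)

lemma Neg_Neg [simp]: "Neg C (Neg C f) = f"
  using inv_inv [of f] f by (simp add: Neg_def Neg_Arr [unfolded Neg_def] Dom_Neg [unfolded Neg_def] Cod_Neg [unfolded Neg_def])

lemma Plus_idem_Zero: "Plus C f f = f \<Longrightarrow> f = Zero C (Dom C f) (Cod C f)"
  using r_cancel_one' [of f f] f by simp

end

declare Plus_Zero [simp] Zero_Plus [simp]

lemma Neg_inj: "\<lbrakk>f \<in> Arr C; g \<in> Arr C; Neg C f = Neg C g\<rbrakk> \<Longrightarrow> f = g"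
  by (metis Neg_Neg)

lemma Minus_eq_Zero:
  assumes "f \<in> Arr C" "g \<in> Arr C" "Dom C f = Dom C g" "Cod C f = Cod C g"
    "Plus C f (Neg C g) = Zero C (Dom C g) (Cod C g)"
  shows "f = g"
  using Neg_unique [of "Neg C g" f] assms by simp

lemma Comp_Plus' [simp]:
  "\<lbrakk>f \<in> Arr C; f' \<in> Arr C; g \<in> Arr C; Dom C f = Dom C f'; Cod C f = Cod C f'; Cod C f' = Dom C g\<rbrakk>
    \<Longrightarrow> g \<cdot> Plus C f f' = Plus C (g \<cdot> f) (g \<cdot> f')"
  using Comp_Plus [of f "Dom C f" "Cod C f" f' g "Cod C g"] by simp

lemma Plus_Comp' [simp]:
  "\<lbrakk>g \<in> Arr C; g' \<in> Arr C; f \<in> Arr C; Dom C g = Dom C g'; Cod C g = Cod C g'; Cod C f = Dom C g'\<rbrakk>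
    \<Longrightarrow> Plus C g g' \<cdot> f = Plus C (g \<cdot> f) (g' \<cdot> f)"
  using Plus_Comp [of f "Dom C f" "Cod C f" g "Cod C g" g'] by simp

lemma Comp_Zero [simp]:
  assumes "f \<in> Arr C" "X \<in> Obj C" "Dom C f = Y"
  shows "f \<cdot> Zero C X Y = Zero C X (Cod C f)"
proof -
  have Y: "Y \<in> Obj C" using assms by auto
  have "Plus C (f \<cdot> Zero C X Y) (f \<cdot> Zero C X Y) = f \<cdot> Plus C (Zero C X Y) (Zero C X Y)"
    using assms Y by (intro Comp_Plus' [symmetric]) auto
  then show ?thesis
    using Plus_idem_Zero [of "f \<cdot> Zero C X Y"] assms Y by simp
qed

lemma Zero_Comp [simp]:
  assumes "f \<in> Arr C" "Z \<in> Obj C" "Cod C f = Y"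
  shows "Zero C Y Z \<cdot> f = Zero C (Dom C f) Z"
proof -
  have Y: "Y \<in> Obj C" using assms by auto
  have "Plus C (Zero C Y Z \<cdot> f) (Zero C Y Z \<cdot> f) = Plus C (Zero C Y Z) (Zero C Y Z) \<cdot> f"
    using assms Y by (intro Plus_Comp' [symmetric]) auto
  then show ?thesis
    using Plus_idem_Zero [of "Zero C Y Z \<cdot> f"] assms Y by simp
qed

lemma Comp_Neg [simp]:
  assumes "f \<in> Arr C" "g \<in> Arr C" "Cod C f = Dom C g"
  shows "g \<cdot> Neg C f = Neg C (g \<cdot> f)"
proof (rule Neg_unique)
  have "Plus C (g \<cdot> Neg C f) (g \<cdot> f) = g \<cdot> Plus C (Neg C f) f"
    using assms by (intro Comp_Plus' [symmetric]) auto
  then show "Plus C (g \<cdot> Neg C f) (g \<cdot> f) = Zero C (Dom C (g \<cdot> f)) (Cod C (g \<cdot> f))"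
    using assms by simp
qed (use assms in auto)

lemma Neg_Comp [simp]:
  assumes "f \<in> Arr C" "g \<in> Arr C" "Cod C f = Dom C g"
  shows "Neg C g \<cdot> f = Neg C (g \<cdot> f)"
proof (rule Neg_unique)
  have "Plus C (Neg C g \<cdot> f) (g \<cdot> f) = Plus C (Neg C g) g \<cdot> f"
    using assms by (intro Plus_Comp' [symmetric]) auto
  then show "Plus C (Neg C g \<cdot> f) (g \<cdot> f) = Zero C (Dom C (g \<cdot> f)) (Cod C (g \<cdot> f))"
    using assms by simp
qed (use assms in auto)

lemma Neg_Zero [simp]:
  assumes "X \<in> Obj C" "Y \<in> Obj C"
  shows "Neg C (Zero C X Y) = Zero C X Y"
  using Neg_unique [of "Zero C X Y" "Zero C X Y"] assms by simp

lemma Neg_eq_Zero: "\<lbrakk>f \<in> Arr C; Dom C f = X; Cod C f = Y; Neg C f = Zero C X Y\<rbrakk> \<Longrightarrow> f = Zero C X Y"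
  using Neg_Neg [of f] by auto

text \<open>Linearity reduces the claim to the difference of \<open>u\<close> and \<open>v\<close>.
  The hypothesis is tied to a single source \<open>T\<close>, so that vanishing known only on the
  heart suffices.\<close>

lemma cancel_left:
  assumes zero: "\<And>u. \<lbrakk>u \<in> Hom C T (Dom C f); f \<cdot> u = Zero C T (Cod C f)\<rbrakk> \<Longrightarrow> u = Zero C T (Dom C f)"
    and "f \<in> Arr C" "u \<in> Hom C T (Dom C f)" "v \<in> Hom C T (Dom C f)" "f \<cdot> u = f \<cdot> v"
  shows "u = v"
proof (rule Minus_eq_Zero)
  show "Plus C u (Neg C v) = Zero C (Dom C v) (Cod C v)"
    using zero [of "Plus C u (Neg C v)"] assms(2-) by auto
qed (use assms in auto)

lemma cancel_right:
  assumes zero: "\<And>u. \<lbrakk>u \<in> Hom C (Cod C f) W; u \<cdot> f = Zero C (Dom C f) W\<rbrakk> \<Longrightarrow> u = Zero C (Cod C f) W"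
    and "f \<in> Arr C" "u \<in> Hom C (Cod C f) W" "v \<in> Hom C (Cod C f) W" "u \<cdot> f = v \<cdot> f"
  shows "u = v"
proof (rule Minus_eq_Zero)
  show "Plus C u (Neg C v) = Zero C (Dom C v) (Cod C v)"
    using zero [of "Plus C u (Neg C v)"] assms(2-) by auto
qed (use assms in auto)

lemma zero_object_Zero:
  assumes "zero_object C Z" "X \<in> Obj C"
  shows zero_object_Cod: "\<lbrakk>f \<in> Arr C; Dom C f = X; Cod C f = Z\<rbrakk> \<Longrightarrow> f = Zero C X Z"
    and zero_object_Dom: "\<lbrakk>f \<in> Arr C; Dom C f = Z; Cod C f = X\<rbrakk> \<Longrightarrow> f = Zero C Z X"
proof -
  have "Z \<in> Obj C" "\<exists>!f. f \<in> Hom C X Z" "\<exists>!f. f \<in> Hom C Z X"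
    using assms by (auto simp: zero_object_def)
  then show "\<lbrakk>f \<in> Arr C; Dom C f = X; Cod C f = Z\<rbrakk> \<Longrightarrow> f = Zero C X Z"
      "\<lbrakk>f \<in> Arr C; Dom C f = Z; Cod C f = X\<rbrakk> \<Longrightarrow> f = Zero C Z X"
    using assms(2) Zero_Arr Dom_Zero Cod_Zero by (metis in_Hom_iff)+
qed

end

section \<open>Exactness of triangles and completion of maps of triangles\<close>

context triangulated_category
begin

sublocale shift: covariant_functor D D "Shift D"
  using Shift_equivalence by (simp add: equivalence_def)

abbreviation shift_obj ("\<Sigma>") where "\<Sigma> X \<equiv> fobj (Shift D) X"
abbreviation shift_arr ("\<sigma>") where "\<sigma> f \<equiv> fmap (Shift D) f"

lemmas shift_faithful = equivalence_faithful [OF Shift_equivalence]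
  and shift_full = equivalence_full [OF Shift_equivalence]
  and shift_ess_surj = equivalence_ess_surj [OF Shift_equivalence]
  and shift_Comp = shift.fmap_Comp'

lemma shift_Plus: "\<lbrakk>f \<in> Arr D; g \<in> Arr D; Dom D f = Dom D g; Cod D f = Cod D g\<rbrakk>
    \<Longrightarrow> \<sigma> (Plus D f g) = Plus D (\<sigma> f) (\<sigma> g)"
  using Shift_additive [of f "Dom D f" "Cod D f" g] by simp

lemma shift_Zero [simp]:
  assumes "X \<in> Obj D" "Y \<in> Obj D"
  shows "\<sigma> (Zero D X Y) = Zero D (\<Sigma> X) (\<Sigma> Y)"
  using Plus_idem_Zero [of "\<sigma> (Zero D X Y)"] shift_Plus [of "Zero D X Y" "Zero D X Y"] assms by simp

lemma shift_eq_Zero: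
  assumes "f \<in> Arr D" "Dom D f = X" "Cod D f = Y" "\<sigma> f = Zero D (\<Sigma> X) (\<Sigma> Y)"
  shows "f = Zero D X Y"
  using assms by - (rule shift_faithful, auto)

lemma Dist_Arr:
  assumes "(f, g, h) \<in> Dist D"
  shows "f \<in> Arr D" "g \<in> Arr D" "h \<in> Arr D" "Dom D g = Cod D f" "Dom D h = Cod D g"
    "Cod D h = \<Sigma> (Dom D f)"
  using Dist_triangle [OF assms] by (auto simp: triangle_def)

lemma rotate: "(f, g, h) \<in> Dist D \<Longrightarrow> (g, h, Neg D (\<sigma> f)) \<in> Dist D"
  using TR2 Dist_triangle by blast

lemma rotate_inverse: "\<lbrakk>triangle D f g h; (g, h, Neg D (\<sigma> f)) \<in> Dist D\<rbrakk> \<Longrightarrow> (f, g, h) \<in> Dist D"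
  using TR2 by blast

text \<open>TR3, applied from the triangle of the identity of \<open>Dom D f\<close> to the given
  one, makes the composite factor through a zero object.\<close>

lemma Dist_Comp_Zero:
  assumes fgh: "(f, g, h) \<in> Dist D"
  shows "g \<cdot> f = Zero D (Dom D f) (Cod D g)"
proof -
  note [simp] = Dist_Arr [OF fgh]
  obtain Z where Z: "zero_object D Z"
    "(Ident D (Dom D f), Zero D (Dom D f) Z, Zero D Z (\<Sigma> (Dom D f))) \<in> Dist D"
    using TR1_Ident [of "Dom D f"] by auto
  then have [simp]: "Z \<in> Obj D" by (simp add: zero_object_def)
  obtain c where "c \<in> Hom D Z (Cod D g)" "c \<cdot> Zero D (Dom D f) Z = g \<cdot> f"
    using TR3 [OF Z(2) fgh, of "Ident D (Dom D f)" f] by auto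
  then show ?thesis by auto
qed

text \<open>TR3 only fills in third vertices, so the triangle of the identity of
  \<open>Dom D u\<close> and the given triangle are both rotated once. The filler is then an arrow
  between shifts; it is desuspended by fullness, and the signs from the two rotations
  cancel.\<close>

lemma weak_kernel:
  assumes fgh: "(f, g, h) \<in> Dist D"
    and u: "u \<in> Arr D" "Cod D u = Cod D f" "g \<cdot> u = Zero D (Dom D u) (Cod D g)"
  shows "\<exists>v \<in> Hom D (Dom D u) (Dom D f). f \<cdot> v = u"
proof -
  note [simp] = Dist_Arr [OF fgh] u
  obtain Z where Z: "zero_object D Z"
    "(Ident D (Dom D u), Zero D (Dom D u) Z, Zero D Z (\<Sigma> (Dom D u))) \<in> Dist D"
    using TR1_Ident [of "Dom D u"] by auto
  then have [simp]: "Z \<in> Obj D" by (simp add: zero_object_def)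
  obtain c where c: "c \<in> Hom D (\<Sigma> (Dom D u)) (\<Sigma> (Dom D f))"
      "\<sigma> u \<cdot> Neg D (\<sigma> (Ident D (Dom D u))) = Neg D (\<sigma> f) \<cdot> c"
    using TR3 [OF rotate [OF Z(2)] rotate [OF fgh], of u "Zero D Z (Cod D g)"] by auto
  obtain v where v: "v \<in> Hom D (Dom D u) (Dom D f)" "\<sigma> v = c"
    using shift_full [of "Dom D u" "Dom D f" c] c(1) by auto
  have "Neg D (\<sigma> u) = Neg D (\<sigma> f \<cdot> c)"
    using c by (simp add: shift.fmap_Ident)
  then have "\<sigma> u = \<sigma> f \<cdot> c"
    using c by - (rule Neg_inj, auto)
  then have "f \<cdot> v = u"
    using v by - (rule shift_faithful, auto simp: shift_Comp)
  with v show ?thesis by blast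
qed

text \<open>The axiom has the identity as first arrow; \<open>weak_cokernel\<close> needs a target
  triangle with the identity in second place.\<close>

lemma Zero_Ident_Dist:
  assumes W: "W \<in> Obj D"
  shows "\<exists>Z. zero_object D Z \<and> (Zero D Z W, Ident D W, Zero D W (\<Sigma> Z)) \<in> Dist D"
proof -
  obtain Z where Z: "zero_object D Z" "(Ident D W, Zero D W Z, Zero D Z (\<Sigma> W)) \<in> Dist D"
    using TR1_Ident [OF W] by auto
  then have [simp]: "Z \<in> Obj D" by (simp add: zero_object_def)
  note W [simp]
  have ZZ: "Ident D Z = Zero D Z Z"
    using zero_object_Cod [OF Z(1), of Z "Ident D Z"] by simp
  then have SZ: "Ident D (\<Sigma> Z) = Zero D (\<Sigma> Z) (\<Sigma> Z)"
    by (metis \<open>Z \<in> Obj D\<close> shift.fmap_Ident shift_Zero)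
  \<comment> \<open>\<open>Z\<close> and \<open>\<Sigma> Z\<close> are both zero objects, so the
    third vertex may be replaced by a shift, which makes inverse rotation applicable.\<close>
  have "(Ident D W, Zero D W (\<Sigma> Z), Neg D (\<sigma> (Zero D Z W))) \<in> Dist D"
  proof (rule TR1_iso [OF Z(2), where a = "Ident D W" and b = "Ident D W" and c = "Zero D Z (\<Sigma> Z)"])
    show "is_iso D (Zero D Z (\<Sigma> Z))"
      by (rule is_isoI [where X = Z and Y = "\<Sigma> Z" and g = "Zero D (\<Sigma> Z) Z"]) (auto simp: ZZ SZ)
  qed (auto simp: triangle_def Ident_is_iso shift.fmap_Ident)
  then have "(Zero D Z W, Ident D W, Zero D W (\<Sigma> Z)) \<in> Dist D"
    by - (rule rotate_inverse, auto simp: triangle_def)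
  with Z show ?thesis by blast
qed

text \<open>A map of triangles to 0 -> W -> W with \<open>u\<close> on the middle vertex. The wanted
  arrow sits on the third vertex, so TR3 gives it directly.\<close>

lemma weak_cokernel:
  assumes fgh: "(f, g, h) \<in> Dist D"
    and u: "u \<in> Arr D" "Dom D u = Cod D f" "u \<cdot> f = Zero D (Dom D f) (Cod D u)"
  shows "\<exists>v \<in> Hom D (Cod D g) (Cod D u). v \<cdot> g = u"
proof -
  note [simp] = Dist_Arr [OF fgh] u
  obtain Z where Z: "zero_object D Z"
    "(Zero D Z (Cod D u), Ident D (Cod D u), Zero D (Cod D u) (\<Sigma> Z)) \<in> Dist D"
    using Zero_Ident_Dist [of "Cod D u"] by auto
  then have [simp]: "Z \<in> Obj D" by (simp add: zero_object_def)
  have "\<exists>c \<in> Hom D (Dom D h) (Dom D (Zero D (Cod D u) (\<Sigma> Z))).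
      c \<cdot> g = Ident D (Cod D u) \<cdot> u \<and> \<sigma> (Zero D (Dom D f) Z) \<cdot> h = Zero D (Cod D u) (\<Sigma> Z) \<cdot> c"
    by (rule TR3 [OF fgh Z(2)]) simp_all
  then show ?thesis by (simp add: Bex_def)
qed

text \<open>After two rotations the middle vertex becomes the third one, where TR3 applies; the
  filler is an arrow between shifts and comes from \<open>D\<close> by fullness.\<close>

lemma fill_middle:
  assumes fgh: "(f, g, h) \<in> Dist D" and fgh': "(f', g', h') \<in> Dist D"
    and a: "a \<in> Hom D (Dom D f) (Dom D f')" and c: "c \<in> Hom D (Cod D g) (Cod D g')"
    and comm: "\<sigma> a \<cdot> h = h' \<cdot> c"
  shows "\<exists>b \<in> Hom D (Cod D f) (Cod D f'). b \<cdot> f = f' \<cdot> a \<and> g' \<cdot> b = c \<cdot> g"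
proof -
  note [simp] = Dist_Arr [OF fgh] Dist_Arr [OF fgh']
  have [simp]: "a \<in> Arr D" "Dom D a = Dom D f" "Cod D a = Dom D f'"
    "c \<in> Arr D" "Dom D c = Cod D g" "Cod D c = Cod D g'"
    using a c by auto
  obtain c' where c': "c' \<in> Hom D (\<Sigma> (Cod D f)) (\<Sigma> (Cod D f'))"
      "c' \<cdot> Neg D (\<sigma> f) = Neg D (\<sigma> f') \<cdot> \<sigma> a" "\<sigma> c \<cdot> Neg D (\<sigma> g) = Neg D (\<sigma> g') \<cdot> c'"
    using TR3 [OF rotate [OF rotate [OF fgh]] rotate [OF rotate [OF fgh']], of c "\<sigma> a"] comm by auto
  obtain b where b: "b \<in> Hom D (Cod D f) (Cod D f')" "\<sigma> b = c'"
    using shift_full [of "Cod D f" "Cod D f'" c'] c'(1) by auto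
  have "Neg D (\<sigma> (b \<cdot> f)) = Neg D (\<sigma> (f' \<cdot> a))" "Neg D (\<sigma> (g' \<cdot> b)) = Neg D (\<sigma> (c \<cdot> g))"
    using b c' by (auto simp: shift_Comp)
  then have "\<sigma> (b \<cdot> f) = \<sigma> (f' \<cdot> a)" "\<sigma> (g' \<cdot> b) = \<sigma> (c \<cdot> g)"
    using b Neg_inj [of "\<sigma> (b \<cdot> f)" "\<sigma> (f' \<cdot> a)"] Neg_inj [of "\<sigma> (g' \<cdot> b)" "\<sigma> (c \<cdot> g)"] by auto
  then have "b \<cdot> f = f' \<cdot> a" "g' \<cdot> b = c \<cdot> g"
    using b shift_faithful [of "b \<cdot> f" "f' \<cdot> a"] shift_faithful [of "g' \<cdot> b" "c \<cdot> g"] by auto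
  with b show ?thesis by blast
qed

text \<open>The cone axiom puts \<open>h\<close> first, so its triangle is rotated back twice. The
  cone is first replaced by an isomorphic \<open>\<Sigma> Y\<close>, because an object need not be a
  shift on the nose.\<close>

lemma exists_Dist:
  assumes X: "X \<in> Obj D" and h: "h \<in> Arr D" "Cod D h = \<Sigma> X"
  shows "\<exists>f g. (f, g, h) \<in> Dist D \<and> Dom D f = X"
proof -
  note [simp] = X h
  obtain u v where uv: "(h, u, v) \<in> Dist D" using TR1_cone [OF h(1)] by blast
  note [simp] = Dist_Arr [OF uv]
  obtain Y where Y [simp]: "Y \<in> Obj D" "isomorphic D (\<Sigma> Y) (Cod D u)"
    using shift_ess_surj [of "Cod D u"] by auto
  obtain e d where e: "e \<in> Hom D (\<Sigma> Y) (Cod D u)" "d \<in> Hom D (Cod D u) (\<Sigma> Y)"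
    "d \<cdot> e = Ident D (\<Sigma> Y)" "e \<cdot> d = Ident D (Cod D u)"
    using isomorphicE [OF Y(2)] by metis
  then have [simp]: "e \<in> Arr D" "Dom D e = \<Sigma> Y" "Cod D e = Cod D u"
    "d \<in> Arr D" "Dom D d = Cod D u" "Cod D d = \<Sigma> Y" by auto
  have 1: "(h, d \<cdot> u, v \<cdot> e) \<in> Dist D"
    by (rule TR1_iso [OF uv, where a = "Ident D (Dom D h)" and b = "Ident D (\<Sigma> X)" and c = d])
      (auto simp: triangle_def Ident_is_iso shift.fmap_Ident assoc e is_isoI [OF e(2,1)])
  \<comment> \<open>Both desuspensions are taken with a sign, which absorbs the one in
    \<open>rotate_inverse\<close>.\<close>
  obtain f where f: "f \<in> Hom D X Y" "\<sigma> f = Neg D (d \<cdot> u)"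
    using shift_full [of X Y "Neg D (d \<cdot> u)"] by auto
  obtain g where g: "g \<in> Hom D Y (Dom D h)" "\<sigma> g = Neg D (v \<cdot> e)"
    using shift_full [of Y "Dom D h" "Neg D (v \<cdot> e)"] by auto
  have "(h, Neg D (\<sigma> f), Neg D (\<sigma> g)) \<in> Dist D"
    using 1 f g by simp
  then have "(g, h, Neg D (\<sigma> f)) \<in> Dist D"
    using f g by - (rule rotate_inverse, auto simp: triangle_def)
  then have "(f, g, h) \<in> Dist D"
    using f g by - (rule rotate_inverse, auto simp: triangle_def)
  with f show ?thesis by auto
qed

text \<open>An arrow that kills \<open>g\<close> factors through \<open>h\<close>, hence through an
  arrow out of \<open>\<Sigma> (Dom D f)\<close>, and these vanish by assumption.\<close>

lemma epi_of_vanish: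
  assumes fgh: "(f, g, h) \<in> Dist D"
    and van: "\<And>w. \<lbrakk>w \<in> Arr D; Dom D w = \<Sigma> (Dom D f); Cod D w = W\<rbrakk> \<Longrightarrow> w = Zero D (\<Sigma> (Dom D f)) W"
    and "u \<in> Hom D (Cod D g) W" "v \<in> Hom D (Cod D g) W" "u \<cdot> g = v \<cdot> g"
  shows "u = v"
proof (rule cancel_right [where f = g])
  note [simp] = Dist_Arr [OF fgh]
  fix u assume u: "u \<in> Hom D (Cod D g) W" "u \<cdot> g = Zero D (Dom D g) W"
  have "\<exists>w \<in> Hom D (Cod D h) (Cod D u). w \<cdot> h = u"
    by (rule weak_cokernel [OF rotate [OF fgh]]) (use u in simp_all)
  then obtain w where w: "w \<in> Hom D (Cod D h) (Cod D u)" "w \<cdot> h = u"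
    by blast
  with van [of w] u have "w = Zero D (\<Sigma> (Dom D f)) W" by simp
  moreover have "W \<in> Obj D" using u by auto
  ultimately show "u = Zero D (Cod D g) W" using w(2) by simp
qed (use assms Dist_Arr [OF fgh] in auto)

text \<open>If \<open>f\<close> kills \<open>u\<close>, then \<open>\<sigma> u\<close> factors
  through \<open>h\<close>. Testing arrows out of \<open>\<Sigma> T\<close> replaces the usual
  arrows T -> Z[-1] and avoids a desuspension.\<close>

lemma mono_of_vanish:
  assumes fgh: "(f, g, h) \<in> Dist D"
    and van: "\<And>w. \<lbrakk>w \<in> Arr D; Dom D w = \<Sigma> T; Cod D w = Cod D g\<rbrakk> \<Longrightarrow> w = Zero D (\<Sigma> T) (Cod D g)"
    and "u \<in> Hom D T (Dom D f)" "v \<in> Hom D T (Dom D f)" "f \<cdot> u = f \<cdot> v"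
  shows "u = v"
proof (rule cancel_left [where f = f])
  note [simp] = Dist_Arr [OF fgh]
  fix u assume u: "u \<in> Hom D T (Dom D f)" "f \<cdot> u = Zero D T (Cod D f)"
  then have T [simp]: "T \<in> Obj D" by auto
  have "\<sigma> f \<cdot> \<sigma> u = Zero D (\<Sigma> T) (\<Sigma> (Cod D f))"
    using u by (auto simp flip: shift_Comp)
  then obtain w where "w \<in> Hom D (\<Sigma> T) (Cod D g)" "h \<cdot> w = \<sigma> u"
    using weak_kernel [OF rotate [OF rotate [OF fgh]], of "\<sigma> u"] u by auto
  with van [of w] have "\<sigma> u = Zero D (\<Sigma> T) (\<Sigma> (Dom D f))" by auto
  with u show "u = Zero D T (Dom D f)" by - (rule shift_eq_Zero, auto)
qed (use assms Dist_Arr [OF fgh] in auto)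

end

section \<open>The glued heart\<close>

lemma full_subcat_additive_simps [simp]:
  "Plus (full_subcat C S) = Plus C" "Zero (full_subcat C S) = Zero C"
  by (simp_all add: full_subcat_def)

lemma Neg_full_subcat:
  assumes "Dom C f \<in> S" "Cod C f \<in> S"
  shows "Neg (full_subcat C S) f = Neg C f"
proof -
  have "hom_group (full_subcat C S) (Dom C f) (Cod C f) = hom_group C (Dom C f) (Cod C f)"
    using assms by (simp add: hom_group_def Hom_full_subcat del: in_Hom_iff)
  then show ?thesis by (simp add: Neg_def)
qed

lemma (in preadditive_category) Plus_Minus_cancel:
  assumes "f \<in> Arr C" "g \<in> Arr C" "Dom C f = Dom C g" "Cod C f = Cod C g"
  shows "Plus C g (Plus C f (Neg C g)) = f"
proof -
  have "Plus C g (Plus C f (Neg C g)) = Plus C (Plus C f (Neg C g)) g"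
    using assms by (intro Plus_commute) auto
  also have "\<dots> = Plus C f (Plus C (Neg C g) g)"
    using assms by (intro Plus_assoc) auto
  finally show ?thesis using assms by simp
qed

text \<open>The semiorthogonal decomposition, the t-structures and the adjoints are condensed into
  these axioms, so that the comparison with Ext takes place inside \<open>D\<close> alone.
  \<open>shift_vanish\<close> is the absence of Ext in degree -1 on the heart;
  \<open>B0_biproduct\<close> supplies the sum of two copies of an object of
  \<open>B\<^sub>0\<close> for Baer sums.\<close>

locale glued_hearts = triangulated_category D
  for D :: "('o, 'm, 'z) tri_cat_scheme" (structure) +
  fixes A\<^sub>0 B\<^sub>0 H :: "'o set"
  assumes H_subset: "H \<subseteq> Obj D" and A0_subset: "A\<^sub>0 \<subseteq> H" and B0_subset: "B\<^sub>0 \<subseteq> H"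
    and shift_vanish: "\<lbrakk>w \<in> Arr D; Dom D w = \<Sigma> X; X \<in> H; Cod D w \<in> H\<rbrakk> \<Longrightarrow> w = Zero D (Dom D w) (Cod D w)"
    and BA_vanish: "\<lbrakk>w \<in> Arr D; Dom D w \<in> B\<^sub>0; Cod D w \<in> A\<^sub>0\<rbrakk> \<Longrightarrow> w = Zero D (Dom D w) (Cod D w)"
    and AB_vanish: "\<lbrakk>w \<in> Arr D; Dom D w \<in> A\<^sub>0; Cod D w \<in> B\<^sub>0\<rbrakk> \<Longrightarrow> w = Zero D (Dom D w) (Cod D w)"
    and H_decomposition: "E \<in> H \<Longrightarrow>
      \<exists>i p k. (i, p, k) \<in> Dist D \<and> Dom D i \<in> B\<^sub>0 \<and> Cod D i = E \<and> Cod D p \<in> A\<^sub>0"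
    and H_extension: "\<lbrakk>(i, p, k) \<in> Dist D; Dom D i \<in> B\<^sub>0; Cod D p \<in> A\<^sub>0\<rbrakk> \<Longrightarrow> Cod D i \<in> H"
    and B0_biproduct: "\<lbrakk>X \<in> B\<^sub>0; Y \<in> B\<^sub>0\<rbrakk> \<Longrightarrow>
        \<exists>P \<in> B\<^sub>0. \<exists>i \<in> Hom D X P. \<exists>j \<in> Hom D Y P. \<exists>p \<in> Hom D P X. \<exists>q \<in> Hom D P Y.
        p \<cdot> i = Ident D X \<and> q \<cdot> j = Ident D Y \<and> q \<cdot> i = Zero D X Y \<and> p \<cdot> j = Zero D Y X \<and>
        Plus D (i \<cdot> p) (j \<cdot> q) = Ident D P"
begin

lemma H_Obj [simp]: "X \<in> H \<Longrightarrow> X \<in> Obj D"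
  and A0_H [simp]: "X \<in> A\<^sub>0 \<Longrightarrow> X \<in> H" and B0_H [simp]: "X \<in> B\<^sub>0 \<Longrightarrow> X \<in> H"
  and A0_Obj [simp]: "X \<in> A\<^sub>0 \<Longrightarrow> X \<in> Obj D" and B0_Obj [simp]: "X \<in> B\<^sub>0 \<Longrightarrow> X \<in> Obj D"
  using H_subset A0_subset B0_subset by auto

lemma shift_vanish': "\<lbrakk>w \<in> Arr D; Dom D w = \<Sigma> X; Cod D w = Y; X \<in> H; Y \<in> H\<rbrakk> \<Longrightarrow> w = Zero D (\<Sigma> X) Y"
  using shift_vanish by metis

abbreviation "gl \<equiv> full_subcat D H"

definition glue_triangles :: "('m \<times> 'm \<times> 'm) set" where
  "glue_triangles = {(i, p, k) \<in> Dist D. Dom D i \<in> B\<^sub>0 \<and> Cod D p \<in> A\<^sub>0}"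

section \<open>Factorizations through a decomposition triangle\<close>

context
  fixes i p k
  assumes ipk: "(i, p, k) \<in> glue_triangles"
begin

lemma glue_Dist: "(i, p, k) \<in> Dist D"
  using ipk by (simp add: glue_triangles_def)

lemma glue_simps:
  shows "i \<in> Arr D" "p \<in> Arr D" "k \<in> Arr D" "Dom D p = Cod D i" "Dom D k = Cod D p"
    "Cod D k = \<Sigma> (Dom D i)" "Dom D i \<in> B\<^sub>0" "Cod D p \<in> A\<^sub>0" "Cod D i \<in> H"
  using ipk Dist_Arr [of i p k] H_extension [of i p k] by (auto simp: glue_triangles_def)

lemma glue_p_i: "p \<cdot> i = Zero D (Dom D i) (Cod D p)"
  using Dist_Comp_Zero [OF glue_Dist] .

lemma glue_k_p: "k \<cdot> p = Zero D (Cod D i) (\<Sigma> (Dom D i))"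
  using Dist_Comp_Zero [OF rotate [OF glue_Dist]] glue_simps by simp

lemma glue_shift_i_k: "\<sigma> i \<cdot> k = Zero D (Cod D p) (\<Sigma> (Cod D i))"
  using Dist_Comp_Zero [OF rotate [OF rotate [OF glue_Dist]]] glue_simps Neg_eq_Zero [of "\<sigma> i \<cdot> k"]
  by simp

lemma glue_mono: "\<lbrakk>T \<in> H; u \<in> Hom D T (Dom D i); v \<in> Hom D T (Dom D i); i \<cdot> u = i \<cdot> v\<rbrakk> \<Longrightarrow> u = v"
  by (rule mono_of_vanish [OF glue_Dist]) (use glue_simps in \<open>auto intro: shift_vanish'\<close>)

lemma glue_epi: "\<lbrakk>W \<in> H; u \<in> Hom D (Cod D p) W; v \<in> Hom D (Cod D p) W; u \<cdot> p = v \<cdot> p\<rbrakk> \<Longrightarrow> u = v"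
  by (rule epi_of_vanish [OF glue_Dist]) (use glue_simps in \<open>auto intro: shift_vanish'\<close>)

lemma lift_along_i:
  assumes "u \<in> Arr D" "Cod D u = Cod D i" "p \<cdot> u = Zero D (Dom D u) (Cod D p)"
  obtains v where "v \<in> Hom D (Dom D u) (Dom D i)" "i \<cdot> v = u"
  using weak_kernel [OF glue_Dist] assms by blast

lemma lift_along_p:
  assumes "u \<in> Arr D" "Cod D u = Cod D p" "k \<cdot> u = Zero D (Dom D u) (Cod D k)"
  obtains v where "v \<in> Hom D (Dom D u) (Cod D i)" "p \<cdot> v = u"
  using weak_kernel [OF rotate [OF glue_Dist]] assms glue_simps by metis

lemma extend_along_p:
  assumes "u \<in> Arr D" "Dom D u = Cod D i" "u \<cdot> i = Zero D (Dom D i) (Cod D u)"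
  obtains v where "v \<in> Hom D (Cod D p) (Cod D u)" "v \<cdot> p = u"
  using weak_cokernel [OF glue_Dist] assms by blast

text \<open>\<open>\<sigma> u \<cdot> k\<close> is the obstruction to extending \<open>u\<close>: in
  the twice rotated triangle the negative of \<open>\<sigma> i\<close> is a weak cokernel of
  \<open>k\<close>. The resulting arrow is desuspended with the opposite sign.\<close>

lemma extend_along_i:
  assumes u: "u \<in> Arr D" "Dom D u = Dom D i" and 0: "\<sigma> u \<cdot> k = Zero D (Cod D p) (\<Sigma> (Cod D u))"
  obtains v where "v \<in> Hom D (Cod D i) (Cod D u)" "v \<cdot> i = u"
proof -
  note [simp] = glue_simps u(2)
  have "\<exists>y \<in> Hom D (Cod D (Neg D (\<sigma> i))) (Cod D (\<sigma> u)). y \<cdot> Neg D (\<sigma> i) = \<sigma> u"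
    by (rule weak_cokernel [OF rotate [OF rotate [OF glue_Dist]]]) (use u 0 in auto)
  then obtain y where y: "y \<in> Hom D (\<Sigma> (Cod D i)) (\<Sigma> (Cod D u))" "y \<cdot> Neg D (\<sigma> i) = \<sigma> u"
    using u by auto
  obtain v where v: "v \<in> Hom D (Cod D i) (Cod D u)" "\<sigma> v = Neg D y"
    using shift_full [of "Cod D i" "Cod D u" "Neg D y"] y u by auto
  have "\<sigma> (v \<cdot> i) = \<sigma> u"
    using y v by (auto simp: shift_Comp)
  then have "v \<cdot> i = u"
    using v u by - (rule shift_faithful, auto)
  with v show ?thesis using that by blast
qed

end

section \<open>Morphisms between decomposition triangles\<close>

context
  fixes i p k i' p' k'
  assumes ipk: "(i, p, k) \<in> glue_triangles" and ipk': "(i', p', k') \<in> glue_triangles"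
begin

lemma glue_fill:
  assumes "a \<in> Hom D (Dom D i) (Dom D i')" "c \<in> Hom D (Cod D p) (Cod D p')" "\<sigma> a \<cdot> k = k' \<cdot> c"
  obtains b where "b \<in> Hom D (Cod D i) (Cod D i')" "b \<cdot> i = i' \<cdot> a" "p' \<cdot> b = c \<cdot> p"
  using fill_middle [OF glue_Dist [OF ipk] glue_Dist [OF ipk']] assms by blast

text \<open>Converse of \<open>glue_fill\<close>. TR3 gives some third arrow compatible with the
  connecting arrows, and it must be \<open>c\<close> because \<open>p\<close> is epic against the
  heart. Connecting arrows are read off from maps of extensions in this way throughout.\<close>

lemma glue_compat:
  assumes a: "a \<in> Hom D (Dom D i) (Dom D i')" and b: "b \<in> Hom D (Cod D i) (Cod D i')"
    and c: "c \<in> Hom D (Cod D p) (Cod D p')" and "b \<cdot> i = i' \<cdot> a" "p' \<cdot> b = c \<cdot> p"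
  shows "\<sigma> a \<cdot> k = k' \<cdot> c"
proof -
  note [simp] = glue_simps [OF ipk] glue_simps [OF ipk']
  obtain c' where c': "c' \<in> Hom D (Cod D p) (Cod D p')" "c' \<cdot> p = p' \<cdot> b" "\<sigma> a \<cdot> k = k' \<cdot> c'"
    using TR3 [OF glue_Dist [OF ipk] glue_Dist [OF ipk'], of a b] assms by auto
  have "c' = c"
    by (rule glue_epi [OF ipk]) (use c c' assms in auto)
  with c' show ?thesis by simp
qed

text \<open>The difference kills \<open>i\<close> and is killed by \<open>p'\<close>, so it factors
  as E -> A -> B' -> E', and the arrow in the middle lies in Hom(A, B') = 0.\<close>

lemma glue_unique:
  assumes b: "b \<in> Hom D (Cod D i) (Cod D i')" and b': "b' \<in> Hom D (Cod D i) (Cod D i')"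
    and "b \<cdot> i = b' \<cdot> i" "p' \<cdot> b = p' \<cdot> b'"
  shows "b = b'"
proof (rule Minus_eq_Zero)
  note [simp] = glue_simps [OF ipk] glue_simps [OF ipk']
  define d where "d = Plus D b (Neg D b')"
  have d: "d \<in> Hom D (Cod D i) (Cod D i')" "d \<cdot> i = Zero D (Dom D i) (Cod D i')"
    "p' \<cdot> d = Zero D (Cod D i) (Cod D p')"
    using assms by (auto simp: d_def)
  obtain y where y: "y \<in> Hom D (Cod D p) (Cod D i')" "y \<cdot> p = d"
    using extend_along_p [OF ipk, of d] d by auto
  have "p' \<cdot> y = Zero D (Cod D p) (Cod D p')"
    by (rule glue_epi [OF ipk, of "Cod D p'"]) (use y d in \<open>auto simp: assoc\<close>)
  then obtain z where z: "z \<in> Hom D (Cod D p) (Dom D i')" "i' \<cdot> z = y"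
    using lift_along_i [OF ipk', of y] y by auto
  have "z = Zero D (Cod D p) (Dom D i')"
    using AB_vanish [of z] z by auto
  then have "d = Zero D (Cod D i) (Cod D i')"
    using y z by auto
  then show "Plus D b (Neg D b') = Zero D (Dom D b') (Cod D b')"
    using b' by (simp add: d_def)
qed (use assms in auto)

text \<open>The composite from \<open>B\<^sub>0\<close> through both middle terms to
  \<open>A\<^sub>0\<close> is zero. Together with \<open>glue_corestrict\<close> this makes the
  torsion sequence functorial.\<close>

lemma glue_restrict:
  assumes b: "b \<in> Hom D (Cod D i) (Cod D i')"
  obtains a where "a \<in> Hom D (Dom D i) (Dom D i')" "b \<cdot> i = i' \<cdot> a"
proof -
  note [simp] = glue_simps [OF ipk] glue_simps [OF ipk']
  have "p' \<cdot> (b \<cdot> i) = Zero D (Dom D i) (Cod D p')"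
    using BA_vanish [of "p' \<cdot> (b \<cdot> i)"] b by auto
  then obtain a where "a \<in> Hom D (Dom D (b \<cdot> i)) (Dom D i')" "i' \<cdot> a = b \<cdot> i"
    using lift_along_i [OF ipk', of "b \<cdot> i"] b by auto
  then show ?thesis
    using b by (intro that [of a]) auto
qed

lemma glue_corestrict:
  assumes b: "b \<in> Hom D (Cod D i) (Cod D i')"
  obtains c where "c \<in> Hom D (Cod D p) (Cod D p')" "p' \<cdot> b = c \<cdot> p"
proof -
  note [simp] = glue_simps [OF ipk] glue_simps [OF ipk']
  have "(p' \<cdot> b) \<cdot> i = Zero D (Dom D i) (Cod D p')"
    using BA_vanish [of "(p' \<cdot> b) \<cdot> i"] b by auto
  then obtain c where "c \<in> Hom D (Cod D p) (Cod D (p' \<cdot> b))" "c \<cdot> p = p' \<cdot> b"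
    using extend_along_p [OF ipk, of "p' \<cdot> b"] b by auto
  then show ?thesis
    using b by (intro that [of c]) auto
qed

end

section \<open>Kernels, cokernels, pullbacks and pushouts in the glued heart\<close>

lemma glue_kernel:
  assumes ipk: "(i, p, k) \<in> glue_triangles"
  shows "is_kernel gl i p"
proof -
  note [simp] = glue_simps [OF ipk]
  have "\<exists>!u. u \<in> Hom gl (Dom D g) (Dom D i) \<and> i \<cdot> u = g"
    if g: "g \<in> Arr D" "Dom D g \<in> H" "Cod D g = Cod D i" "p \<cdot> g = Zero D (Dom D g) (Cod D p)" for g
  proof -
    obtain v where "v \<in> Hom D (Dom D g) (Dom D i)" "i \<cdot> v = g"
      using lift_along_i [OF ipk, of g] g by auto
    then show ?thesis
      using g glue_mono [OF ipk, of "Dom D g"] by (intro ex1I [of _ v]) auto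
  qed
  then show ?thesis
    by (simp add: is_kernel_def glue_p_i [OF ipk])
qed

lemma glue_cokernel:
  assumes ipk: "(i, p, k) \<in> glue_triangles"
  shows "is_cokernel gl p i"
proof -
  note [simp] = glue_simps [OF ipk]
  have "\<exists>!u. u \<in> Hom gl (Cod D p) (Cod D g) \<and> u \<cdot> p = g"
    if g: "g \<in> Arr D" "Cod D g \<in> H" "Dom D g = Cod D i" "g \<cdot> i = Zero D (Dom D i) (Cod D g)" for g
  proof -
    obtain v where "v \<in> Hom D (Cod D p) (Cod D g)" "v \<cdot> p = g"
      using extend_along_p [OF ipk, of g] g by auto
    then show ?thesis
      using g glue_epi [OF ipk, of "Cod D g"] by (intro ex1I [of _ v]) auto
  qed
  then show ?thesis
    by (simp add: is_cokernel_def glue_p_i [OF ipk])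
qed

text \<open>A map of extensions that is the identity on the subobject gives
  \<open>k' = k \<cdot> f\<close>. For a compatible pair this yields
  \<open>k' \<cdot> b = k \<cdot> (p \<cdot> a) = 0\<close>, so \<open>b\<close> lifts along
  \<open>p'\<close>, and the lift is adjusted by an arrow through \<open>i'\<close>. Uniqueness
  holds because an arrow killed by \<open>p'\<close> factors through \<open>i'\<close>, and
  \<open>h \<cdot> i'\<close> is the monic \<open>i\<close>.\<close>

lemma glue_pullback:
  assumes ipk: "(i, p, k) \<in> glue_triangles" and ipk': "(i', p', k') \<in> glue_triangles"
    and h: "h \<in> Hom D (Cod D i') (Cod D i)" and f: "f \<in> Hom D (Cod D p') (Cod D p)"
    and B: "Dom D i' = Dom D i" and hi: "h \<cdot> i' = i" and ph: "p \<cdot> h = f \<cdot> p'"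
  shows "is_pullback gl p f h p'"
proof -
  note [simp] = glue_simps [OF ipk] glue_simps [OF ipk'] B
  have [simp]: "h \<in> Arr D" "Dom D h = Cod D i'" "Cod D h = Cod D i"
    "f \<in> Arr D" "Dom D f = Cod D p'" "Cod D f = Cod D p"
    using h f by auto
  have kf: "k' = k \<cdot> f"
    using glue_compat [OF ipk' ipk, of "Ident D (Dom D i)" h f] hi ph by (simp add: shift.fmap_Ident)
  have "\<exists>!u. u \<in> Hom gl (Dom D a) (Cod D i') \<and> h \<cdot> u = a \<and> p' \<cdot> u = b"
    if "a \<in> Arr D" "b \<in> Arr D" "Dom D a \<in> H" "Dom D a = Dom D b" "Cod D a = Cod D i" "Cod D b = Cod D p'"
      and pa: "p \<cdot> a = f \<cdot> b" for a b
  proof -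
    note [simp] = that(1,2) that(4) [symmetric] that(5,6)
    have TH [simp]: "Dom D a \<in> H" by fact
    have "k' \<cdot> b = (k \<cdot> p) \<cdot> a"
      by (simp add: kf assoc pa)
    then obtain u0 where u0: "u0 \<in> Hom D (Dom D a) (Cod D i')" "p' \<cdot> u0 = b"
      using lift_along_p [OF ipk', of b] by (auto simp: glue_k_p [OF ipk])
    \<comment> \<open>\<open>u0\<close> already has the right image under \<open>p'\<close>;
      \<open>d\<close> is the defect of its image under \<open>h\<close>, and it factors through
      \<open>i\<close> because \<open>p\<close> kills it.\<close>
    define d where "d = Plus D a (Neg D (h \<cdot> u0))"
    have d: "d \<in> Hom D (Dom D a) (Cod D i)"
      using u0 by (auto simp: d_def)
    have "p \<cdot> (h \<cdot> u0) = f \<cdot> b"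
      using u0 assoc [of u0 h p] assoc [of u0 p' f] ph by auto
    then have "p \<cdot> d = Zero D (Dom D a) (Cod D p)"
      using u0 pa by (auto simp: d_def)
    then obtain v where v: "v \<in> Hom D (Dom D a) (Dom D i)" "i \<cdot> v = d"
      using lift_along_i [OF ipk, of d] d by auto
    define u where "u = Plus D u0 (i' \<cdot> v)"
    have u: "u \<in> Hom D (Dom D a) (Cod D i')"
      using u0 v by (auto simp: u_def)
    have "h \<cdot> (i' \<cdot> v) = d" "p' \<cdot> (i' \<cdot> v) = Zero D (Dom D a) (Cod D p')"
      using v assoc [of v i' h] assoc [of v i' p'] by (auto simp: hi glue_p_i [OF ipk'])
    moreover have "Plus D (h \<cdot> u0) d = a"
      unfolding d_def using u0 by (intro Plus_Minus_cancel) auto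
    ultimately have hu: "h \<cdot> u = a" "p' \<cdot> u = b"
      using u0 v by (auto simp: u_def)
    have "w = u" if w: "w \<in> Hom D (Dom D a) (Cod D i')" "h \<cdot> w = a" "p' \<cdot> w = b" for w
    proof (rule Minus_eq_Zero)
      define e where "e = Plus D w (Neg D u)"
      have e: "e \<in> Hom D (Dom D a) (Cod D i')" "h \<cdot> e = Zero D (Dom D a) (Cod D i)"
        "p' \<cdot> e = Zero D (Dom D a) (Cod D p')"
        using w u hu by (auto simp: e_def)
      then obtain x where x: "x \<in> Hom D (Dom D a) (Dom D i)" "i' \<cdot> x = e"
        using lift_along_i [OF ipk', of e] by auto
      have "i \<cdot> x = Zero D (Dom D a) (Cod D i)"
        using x e assoc [of x i' h] by (auto simp: hi)
      then have "x = Zero D (Dom D a) (Dom D i)"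
        using x by - (rule glue_mono [OF ipk, of "Dom D a"], auto)
      then show "Plus D w (Neg D u) = Zero D (Dom D u) (Cod D u)"
        using x u by (auto simp: e_def)
    qed (use w u in auto)
    note uniq = this
    show ?thesis
    proof (rule ex1I [of _ u])
      show "u \<in> Hom gl (Dom D a) (Cod D i') \<and> h \<cdot> u = a \<and> p' \<cdot> u = b"
        using u hu by simp
    next
      fix w assume "w \<in> Hom gl (Dom D a) (Cod D i') \<and> h \<cdot> w = a \<and> p' \<cdot> w = b"
      then show "w = u" by (intro uniq) simp_all
    qed
  qed
  then show ?thesis
    unfolding is_pullback_def by (auto simp: ph)
qed

text \<open>Dual to \<open>glue_pullback\<close>, with \<open>k' = \<sigma> g \<cdot> k\<close>: the
  obstruction to extending \<open>b\<close> along \<open>i'\<close> becomes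
  \<open>\<sigma> a \<cdot> (\<sigma> i \<cdot> k)\<close>, which is zero, and the defect is
  corrected by an arrow through \<open>p'\<close>.\<close>

lemma glue_pushout:
  assumes ipk: "(i, p, k) \<in> glue_triangles" and ipk': "(i', p', k') \<in> glue_triangles"
    and h: "h \<in> Hom D (Cod D i) (Cod D i')" and g: "g \<in> Hom D (Dom D i) (Dom D i')"
    and A: "Cod D p' = Cod D p" and hi: "h \<cdot> i = i' \<cdot> g" and ph: "p' \<cdot> h = p"
  shows "is_pushout gl i g h i'"
proof -
  note [simp] = glue_simps [OF ipk] glue_simps [OF ipk'] A
  have [simp]: "h \<in> Arr D" "Dom D h = Cod D i" "Cod D h = Cod D i'"
    "g \<in> Arr D" "Dom D g = Dom D i" "Cod D g = Dom D i'"
    using h g by auto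
  have gk: "k' = \<sigma> g \<cdot> k"
    using glue_compat [OF ipk ipk', of g h "Ident D (Cod D p)"] hi ph by simp
  have "\<exists>!u. u \<in> Hom gl (Cod D i') (Cod D a) \<and> u \<cdot> h = a \<and> u \<cdot> i' = b"
    if "a \<in> Arr D" "b \<in> Arr D" "Cod D a \<in> H" "Cod D a = Cod D b" "Dom D a = Cod D i" "Dom D b = Dom D i'"
      and ai: "a \<cdot> i = b \<cdot> g" for a b
  proof -
    note [simp] = that(1,2) that(4) [symmetric] that(5,6)
    have WH [simp]: "Cod D a \<in> H" by fact
    have "\<sigma> b \<cdot> k' = \<sigma> (b \<cdot> g) \<cdot> k"
      by (simp add: gk assoc shift_Comp)
    also have "\<dots> = \<sigma> a \<cdot> (\<sigma> i \<cdot> k)"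
      by (simp add: ai [symmetric] shift_Comp assoc)
    also have "\<dots> = Zero D (Cod D p) (\<Sigma> (Cod D a))"
      by (simp add: glue_shift_i_k [OF ipk])
    finally obtain u0 where u0: "u0 \<in> Hom D (Cod D i') (Cod D a)" "u0 \<cdot> i' = b"
      using extend_along_i [OF ipk', of b] by auto
    define d where "d = Plus D a (Neg D (u0 \<cdot> h))"
    have d: "d \<in> Hom D (Cod D i) (Cod D a)"
      using u0 by (auto simp: d_def)
    have "(u0 \<cdot> h) \<cdot> i = b \<cdot> g"
      using u0 assoc [of i h u0] assoc [of g i' u0] hi by auto
    then have "d \<cdot> i = Zero D (Dom D i) (Cod D a)"
      using u0 ai by (auto simp: d_def)
    then obtain v where v: "v \<in> Hom D (Cod D p) (Cod D a)" "v \<cdot> p = d"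
      using extend_along_p [OF ipk, of d] d by auto
    define u where "u = Plus D u0 (v \<cdot> p')"
    have u: "u \<in> Hom D (Cod D i') (Cod D a)"
      using u0 v by (auto simp: u_def)
    have "(v \<cdot> p') \<cdot> h = d" "(v \<cdot> p') \<cdot> i' = Zero D (Dom D i') (Cod D a)"
      using v by (auto simp: assoc ph glue_p_i [OF ipk'])
    moreover have "Plus D (u0 \<cdot> h) d = a"
      unfolding d_def using u0 by (intro Plus_Minus_cancel) auto
    ultimately have uh: "u \<cdot> h = a" "u \<cdot> i' = b"
      using u0 v by (auto simp: u_def)
    have "w = u" if w: "w \<in> Hom D (Cod D i') (Cod D a)" "w \<cdot> h = a" "w \<cdot> i' = b" for w
    proof (rule Minus_eq_Zero)
      define e where "e = Plus D w (Neg D u)"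
      have e: "e \<in> Hom D (Cod D i') (Cod D a)" "e \<cdot> h = Zero D (Cod D i) (Cod D a)"
        "e \<cdot> i' = Zero D (Dom D i') (Cod D a)"
        using w u uh by (auto simp: e_def)
      then obtain x where x: "x \<in> Hom D (Cod D p) (Cod D a)" "x \<cdot> p' = e"
        using extend_along_p [OF ipk', of e] by auto
      have "x \<cdot> p = Zero D (Cod D i) (Cod D a)"
        using x e assoc [of h p' x] by (auto simp: ph)
      then have "x = Zero D (Cod D p) (Cod D a)"
        using x by - (rule glue_epi [OF ipk, of "Cod D a"], auto)
      then show "Plus D w (Neg D u) = Zero D (Dom D u) (Cod D u)"
        using x u by (auto simp: e_def)
    qed (use w u in auto)
    note uniq = this
    show ?thesis
    proof (rule ex1I [of _ u])
      show "u \<in> Hom gl (Cod D i') (Cod D a) \<and> u \<cdot> h = a \<and> u \<cdot> i' = b"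
        using u uh by simp
    next
      fix w assume "w \<in> Hom gl (Cod D i') (Cod D a) \<and> w \<cdot> h = a \<and> w \<cdot> i' = b"
      then show "w = u" by (intro uniq) simp_all
    qed
  qed
  then show ?thesis
    unfolding is_pushout_def by (auto simp: hi)
qed

subsection \<open>Extensions and their connecting arrows\<close>

text \<open>Intended as a Yoneda class, kept as the full set of its representatives so that it can
  be equal, as a set, to an element of \<open>Ext1\<close> and to the set-valued results of
  pullback, pushout and Baer sum.\<close>

definition ext_class :: "'o \<Rightarrow> 'o \<Rightarrow> 'm \<Rightarrow> ('m \<times> 'm) set" where
  "ext_class A B k = {(i, p). (i, p, k) \<in> Dist D \<and> Dom D i = B \<and> Cod D p = A}"

lemma ext_classD:
  assumes "(i, p) \<in> ext_class A B k" "A \<in> A\<^sub>0" "B \<in> B\<^sub>0"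
  shows "(i, p, k) \<in> glue_triangles" "Dom D i = B" "Cod D p = A"
  using assms by (auto simp: ext_class_def glue_triangles_def)

lemma ext_classI: "\<lbrakk>(i, p, k) \<in> glue_triangles; Dom D i = B; Cod D p = A\<rbrakk> \<Longrightarrow> (i, p) \<in> ext_class A B k"
  by (auto simp: ext_class_def glue_triangles_def)

lemma ext_class_nonempty:
  assumes "A \<in> A\<^sub>0" "B \<in> B\<^sub>0" "k \<in> Hom D A (\<Sigma> B)"
  obtains i p where "(i, p) \<in> ext_class A B k" "(i, p, k) \<in> glue_triangles"
    "Dom D i = B" "Cod D p = A"
proof -
  obtain i p where "(i, p, k) \<in> Dist D" "Dom D i = B"
    using exists_Dist [of B k] assms by auto
  moreover from this have "Cod D p = A"
    using Dist_Arr(5) assms(3) by fastforce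
  ultimately show ?thesis
    using assms that by (auto simp: ext_class_def glue_triangles_def)
qed

text \<open>\<open>glue_compat\<close> for the identity map of the pair \<open>(i, p)\<close>. It
  yields the injectivity of \<open>ext_class A B\<close> on arrows.\<close>

lemma connecting_unique:
  assumes "(i, p, k) \<in> glue_triangles" "(i, p, k') \<in> glue_triangles"
  shows "k = k'"
proof -
  note [simp] = glue_simps [OF assms(1)] glue_simps [OF assms(2)]
  show ?thesis
    using glue_compat [OF assms, of "Ident D (Dom D i)" "Ident D (Cod D i)" "Ident D (Cod D p)"]
    by (simp add: shift.fmap_Ident)
qed

lemma ext_class_eq:
  assumes "A \<in> A\<^sub>0" "B \<in> B\<^sub>0" "k \<in> Hom D A (\<Sigma> B)" "ext_class A B k = ext_class A B k'"
  shows "k = k'"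
  using ext_class_nonempty [OF assms(1-3)] assms connecting_unique by (metis ext_classD(1))

text \<open>In a kernel-cokernel pair \<open>(i, p)\<close> the arrow \<open>i\<close> factors through the \<open>B\<^sub>0\<close>-part of its
  codomain and conversely, and likewise for \<open>p\<close>; so the pair is isomorphic to the decomposition
  triangle of \<open>Cod D i\<close>.\<close>

lemma extension_triangle:
  assumes A: "A \<in> A\<^sub>0" and B: "B \<in> B\<^sub>0" and ext: "(i, p) \<in> extensions gl A B"
  obtains k where "(i, p, k) \<in> glue_triangles" "Dom D i = B" "Cod D p = A"
proof -
  have ker: "is_kernel gl i p" and coker: "is_cokernel gl p i" and [simp]: "Dom D i = B" "Cod D p = A"
    using ext by (auto simp: extensions_def)
  have [simp]: "i \<in> Arr D" "p \<in> Arr D" "Dom D p = Cod D i" "Cod D i \<in> H" and pi: "p \<cdot> i = Zero D B A"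
    using ker by (auto simp: is_kernel_def)
  note [simp] = A B
  have ker': "\<exists>!u. u \<in> Hom D (Dom D g) B \<and> i \<cdot> u = g"
    if "g \<in> Arr D" "Dom D g \<in> H" "Cod D g = Cod D i" "p \<cdot> g = Zero D (Dom D g) A" for g
  proof -
    have "\<forall>g \<in> Arr gl. Cod D g = Cod D i \<and> p \<cdot> g = Zero D (Dom D g) A \<longrightarrow>
        (\<exists>!u. u \<in> Hom gl (Dom D g) B \<and> i \<cdot> u = g)"
      using ker by (simp add: is_kernel_def del: in_Hom_iff)
    from bspec [OF this, of g] that show ?thesis
      by (simp add: Hom_full_subcat del: in_Hom_iff)
  qed
  have coker': "\<exists>!u. u \<in> Hom D A (Cod D g) \<and> u \<cdot> p = g"
    if "g \<in> Arr D" "Cod D g \<in> H" "Dom D g = Cod D i" "g \<cdot> i = Zero D B (Cod D g)" for g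
  proof -
    have "\<forall>g \<in> Arr gl. Dom D g = Cod D i \<and> g \<cdot> i = Zero D B (Cod D g) \<longrightarrow>
        (\<exists>!u. u \<in> Hom gl A (Cod D g) \<and> u \<cdot> p = g)"
      using coker by (simp add: is_cokernel_def del: in_Hom_iff)
    from bspec [OF this, of g] that show ?thesis
      by (simp add: Hom_full_subcat del: in_Hom_iff)
  qed
  obtain b a k where bak: "(b, a, k) \<in> glue_triangles" and Cod_b [simp]: "Cod D b = Cod D i"
    using H_decomposition [of "Cod D i"] by (auto simp: glue_triangles_def)
  note [simp] = glue_simps [OF bak, simplified]
  have ab: "a \<cdot> b = Zero D (Dom D b) (Cod D a)" using glue_p_i [OF bak] .
  have pb: "p \<cdot> b = Zero D (Dom D b) A"
    using BA_vanish [of "p \<cdot> b"] by simp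
  have ai: "a \<cdot> i = Zero D B (Cod D a)"
    using BA_vanish [of "a \<cdot> i"] by simp
  obtain u where u: "u \<in> Hom D (Dom D b) B" "i \<cdot> u = b"
    using ker' [of b] pb by auto
  obtain v where v: "v \<in> Hom D B (Dom D b)" "b \<cdot> v = i"
    using lift_along_i [OF bak, of i] ai by auto
  obtain t where t: "t \<in> Hom D (Cod D a) A" "t \<cdot> a = p"
    using extend_along_p [OF bak, of p] pb by auto
  obtain w where w: "w \<in> Hom D A (Cod D a)" "w \<cdot> p = a"
    using coker' [of a] ai by auto
  have [simp]: "u \<in> Arr D" "Dom D u = Dom D b" "Cod D u = B" "v \<in> Arr D" "Dom D v = B" "Cod D v = Dom D b"
    "t \<in> Arr D" "Dom D t = Cod D a" "Cod D t = A" "w \<in> Arr D" "Dom D w = A" "Cod D w = Cod D a"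
    using u v t w by auto
  have "i \<cdot> (u \<cdot> v) = i \<cdot> Ident D B"
    by (simp add: assoc [symmetric] u v)
  then have uv: "u \<cdot> v = Ident D B"
    by - (rule ex1_eqI [OF ker' [of i]], simp_all add: pi)
  have "b \<cdot> (v \<cdot> u) = b \<cdot> Ident D (Dom D b)"
    by (simp add: assoc [symmetric] u v)
  then have vu: "v \<cdot> u = Ident D (Dom D b)"
    by - (rule glue_mono [OF bak, of "Dom D b"], auto)
  have "(t \<cdot> w) \<cdot> p = Ident D A \<cdot> p"
    by (simp add: assoc t w)
  then have tw: "t \<cdot> w = Ident D A"
    by - (rule ex1_eqI [OF coker' [of p]], simp_all add: pi)
  have "(w \<cdot> t) \<cdot> a = Ident D (Cod D a) \<cdot> a"
    by (simp add: assoc t w)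
  then have wt: "w \<cdot> t = Ident D (Cod D a)"
    by - (rule glue_epi [OF bak, of "Cod D a"], auto)
  \<comment> \<open>\<open>u\<close> and \<open>t\<close> are isomorphisms of the outer terms over
    the identity of the middle one, and \<open>w\<close> is the inverse of \<open>t\<close>; the new
    connecting arrow is \<open>k\<close> transported along them.\<close>
  have "(i, p, \<sigma> u \<cdot> k \<cdot> w) \<in> Dist D"
  proof (rule TR1_iso [OF glue_Dist [OF bak], where a = u and b = "Ident D (Cod D i)" and c = t])
    show "is_iso D u" by (rule is_isoI [of u "Dom D b" B v]) (auto simp: uv vu)
    show "is_iso D t" by (rule is_isoI [of t "Cod D a" A w]) (auto simp: tw wt)
    show "\<sigma> u \<cdot> k = (\<sigma> u \<cdot> k \<cdot> w) \<cdot> t" by (simp add: assoc wt)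
  qed (auto simp: triangle_def Ident_is_iso u t)
  then show ?thesis
    using that by (auto simp: glue_triangles_def)
qed

lemma extensions_iff:
  assumes "A \<in> A\<^sub>0" "B \<in> B\<^sub>0"
  shows "x \<in> extensions gl A B \<longleftrightarrow> (\<exists>k \<in> Hom D A (\<Sigma> B). x \<in> ext_class A B k)"
proof (cases x)
  case (Pair i p)
  have "\<exists>k \<in> Hom D A (\<Sigma> B). (i, p) \<in> ext_class A B k" if ext: "(i, p) \<in> extensions gl A B"
  proof -
    obtain k where k: "(i, p, k) \<in> glue_triangles" "Dom D i = B" "Cod D p = A"
      using extension_triangle [OF assms ext] .
    then show ?thesis
      using ext_classI [OF k] glue_simps [OF k(1)] by auto
  qed
  moreover have "(i, p) \<in> extensions gl A B" if "(i, p) \<in> ext_class A B k" for k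
    using ext_classD [OF that assms] glue_kernel glue_cokernel by (auto simp: extensions_def)
  ultimately show ?thesis
    using Pair by blast
qed

lemma ext_class_extension:
  assumes "(i, p) \<in> ext_class A B k" "A \<in> A\<^sub>0" "B \<in> B\<^sub>0"
  shows "(i, p) \<in> extensions gl A B"
  using ext_classD [OF assms] glue_kernel glue_cokernel by (auto simp: extensions_def)

text \<open>An equivalence is a map of triangles over two identities, whence equal connecting arrows
  by \<open>glue_compat\<close>. Conversely \<open>glue_fill\<close> gives maps in both directions,
  and \<open>glue_unique\<close> makes them mutually inverse.\<close>

lemma ext_equiv_iff:
  assumes "A \<in> A\<^sub>0" "B \<in> B\<^sub>0"
  shows "(x, y) \<in> ext_equiv gl A B \<longleftrightarrow> (\<exists>k \<in> Hom D A (\<Sigma> B). x \<in> ext_class A B k \<and> y \<in> ext_class A B k)"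
proof (cases x, cases y)
  fix i p i' p' assume xy: "x = (i, p)" "y = (i', p')"
  show ?thesis
  proof
    assume L: "(x, y) \<in> ext_equiv gl A B"
    then obtain h where h: "h \<in> Hom D (Cod D i) (Cod D i')" "h \<cdot> i = i'" "p' \<cdot> h = p"
      using xy by (auto simp: ext_equiv_def)
    obtain k k' where k: "k \<in> Hom D A (\<Sigma> B)" "x \<in> ext_class A B k" and k': "y \<in> ext_class A B k'"
      using L xy extensions_iff [OF assms] by (auto simp: ext_equiv_def)
    note t = ext_classD [OF k(2) [unfolded xy] assms] and t' = ext_classD [OF k' [unfolded xy] assms]
    note [simp] = glue_simps [OF t(1)] glue_simps [OF t'(1)] t(2,3) t'(2,3) assms
    have "k = k'"
      using glue_compat [OF t(1) t'(1), of "Ident D B" h "Ident D A"] h by (simp add: shift.fmap_Ident)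
    with k k' show "\<exists>k \<in> Hom D A (\<Sigma> B). x \<in> ext_class A B k \<and> y \<in> ext_class A B k" by blast
  next
    assume "\<exists>k \<in> Hom D A (\<Sigma> B). x \<in> ext_class A B k \<and> y \<in> ext_class A B k"
    then obtain k where k: "(i, p) \<in> ext_class A B k" and k': "(i', p') \<in> ext_class A B k"
      using xy by auto
    note t = ext_classD [OF k assms] and t' = ext_classD [OF k' assms]
    note [simp] = glue_simps [OF t(1)] glue_simps [OF t'(1)] t(2,3) t'(2,3) assms
    obtain h where h: "h \<in> Hom D (Cod D i) (Cod D i')" "h \<cdot> i = i'" "p' \<cdot> h = p"
      using glue_fill [OF t(1) t'(1), of "Ident D B" "Ident D A"] by (auto simp: shift.fmap_Ident)
    obtain h' where h': "h' \<in> Hom D (Cod D i') (Cod D i)" "h' \<cdot> i' = i" "p \<cdot> h' = p'"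
      using glue_fill [OF t'(1) t(1), of "Ident D B" "Ident D A"] by (auto simp: shift.fmap_Ident)
    have [simp]: "h \<in> Arr D" "Dom D h = Cod D i" "Cod D h = Cod D i'"
      "h' \<in> Arr D" "Dom D h' = Cod D i'" "Cod D h' = Cod D i"
      using h h' by auto
    have 1: "h' \<cdot> h = Ident D (Cod D i)"
    proof (rule glue_unique [OF t(1) t(1)])
      show "(h' \<cdot> h) \<cdot> i = Ident D (Cod D i) \<cdot> i" by (simp add: assoc h h')
      show "p \<cdot> (h' \<cdot> h) = p \<cdot> Ident D (Cod D i)" by (simp add: assoc [symmetric] h h')
    qed auto
    have 2: "h \<cdot> h' = Ident D (Cod D i')"
    proof (rule glue_unique [OF t'(1) t'(1)])
      show "(h \<cdot> h') \<cdot> i' = Ident D (Cod D i') \<cdot> i'" by (simp add: assoc h h')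
      show "p' \<cdot> (h \<cdot> h') = p' \<cdot> Ident D (Cod D i')" by (simp add: assoc [symmetric] h h')
    qed auto
    have "h \<in> Hom gl (Cod D i) (Cod D i')" "h' \<in> Hom gl (Cod D i') (Cod D i)"
      by auto
    moreover from this have "is_iso gl h"
      unfolding is_iso_def using 1 2 by (intro conjI bexI [of _ h']) auto
    moreover have "x \<in> extensions gl A B" "y \<in> extensions gl A B"
      using ext_class_extension k k' assms xy by auto
    ultimately show "(x, y) \<in> ext_equiv gl A B"
      unfolding ext_equiv_def xy mem_Collect_eq prod.case full_subcat_simps using h(2,3) by blast
  qed
qed

lemma Ext1_eq:
  assumes "A \<in> A\<^sub>0" "B \<in> B\<^sub>0"
  shows "Ext1 gl A B = ext_class A B ` Hom D A (\<Sigma> B)"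
proof -
  \<comment> \<open>A representative has just one connecting arrow, so its equivalence class is all
    of \<open>ext_class A B k\<close>.\<close>
  have *: "ext_equiv gl A B `` {x} = ext_class A B k" if x: "x \<in> ext_class A B k" and k: "k \<in> Hom D A (\<Sigma> B)" for x k
  proof -
    have "k' = k" if "x \<in> ext_class A B k'" for k'
      using that x connecting_unique ext_classD(1) [OF _ assms] by (cases x) blast
    then show ?thesis
      using x k unfolding Image_singleton ext_equiv_iff [OF assms] by blast
  qed
  show ?thesis
    unfolding Ext1_def quotient_def
  proof (intro equalityI subsetI)
    fix c assume "c \<in> (\<Union>x \<in> extensions gl A B. {ext_equiv gl A B `` {x}})"
    then obtain x k where "c = ext_equiv gl A B `` {x}" "k \<in> Hom D A (\<Sigma> B)" "x \<in> ext_class A B k"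
      using extensions_iff [OF assms] by blast
    then show "c \<in> ext_class A B ` Hom D A (\<Sigma> B)"
      using * by blast
  next
    fix c assume "c \<in> ext_class A B ` Hom D A (\<Sigma> B)"
    then obtain k where k: "k \<in> Hom D A (\<Sigma> B)" and c: "c = ext_class A B k" by blast
    obtain i p where ip: "(i, p) \<in> ext_class A B k"
      using ext_class_nonempty [OF assms k] .
    have "c = ext_equiv gl A B `` {(i, p)}"
      using * [OF ip k] c by simp
    then show "c \<in> (\<Union>x \<in> extensions gl A B. {ext_equiv gl A B `` {x}})"
      using ext_class_extension [OF ip assms] by blast
  qed
qed

text \<open>\<open>ext_pull\<close> admits every choice of pullback. An arbitrary one is a map of
  extensions, whose connecting arrow \<open>glue_compat\<close> computes; in the other direction
  \<open>glue_fill\<close> and \<open>glue_pullback\<close> exhibit every triangle on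
  \<open>k \<cdot> f\<close> as a pullback.\<close>

lemma ext_pull_ext_class:
  assumes f: "f \<in> Hom D A' A" "A' \<in> A\<^sub>0" "A \<in> A\<^sub>0" and B: "B \<in> B\<^sub>0" and k: "k \<in> Hom D A (\<Sigma> B)"
  shows "ext_pull gl f (ext_class A B k) = ext_class A' B (k \<cdot> f)"
proof -
  note [simp] = f(2,3) B
  have [simp]: "f \<in> Arr D" "Dom D f = A'" "Cod D f = A" using f by auto
  have "(i', p') \<in> ext_class A' B (k \<cdot> f)" if mem: "(i', p') \<in> ext_pull gl f (ext_class A B k)" for i' p'
  proof -
    obtain i p h where ip: "(i, p) \<in> ext_class A B k" and ext: "(i', p') \<in> extensions gl A' (Dom D i)"
      and pb: "is_pullback gl p f h p'" and hi: "h \<cdot> i' = i"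
      using mem by (auto simp: ext_pull_def)
    note t = ext_classD [OF ip f(3) B]
    obtain k' where t': "(i', p', k') \<in> glue_triangles" "Dom D i' = B" "Cod D p' = A'"
      using extension_triangle [OF f(2) B] ext t by metis
    note [simp] = glue_simps [OF t(1)] glue_simps [OF t'(1)] t(2,3) t'(2,3)
    have "h \<in> Hom D (Cod D i') (Cod D i)" "p \<cdot> h = f \<cdot> p'"
      using pb by (auto simp: is_pullback_def)
    then have "k' = k \<cdot> f"
      using glue_compat [OF t'(1) t(1), of "Ident D B" h f] hi by (simp add: shift.fmap_Ident)
    with t' show ?thesis by (intro ext_classI) auto
  qed
  moreover have "(i', p') \<in> ext_pull gl f (ext_class A B k)" if "(i', p') \<in> ext_class A' B (k \<cdot> f)" for i' p'
  proof -
    note t' = ext_classD [OF that f(2) B]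
    obtain i p where ip: "(i, p) \<in> ext_class A B k"
      using ext_class_nonempty [OF f(3) B k] .
    note t = ext_classD [OF ip f(3) B]
    note [simp] = glue_simps [OF t(1)] glue_simps [OF t'(1)] t(2,3) t'(2,3)
    obtain h where h: "h \<in> Hom D (Cod D i') (Cod D i)" "h \<cdot> i' = i" "p \<cdot> h = f \<cdot> p'"
      using glue_fill [OF t'(1) t(1), of "Ident D B" f] by (auto simp: shift.fmap_Ident)
    have "is_pullback gl p f h p'"
      using glue_pullback [OF t(1) t'(1)] h by auto
    moreover have "(i', p') \<in> extensions gl (Dom gl f) (Dom gl i)"
      using ext_class_extension [OF that f(2) B] by simp
    ultimately show ?thesis
      unfolding ext_pull_def mem_Collect_eq prod.case using ip h(2)
      by (intro exI [of _ i] exI [of _ p] exI [of _ h]) simp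
  qed
  ultimately show ?thesis by auto
qed

text \<open>As for pullbacks, now with the identity on the quotients and \<open>g\<close> on the
  subobjects.\<close>

lemma ext_push_ext_class:
  assumes g: "g \<in> Hom D B B'" "B \<in> B\<^sub>0" "B' \<in> B\<^sub>0" and A: "A \<in> A\<^sub>0" and k: "k \<in> Hom D A (\<Sigma> B)"
  shows "ext_push gl g (ext_class A B k) = ext_class A B' (\<sigma> g \<cdot> k)"
proof -
  note [simp] = g(2,3) A
  have [simp]: "g \<in> Arr D" "Dom D g = B" "Cod D g = B'" using g by auto
  have "(i', p') \<in> ext_class A B' (\<sigma> g \<cdot> k)" if mem: "(i', p') \<in> ext_push gl g (ext_class A B k)" for i' p'
  proof -
    obtain i p h where ip: "(i, p) \<in> ext_class A B k" and ext: "(i', p') \<in> extensions gl (Cod D p) B'"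
      and po: "is_pushout gl i g h i'" and ph: "p' \<cdot> h = p"
      using mem by (auto simp: ext_push_def)
    note t = ext_classD [OF ip A g(2)]
    obtain k' where t': "(i', p', k') \<in> glue_triangles" "Dom D i' = B'" "Cod D p' = A"
      using extension_triangle [OF A g(3)] ext t by metis
    note [simp] = glue_simps [OF t(1)] glue_simps [OF t'(1)] t(2,3) t'(2,3)
    have "h \<in> Hom D (Cod D i) (Cod D i')" "h \<cdot> i = i' \<cdot> g"
      using po by (auto simp: is_pushout_def)
    then have "k' = \<sigma> g \<cdot> k"
      using glue_compat [OF t(1) t'(1), of g h "Ident D A"] ph by simp
    with t' show ?thesis by (intro ext_classI) auto
  qed
  moreover have "(i', p') \<in> ext_push gl g (ext_class A B k)" if "(i', p') \<in> ext_class A B' (\<sigma> g \<cdot> k)" for i' p'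
  proof -
    note t' = ext_classD [OF that A g(3)]
    obtain i p where ip: "(i, p) \<in> ext_class A B k"
      using ext_class_nonempty [OF A g(2) k] .
    note t = ext_classD [OF ip A g(2)]
    note [simp] = glue_simps [OF t(1)] glue_simps [OF t'(1)] t(2,3) t'(2,3)
    obtain h where h: "h \<in> Hom D (Cod D i) (Cod D i')" "h \<cdot> i = i' \<cdot> g" "p' \<cdot> h = p"
      using glue_fill [OF t(1) t'(1), of g "Ident D A"] by auto
    have "is_pushout gl i g h i'"
      using glue_pushout [OF t(1) t'(1)] h by auto
    moreover have "(i', p') \<in> extensions gl (Cod gl p) (Cod gl g)"
      using ext_class_extension [OF that A g(3)] by simp
    ultimately show ?thesis
      unfolding ext_push_def mem_Collect_eq prod.case using ip h(3)
      by (intro exI [of _ i] exI [of _ p] exI [of _ h]) simp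
  qed
  ultimately show ?thesis by auto
qed

text \<open>A section \<open>s\<close> gives \<open>k = (k \<cdot> p) \<cdot> s = 0\<close>;
  conversely \<open>k\<close> is the obstruction to lifting the identity of \<open>A\<close> along
  \<open>p\<close>.\<close>

lemma split_class_eq:
  assumes A: "A \<in> A\<^sub>0" and B: "B \<in> B\<^sub>0"
  shows "split_class gl A B = ext_class A B (Zero D A (\<Sigma> B))"
proof -
  note [simp] = A B
  have "(i, p) \<in> ext_class A B (Zero D A (\<Sigma> B))" if mem: "(i, p) \<in> split_class gl A B" for i p
  proof -
    obtain s where ext: "(i, p) \<in> extensions gl A B" and s: "s \<in> Hom D A (Dom D p)" "p \<cdot> s = Ident D A"
      using mem by (auto simp: split_class_def)
    obtain k where t: "(i, p, k) \<in> glue_triangles" "Dom D i = B" "Cod D p = A"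
      using extension_triangle [OF A B ext] .
    note [simp] = glue_simps [OF t(1)] t(2,3)
    have "k = k \<cdot> (p \<cdot> s)"
      using s by simp
    also have "\<dots> = Zero D A (\<Sigma> B)"
      using s assoc [of s p k] glue_k_p [OF t(1)] by simp
    finally show ?thesis using ext_classI [OF t] by simp
  qed
  moreover have "(i, p) \<in> split_class gl A B" if ip: "(i, p) \<in> ext_class A B (Zero D A (\<Sigma> B))" for i p
  proof -
    note t = ext_classD [OF ip A B]
    note [simp] = glue_simps [OF t(1)] t(2,3)
    obtain s where "s \<in> Hom D A (Cod D i)" "p \<cdot> s = Ident D A"
      using lift_along_p [OF t(1), of "Ident D A"] by auto
    then have "\<exists>s \<in> Hom gl A (Dom D p). p \<cdot> s = Ident D A"
      by (intro bexI [of _ s]) simp_all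
    then show ?thesis
      using ext_class_extension [OF ip A B] by (simp add: split_class_def del: in_Hom_iff)
  qed
  ultimately show ?thesis by auto
qed

subsection \<open>Baer sums\<close>

text \<open>The fibre product of two extensions of \<open>A\<close> by \<open>B\<close> with classes \<open>k\<^sub>1\<close>, \<open>k\<^sub>2\<close> is the extension
  of \<open>A\<close> by \<open>B \<oplus> B\<close> with class \<open>(k\<^sub>1, k\<^sub>2)\<close>.\<close>

lemma fibre_product:
  assumes t1: "(i\<^sub>1, p\<^sub>1, k\<^sub>1) \<in> glue_triangles" and t2: "(i\<^sub>2, p\<^sub>2, k\<^sub>2) \<in> glue_triangles"
    and [simp]: "Dom D i\<^sub>1 = B" "Dom D i\<^sub>2 = B" "Cod D p\<^sub>1 = A" "Cod D p\<^sub>2 = A"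
  obtains P \<iota>\<^sub>1 \<iota>\<^sub>2 \<pi>\<^sub>1 \<pi>\<^sub>2 i p q\<^sub>1 q\<^sub>2 K
  where "P \<in> B\<^sub>0" "\<iota>\<^sub>1 \<in> Hom D B P" "\<iota>\<^sub>2 \<in> Hom D B P" "\<pi>\<^sub>1 \<in> Hom D P B" "\<pi>\<^sub>2 \<in> Hom D P B"
    "\<pi>\<^sub>1 \<cdot> \<iota>\<^sub>1 = Ident D B" "\<pi>\<^sub>2 \<cdot> \<iota>\<^sub>2 = Ident D B" "\<pi>\<^sub>2 \<cdot> \<iota>\<^sub>1 = Zero D B B" "\<pi>\<^sub>1 \<cdot> \<iota>\<^sub>2 = Zero D B B"
    "Plus D (\<iota>\<^sub>1 \<cdot> \<pi>\<^sub>1) (\<iota>\<^sub>2 \<cdot> \<pi>\<^sub>2) = Ident D P"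
    "(i, p, K) \<in> glue_triangles" "Dom D i = P" "Cod D p = A"
    "q\<^sub>1 \<in> Hom D (Cod D i) (Cod D i\<^sub>1)" "q\<^sub>1 \<cdot> i = i\<^sub>1 \<cdot> \<pi>\<^sub>1" "p\<^sub>1 \<cdot> q\<^sub>1 = p"
    "q\<^sub>2 \<in> Hom D (Cod D i) (Cod D i\<^sub>2)" "q\<^sub>2 \<cdot> i = i\<^sub>2 \<cdot> \<pi>\<^sub>2" "p\<^sub>2 \<cdot> q\<^sub>2 = p"
    "\<sigma> \<pi>\<^sub>1 \<cdot> K = k\<^sub>1" "\<sigma> \<pi>\<^sub>2 \<cdot> K = k\<^sub>2" "is_pullback gl p\<^sub>1 p\<^sub>2 q\<^sub>1 q\<^sub>2"
proof -
  note [simp] = glue_simps [OF t1, simplified] glue_simps [OF t2, simplified]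
  obtain P \<iota>\<^sub>1 \<iota>\<^sub>2 \<pi>\<^sub>1 \<pi>\<^sub>2 where P [simp]: "P \<in> B\<^sub>0" and
    bi: "\<iota>\<^sub>1 \<in> Hom D B P" "\<iota>\<^sub>2 \<in> Hom D B P" "\<pi>\<^sub>1 \<in> Hom D P B" "\<pi>\<^sub>2 \<in> Hom D P B" and
    bi2: "\<pi>\<^sub>1 \<cdot> \<iota>\<^sub>1 = Ident D B" "\<pi>\<^sub>2 \<cdot> \<iota>\<^sub>2 = Ident D B" "\<pi>\<^sub>2 \<cdot> \<iota>\<^sub>1 = Zero D B B" "\<pi>\<^sub>1 \<cdot> \<iota>\<^sub>2 = Zero D B B"
    "Plus D (\<iota>\<^sub>1 \<cdot> \<pi>\<^sub>1) (\<iota>\<^sub>2 \<cdot> \<pi>\<^sub>2) = Ident D P"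
    using B0_biproduct [of B B] by (metis glue_simps(7) t1 assms(3))
  have [simp]: "\<iota>\<^sub>1 \<in> Arr D" "Dom D \<iota>\<^sub>1 = B" "Cod D \<iota>\<^sub>1 = P" "\<iota>\<^sub>2 \<in> Arr D" "Dom D \<iota>\<^sub>2 = B" "Cod D \<iota>\<^sub>2 = P"
    "\<pi>\<^sub>1 \<in> Arr D" "Dom D \<pi>\<^sub>1 = P" "Cod D \<pi>\<^sub>1 = B" "\<pi>\<^sub>2 \<in> Arr D" "Dom D \<pi>\<^sub>2 = P" "Cod D \<pi>\<^sub>2 = B"
    using bi by auto
  \<comment> \<open>Sum over the two injections, so that the biproduct equations recover
    \<open>k\<^sub>1\<close> and \<open>k\<^sub>2\<close> under the projections.\<close>
  define K where "K = Plus D (\<sigma> \<iota>\<^sub>1 \<cdot> k\<^sub>1) (\<sigma> \<iota>\<^sub>2 \<cdot> k\<^sub>2)"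
  have [simp]: "K \<in> Arr D" "Dom D K = A" "Cod D K = \<Sigma> P"
    by (auto simp: K_def)
  have "\<sigma> \<pi>\<^sub>1 \<cdot> (\<sigma> \<iota>\<^sub>1 \<cdot> k\<^sub>1) = \<sigma> (\<pi>\<^sub>1 \<cdot> \<iota>\<^sub>1) \<cdot> k\<^sub>1" "\<sigma> \<pi>\<^sub>1 \<cdot> (\<sigma> \<iota>\<^sub>2 \<cdot> k\<^sub>2) = \<sigma> (\<pi>\<^sub>1 \<cdot> \<iota>\<^sub>2) \<cdot> k\<^sub>2"
    "\<sigma> \<pi>\<^sub>2 \<cdot> (\<sigma> \<iota>\<^sub>1 \<cdot> k\<^sub>1) = \<sigma> (\<pi>\<^sub>2 \<cdot> \<iota>\<^sub>1) \<cdot> k\<^sub>1" "\<sigma> \<pi>\<^sub>2 \<cdot> (\<sigma> \<iota>\<^sub>2 \<cdot> k\<^sub>2) = \<sigma> (\<pi>\<^sub>2 \<cdot> \<iota>\<^sub>2) \<cdot> k\<^sub>2"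
    by (simp_all add: shift_Comp assoc)
  then have \<pi>K: "\<sigma> \<pi>\<^sub>1 \<cdot> K = k\<^sub>1" "\<sigma> \<pi>\<^sub>2 \<cdot> K = k\<^sub>2"
    by (simp_all add: K_def bi2 shift.fmap_Ident)
  have A [simp]: "A \<in> A\<^sub>0" "B \<in> B\<^sub>0" using glue_simps [OF t1] by auto
  have "K \<in> Hom D A (\<Sigma> P)" by simp
  then obtain i p where t: "(i, p, K) \<in> glue_triangles" and [simp]: "Dom D i = P" "Cod D p = A"
    using ext_class_nonempty [OF A(1) P] by blast
  note [simp] = glue_simps [OF t, simplified]
  obtain q\<^sub>1 where q1: "q\<^sub>1 \<in> Hom D (Cod D i) (Cod D i\<^sub>1)" "q\<^sub>1 \<cdot> i = i\<^sub>1 \<cdot> \<pi>\<^sub>1" "p\<^sub>1 \<cdot> q\<^sub>1 = p"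
    using glue_fill [OF t t1, of \<pi>\<^sub>1 "Ident D A"] by (auto simp: \<pi>K)
  obtain q\<^sub>2 where q2: "q\<^sub>2 \<in> Hom D (Cod D i) (Cod D i\<^sub>2)" "q\<^sub>2 \<cdot> i = i\<^sub>2 \<cdot> \<pi>\<^sub>2" "p\<^sub>2 \<cdot> q\<^sub>2 = p"
    using glue_fill [OF t t2, of \<pi>\<^sub>2 "Ident D A"] by (auto simp: \<pi>K)
  have [simp]: "q\<^sub>1 \<in> Arr D" "Dom D q\<^sub>1 = Cod D i" "Cod D q\<^sub>1 = Cod D i\<^sub>1"
    "q\<^sub>2 \<in> Arr D" "Dom D q\<^sub>2 = Cod D i" "Cod D q\<^sub>2 = Cod D i\<^sub>2"
    using q1 q2 by auto
  have "\<exists>!u. u \<in> Hom gl (Dom D a) (Cod D i) \<and> q\<^sub>1 \<cdot> u = a \<and> q\<^sub>2 \<cdot> u = b"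
    if "a \<in> Arr D" "b \<in> Arr D" "Dom D a \<in> H" "Dom D a = Dom D b" "Cod D a = Cod D i\<^sub>1" "Cod D b = Cod D i\<^sub>2"
      and ab: "p\<^sub>1 \<cdot> a = p\<^sub>2 \<cdot> b" for a b
  proof -
    note [simp] = that(1,2) that(4) [symmetric] that(5,6)
    have TH [simp]: "Dom D a \<in> H" by fact
    let ?T = "Dom D a"
    \<comment> \<open>The obstruction to lifting the common composite along \<open>p\<close> splits
      into two summands, and each contains a product \<open>k\<^sub>1 \<cdot> p\<^sub>1\<close> or
      \<open>k\<^sub>2 \<cdot> p\<^sub>2\<close>, which is zero.\<close>
    have "K \<cdot> (p\<^sub>1 \<cdot> a) = Plus D (\<sigma> \<iota>\<^sub>1 \<cdot> ((k\<^sub>1 \<cdot> p\<^sub>1) \<cdot> a)) (\<sigma> \<iota>\<^sub>2 \<cdot> ((k\<^sub>2 \<cdot> p\<^sub>2) \<cdot> b))"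
      by (simp add: K_def assoc ab)
    also have "\<dots> = Zero D ?T (\<Sigma> P)"
      by (simp add: glue_k_p [OF t1] glue_k_p [OF t2])
    finally obtain u0 where u0: "u0 \<in> Hom D ?T (Cod D i)" "p \<cdot> u0 = p\<^sub>1 \<cdot> a"
      using lift_along_p [OF t, of "p\<^sub>1 \<cdot> a"] by auto
    have [simp]: "u0 \<in> Arr D" "Dom D u0 = ?T" "Cod D u0 = Cod D i" using u0 by auto
    have "p\<^sub>1 \<cdot> (q\<^sub>1 \<cdot> u0) = p\<^sub>1 \<cdot> a" "p\<^sub>2 \<cdot> (q\<^sub>2 \<cdot> u0) = p\<^sub>1 \<cdot> a"
      by (simp_all add: assoc [symmetric] q1 q2 u0)
    then have "p\<^sub>1 \<cdot> Plus D a (Neg D (q\<^sub>1 \<cdot> u0)) = Zero D ?T A"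
      "p\<^sub>2 \<cdot> Plus D b (Neg D (q\<^sub>2 \<cdot> u0)) = Zero D ?T A"
      using ab by simp_all
    note 0 = this
    obtain v\<^sub>1 where v1: "v\<^sub>1 \<in> Hom D ?T B" "i\<^sub>1 \<cdot> v\<^sub>1 = Plus D a (Neg D (q\<^sub>1 \<cdot> u0))"
      by (rule lift_along_i [OF t1, of "Plus D a (Neg D (q\<^sub>1 \<cdot> u0))"]) (use 0 in \<open>simp_all del: Comp_Plus'\<close>)
    obtain v\<^sub>2 where v2: "v\<^sub>2 \<in> Hom D ?T B" "i\<^sub>2 \<cdot> v\<^sub>2 = Plus D b (Neg D (q\<^sub>2 \<cdot> u0))"
      by (rule lift_along_i [OF t2, of "Plus D b (Neg D (q\<^sub>2 \<cdot> u0))"]) (use 0 in \<open>simp_all del: Comp_Plus'\<close>)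
    note v = v1 v2
    have [simp]: "v\<^sub>1 \<in> Arr D" "Dom D v\<^sub>1 = ?T" "Cod D v\<^sub>1 = B" "v\<^sub>2 \<in> Arr D" "Dom D v\<^sub>2 = ?T" "Cod D v\<^sub>2 = B"
      using v by auto
    \<comment> \<open>The defects of \<open>u0\<close> under the two projections factor through
      \<open>i\<^sub>1\<close> and \<open>i\<^sub>2\<close>; one arrow into the biproduct corrects
      both at once.\<close>
    define v where "v = Plus D (\<iota>\<^sub>1 \<cdot> v\<^sub>1) (\<iota>\<^sub>2 \<cdot> v\<^sub>2)"
    have [simp]: "v \<in> Arr D" "Dom D v = ?T" "Cod D v = P"
      by (auto simp: v_def)
    have "\<pi>\<^sub>1 \<cdot> v = v\<^sub>1" "\<pi>\<^sub>2 \<cdot> v = v\<^sub>2"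
      by (simp_all add: v_def assoc [symmetric] bi2)
    then have "q\<^sub>1 \<cdot> (i \<cdot> v) = i\<^sub>1 \<cdot> v\<^sub>1" "q\<^sub>2 \<cdot> (i \<cdot> v) = i\<^sub>2 \<cdot> v\<^sub>2"
      using assoc [of v i q\<^sub>1] assoc [of v i q\<^sub>2] by (simp_all add: q1 q2 assoc)
    moreover have "Plus D (q\<^sub>1 \<cdot> u0) (i\<^sub>1 \<cdot> v\<^sub>1) = a" "Plus D (q\<^sub>2 \<cdot> u0) (i\<^sub>2 \<cdot> v\<^sub>2) = b"
      unfolding v by (simp_all add: Plus_Minus_cancel)
    ultimately have qu: "q\<^sub>1 \<cdot> Plus D u0 (i \<cdot> v) = a" "q\<^sub>2 \<cdot> Plus D u0 (i \<cdot> v) = b"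
      by simp_all
    have uniq: "w = w'" if w: "w \<in> Hom D ?T (Cod D i)" "w' \<in> Hom D ?T (Cod D i)"
      "q\<^sub>1 \<cdot> w = q\<^sub>1 \<cdot> w'" "q\<^sub>2 \<cdot> w = q\<^sub>2 \<cdot> w'" for w w'
    proof (rule Minus_eq_Zero)
      define e where "e = Plus D w (Neg D w')"
      have e: "e \<in> Hom D ?T (Cod D i)" "q\<^sub>1 \<cdot> e = Zero D ?T (Cod D i\<^sub>1)" "q\<^sub>2 \<cdot> e = Zero D ?T (Cod D i\<^sub>2)"
        using w by (auto simp: e_def)
      then have "p \<cdot> e = Zero D ?T A"
        using assoc [of e q\<^sub>1 p\<^sub>1] by (simp add: q1)
      then obtain x where x: "x \<in> Hom D ?T P" "i \<cdot> x = e"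
        using lift_along_i [OF t, of e] e by auto
      have [simp]: "x \<in> Arr D" "Dom D x = ?T" "Cod D x = P" using x by auto
      have "i\<^sub>1 \<cdot> (\<pi>\<^sub>1 \<cdot> x) = q\<^sub>1 \<cdot> (i \<cdot> x)" "i\<^sub>2 \<cdot> (\<pi>\<^sub>2 \<cdot> x) = q\<^sub>2 \<cdot> (i \<cdot> x)"
        by (simp_all add: assoc [symmetric] q1 q2)
      then have "i\<^sub>1 \<cdot> (\<pi>\<^sub>1 \<cdot> x) = i\<^sub>1 \<cdot> Zero D ?T B" "i\<^sub>2 \<cdot> (\<pi>\<^sub>2 \<cdot> x) = i\<^sub>2 \<cdot> Zero D ?T B"
        using x e by simp_all
      then have "\<pi>\<^sub>1 \<cdot> x = Zero D ?T B" "\<pi>\<^sub>2 \<cdot> x = Zero D ?T B"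
        using glue_mono [OF t1 TH, of "\<pi>\<^sub>1 \<cdot> x"] glue_mono [OF t2 TH, of "\<pi>\<^sub>2 \<cdot> x"] by simp_all
      then have "Plus D (\<iota>\<^sub>1 \<cdot> \<pi>\<^sub>1) (\<iota>\<^sub>2 \<cdot> \<pi>\<^sub>2) \<cdot> x = Zero D ?T P"
        by (simp add: assoc)
      then have "x = Zero D ?T P"
        by (simp only: bi2) simp
      then show "Plus D w (Neg D w') = Zero D (Dom D w') (Cod D w')"
        using x w by (auto simp: e_def)
    qed (use w in auto)
    show ?thesis
    proof (rule ex1I [of _ "Plus D u0 (i \<cdot> v)"])
      show "Plus D u0 (i \<cdot> v) \<in> Hom gl ?T (Cod D i) \<and> q\<^sub>1 \<cdot> Plus D u0 (i \<cdot> v) = a \<and> q\<^sub>2 \<cdot> Plus D u0 (i \<cdot> v) = b"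
        using qu by (simp del: Comp_Plus')
    next
      fix w assume "w \<in> Hom gl ?T (Cod D i) \<and> q\<^sub>1 \<cdot> w = a \<and> q\<^sub>2 \<cdot> w = b"
      then show "w = Plus D u0 (i \<cdot> v)"
        using qu by - (rule uniq, simp_all del: Comp_Plus')
    qed
  qed
  then have "is_pullback gl p\<^sub>1 p\<^sub>2 q\<^sub>1 q\<^sub>2"
    unfolding is_pullback_def by (auto simp: q1 q2)
  with P bi bi2 t q1 q2 \<pi>K show ?thesis
    by (intro that [of P \<iota>\<^sub>1 \<iota>\<^sub>2 \<pi>\<^sub>1 \<pi>\<^sub>2 i p K q\<^sub>1 q\<^sub>2]) simp_all
qed

text \<open>For two copies of \<open>B\<close>, the codiagonal \<tau> is a cokernel of the skew
  diagonal \<delta>. Dividing the fibre product by the skew diagonal therefore amounts to pushing it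
  out along \<tau>, which turns the class with components \<open>k\<^sub>1\<close> and
  \<open>k\<^sub>2\<close> into their sum.\<close>

lemma baer_sum_ext_class:
  assumes A: "A \<in> A\<^sub>0" and B: "B \<in> B\<^sub>0" and k: "k\<^sub>1 \<in> Hom D A (\<Sigma> B)" "k\<^sub>2 \<in> Hom D A (\<Sigma> B)"
  shows "baer_sum gl (ext_class A B k\<^sub>1) (ext_class A B k\<^sub>2) = ext_class A B (Plus D k\<^sub>1 k\<^sub>2)"
proof -
  note [simp] = A B
  have k' [simp]: "k\<^sub>1 \<in> Arr D" "Dom D k\<^sub>1 = A" "Cod D k\<^sub>1 = \<Sigma> B" "k\<^sub>2 \<in> Arr D" "Dom D k\<^sub>2 = A" "Cod D k\<^sub>2 = \<Sigma> B"
    using k by auto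
  have "(i, p) \<in> ext_class A B (Plus D k\<^sub>1 k\<^sub>2)"
    if "(i, p) \<in> baer_sum gl (ext_class A B k\<^sub>1) (ext_class A B k\<^sub>2)" for i p
  proof -
    from that obtain i\<^sub>1 p\<^sub>1 i\<^sub>2 p\<^sub>2 r\<^sub>1 r\<^sub>2 s j c where ip1: "(i\<^sub>1, p\<^sub>1) \<in> ext_class A B k\<^sub>1"
      and ip2: "(i\<^sub>2, p\<^sub>2) \<in> ext_class A B k\<^sub>2" and pb: "is_pullback gl p\<^sub>1 p\<^sub>2 r\<^sub>1 r\<^sub>2"
      and s: "s \<in> Hom gl (Dom D i\<^sub>1) (Dom D r\<^sub>1)" "r\<^sub>1 \<cdot> s = i\<^sub>1" "r\<^sub>2 \<cdot> s = Neg gl i\<^sub>2"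
      and j: "j \<in> Hom gl (Dom D i\<^sub>1) (Dom D r\<^sub>1)" "r\<^sub>1 \<cdot> j = i\<^sub>1" "r\<^sub>2 \<cdot> j = Zero D (Dom D i\<^sub>1) (Cod D r\<^sub>2)"
      and c: "is_cokernel gl c s" and ext: "(i, p) \<in> extensions gl (Cod D p\<^sub>1) (Dom D i\<^sub>1)"
      and ic: "i = c \<cdot> j" and pc: "p \<cdot> c = p\<^sub>1 \<cdot> r\<^sub>1"
      unfolding baer_sum_def mem_Collect_eq prod.case full_subcat_simps full_subcat_additive_simps by blast
    note t1 = ext_classD [OF ip1 A B] and t2 = ext_classD [OF ip2 A B]
    note [simp] = glue_simps [OF t1(1)] glue_simps [OF t2(1)] t1(2,3) t2(2,3)
    obtain P \<iota>\<^sub>1 \<iota>\<^sub>2 \<pi>\<^sub>1 \<pi>\<^sub>2 i' p' q\<^sub>1 q\<^sub>2 K where P [simp]: "P \<in> B\<^sub>0"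
      and bi: "\<iota>\<^sub>1 \<in> Hom D B P" "\<iota>\<^sub>2 \<in> Hom D B P" "\<pi>\<^sub>1 \<in> Hom D P B" "\<pi>\<^sub>2 \<in> Hom D P B"
      and bi2: "\<pi>\<^sub>1 \<cdot> \<iota>\<^sub>1 = Ident D B" "\<pi>\<^sub>2 \<cdot> \<iota>\<^sub>2 = Ident D B" "\<pi>\<^sub>2 \<cdot> \<iota>\<^sub>1 = Zero D B B" "\<pi>\<^sub>1 \<cdot> \<iota>\<^sub>2 = Zero D B B"
        "Plus D (\<iota>\<^sub>1 \<cdot> \<pi>\<^sub>1) (\<iota>\<^sub>2 \<cdot> \<pi>\<^sub>2) = Ident D P"
      and t: "(i', p', K) \<in> glue_triangles" "Dom D i' = P" "Cod D p' = A"
      and q1: "q\<^sub>1 \<in> Hom D (Cod D i') (Cod D i\<^sub>1)" "q\<^sub>1 \<cdot> i' = i\<^sub>1 \<cdot> \<pi>\<^sub>1" "p\<^sub>1 \<cdot> q\<^sub>1 = p'"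
      and q2: "q\<^sub>2 \<in> Hom D (Cod D i') (Cod D i\<^sub>2)" "q\<^sub>2 \<cdot> i' = i\<^sub>2 \<cdot> \<pi>\<^sub>2" "p\<^sub>2 \<cdot> q\<^sub>2 = p'"
      and \<pi>K: "\<sigma> \<pi>\<^sub>1 \<cdot> K = k\<^sub>1" "\<sigma> \<pi>\<^sub>2 \<cdot> K = k\<^sub>2"
      by (rule fibre_product [OF t1(1) t2(1) t1(2) t2(2) t1(3) t2(3)])
    note [simp] = glue_simps [OF t(1)] t(2,3)
    have [simp]: "\<iota>\<^sub>1 \<in> Arr D" "Dom D \<iota>\<^sub>1 = B" "Cod D \<iota>\<^sub>1 = P" "\<iota>\<^sub>2 \<in> Arr D" "Dom D \<iota>\<^sub>2 = B" "Cod D \<iota>\<^sub>2 = P"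
      "\<pi>\<^sub>1 \<in> Arr D" "Dom D \<pi>\<^sub>1 = P" "Cod D \<pi>\<^sub>1 = B" "\<pi>\<^sub>2 \<in> Arr D" "Dom D \<pi>\<^sub>2 = P" "Cod D \<pi>\<^sub>2 = B"
      "q\<^sub>1 \<in> Arr D" "Dom D q\<^sub>1 = Cod D i'" "Cod D q\<^sub>1 = Cod D i\<^sub>1"
      "q\<^sub>2 \<in> Arr D" "Dom D q\<^sub>2 = Cod D i'" "Cod D q\<^sub>2 = Cod D i\<^sub>2"
      using bi q1 q2 by auto
    have [simp]: "r\<^sub>1 \<in> Arr D" "Dom D r\<^sub>1 \<in> H" "Cod D r\<^sub>1 = Cod D i\<^sub>1"
      "r\<^sub>2 \<in> Arr D" "Dom D r\<^sub>2 = Dom D r\<^sub>1" "Cod D r\<^sub>2 = Cod D i\<^sub>2"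
      using pb by (auto simp: is_pullback_def)
    have [simp]: "s \<in> Arr D" "Dom D s = B" "Cod D s = Dom D r\<^sub>1" "j \<in> Arr D" "Dom D j = B" "Cod D j = Dom D r\<^sub>1"
      using s j by auto
    have [simp]: "c \<in> Arr D" "Dom D c = Dom D r\<^sub>1" "Cod D c \<in> H" and cs: "c \<cdot> s = Zero D B (Cod D c)"
      using c by (auto simp: is_cokernel_def)
    have Neg_i2: "Neg gl i\<^sub>2 = Neg D i\<^sub>2" by (rule Neg_full_subcat) auto
    have univ: "\<exists>!u. u \<in> Hom D (Dom D a) (Dom D r\<^sub>1) \<and> r\<^sub>1 \<cdot> u = a \<and> r\<^sub>2 \<cdot> u = b"
      if "a \<in> Arr D" "b \<in> Arr D" "Dom D a \<in> H" "Dom D a = Dom D b" "Cod D a = Cod D i\<^sub>1" "Cod D b = Cod D i\<^sub>2"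
        "p\<^sub>1 \<cdot> a = p\<^sub>2 \<cdot> b" for a b
    proof -
      have "\<forall>a \<in> Arr gl. \<forall>b \<in> Arr gl. Dom D a = Dom D b \<and> Cod D a = Dom D p\<^sub>1 \<and> Cod D b = Dom D p\<^sub>2 \<and>
          p\<^sub>1 \<cdot> a = p\<^sub>2 \<cdot> b \<longrightarrow> (\<exists>!u. u \<in> Hom gl (Dom D a) (Dom D r\<^sub>1) \<and> r\<^sub>1 \<cdot> u = a \<and> r\<^sub>2 \<cdot> u = b)"
        using pb unfolding is_pullback_def full_subcat_simps by blast
      from bspec [OF bspec [OF this, of a], of b] that show ?thesis
        by (simp add: Hom_full_subcat del: in_Hom_iff)
    qed
    \<comment> \<open>Comparison of the fibre product built from triangles with the arbitrary
      pullback used in the given Baer sum.\<close>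
    obtain u where u: "u \<in> Hom D (Cod D i') (Dom D r\<^sub>1)" "r\<^sub>1 \<cdot> u = q\<^sub>1" "r\<^sub>2 \<cdot> u = q\<^sub>2"
      using univ [of q\<^sub>1 q\<^sub>2] by (auto simp: q1 q2)
    have [simp]: "u \<in> Arr D" "Dom D u = Cod D i'" "Cod D u = Dom D r\<^sub>1" using u by auto
    have "p\<^sub>1 \<cdot> i\<^sub>1 = Zero D B A" "p\<^sub>2 \<cdot> i\<^sub>2 = Zero D B A"
      using glue_p_i [OF t1(1)] glue_p_i [OF t2(1)] by simp_all
    note pi = this
    have qi: "q\<^sub>1 \<cdot> (i' \<cdot> x) = i\<^sub>1 \<cdot> (\<pi>\<^sub>1 \<cdot> x)" "q\<^sub>2 \<cdot> (i' \<cdot> x) = i\<^sub>2 \<cdot> (\<pi>\<^sub>2 \<cdot> x)" if "x \<in> Hom D B P" for x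
      using that assoc [of x i' q\<^sub>1] assoc [of x i' q\<^sub>2] by (simp_all add: q1 q2 assoc)
    have ru: "r\<^sub>1 \<cdot> (u \<cdot> x) = q\<^sub>1 \<cdot> x" "r\<^sub>2 \<cdot> (u \<cdot> x) = q\<^sub>2 \<cdot> x" if "x \<in> Hom D B (Cod D i')" for x
      using that assoc [of x u r\<^sub>1] assoc [of x u r\<^sub>2] by (simp_all add: u)
    \<comment> \<open>Under \<open>u\<close> the first injection corresponds to \<open>j\<close>
      and, further on, \<delta> to the given skew diagonal \<open>s\<close>; both are tested on the
      two projections.\<close>
    have uj: "u \<cdot> (i' \<cdot> \<iota>\<^sub>1) = j"
      by (rule ex1_eqI [OF univ [of i\<^sub>1 "Zero D B (Cod D i\<^sub>2)"]]) (simp_all add: pi ru qi bi2 j)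
    define \<delta> where "\<delta> = Plus D \<iota>\<^sub>1 (Neg D \<iota>\<^sub>2)"
    have \<delta> [simp]: "\<delta> \<in> Arr D" "Dom D \<delta> = B" "Cod D \<delta> = P" "\<pi>\<^sub>1 \<cdot> \<delta> = Ident D B" "\<pi>\<^sub>2 \<cdot> \<delta> = Neg D (Ident D B)"
      by (simp_all add: \<delta>_def bi2)
    have us: "u \<cdot> (i' \<cdot> \<delta>) = s"
      by (rule ex1_eqI [OF univ [of i\<^sub>1 "Neg D i\<^sub>2"]]) (simp_all add: pi ru qi s Neg_i2)
    \<comment> \<open>The restriction of \<open>c \<cdot> u\<close> to the biproduct. It is
      \<open>i\<close> on the first summand because \<open>i = c \<cdot> j\<close>, and on the
      second because \<open>c\<close> kills the skew diagonal; so it is the codiagonal followed by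
      \<open>i\<close>.\<close>
    define m where "m = c \<cdot> (u \<cdot> i')"
    have [simp]: "m \<in> Arr D" "Dom D m = P" "Cod D m = Cod D c" by (simp_all add: m_def)
    have m1: "m \<cdot> \<iota>\<^sub>1 = i"
      using uj by (simp add: m_def assoc ic)
    then have [simp]: "i \<in> Arr D" "Dom D i = B" "Cod D i = Cod D c"
      by auto
    have "m \<cdot> \<delta> = Zero D B (Cod D c)"
      using us cs by (simp add: m_def assoc)
    then have "Plus D (m \<cdot> \<iota>\<^sub>1) (Neg D (m \<cdot> \<iota>\<^sub>2)) = Zero D B (Cod D c)"
      by (simp add: \<delta>_def)
    then have m2: "m \<cdot> \<iota>\<^sub>2 = i"
      unfolding m1 by - (rule Minus_eq_Zero [symmetric], simp_all)
    have "m = m \<cdot> Plus D (\<iota>\<^sub>1 \<cdot> \<pi>\<^sub>1) (\<iota>\<^sub>2 \<cdot> \<pi>\<^sub>2)"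
      unfolding bi2 by simp
    also have "\<dots> = Plus D ((m \<cdot> \<iota>\<^sub>1) \<cdot> \<pi>\<^sub>1) ((m \<cdot> \<iota>\<^sub>2) \<cdot> \<pi>\<^sub>2)"
      by (simp add: assoc)
    also have "\<dots> = i \<cdot> Plus D \<pi>\<^sub>1 \<pi>\<^sub>2"
      by (simp add: m1 m2)
    finally have cu: "(c \<cdot> u) \<cdot> i' = i \<cdot> Plus D \<pi>\<^sub>1 \<pi>\<^sub>2"
      by (simp add: m_def assoc)
    obtain \<kappa> where t': "(i, p, \<kappa>) \<in> glue_triangles" "Dom D i = B" "Cod D p = A"
      using extension_triangle [OF A B ext [simplified]] .
    note [simp] = glue_simps [OF t'(1), simplified] t'(3)
    have "p \<cdot> (c \<cdot> u) = p'"
      using assoc [of u c p] assoc [of u r\<^sub>1 p\<^sub>1] by (simp add: pc u q1)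
    \<comment> \<open>Hence \<open>c \<cdot> u\<close> is a map of extensions over the codiagonal
      and the identity of \<open>A\<close>.\<close>
    then have "\<sigma> (Plus D \<pi>\<^sub>1 \<pi>\<^sub>2) \<cdot> K = \<kappa>"
      using glue_compat [OF t(1) t'(1), of "Plus D \<pi>\<^sub>1 \<pi>\<^sub>2" "c \<cdot> u" "Ident D A"] cu by simp
    then have "\<kappa> = Plus D k\<^sub>1 k\<^sub>2"
      by (simp add: shift_Plus \<pi>K)
    with t' show ?thesis by (intro ext_classI) auto
  qed
  moreover have "(i, p) \<in> baer_sum gl (ext_class A B k\<^sub>1) (ext_class A B k\<^sub>2)"
    if ip: "(i, p) \<in> ext_class A B (Plus D k\<^sub>1 k\<^sub>2)" for i p
  proof -
    obtain i\<^sub>1 p\<^sub>1 where ip1: "(i\<^sub>1, p\<^sub>1) \<in> ext_class A B k\<^sub>1" using ext_class_nonempty [OF A B k(1)] .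
    obtain i\<^sub>2 p\<^sub>2 where ip2: "(i\<^sub>2, p\<^sub>2) \<in> ext_class A B k\<^sub>2" using ext_class_nonempty [OF A B k(2)] .
    note t0 = ext_classD [OF ip A B] and t1 = ext_classD [OF ip1 A B] and t2 = ext_classD [OF ip2 A B]
    note [simp] = glue_simps [OF t0(1)] glue_simps [OF t1(1)] glue_simps [OF t2(1)] t0(2,3) t1(2,3) t2(2,3)
    obtain P \<iota>\<^sub>1 \<iota>\<^sub>2 \<pi>\<^sub>1 \<pi>\<^sub>2 i' p' q\<^sub>1 q\<^sub>2 K where P [simp]: "P \<in> B\<^sub>0"
      and bi: "\<iota>\<^sub>1 \<in> Hom D B P" "\<iota>\<^sub>2 \<in> Hom D B P" "\<pi>\<^sub>1 \<in> Hom D P B" "\<pi>\<^sub>2 \<in> Hom D P B"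
      and bi2: "\<pi>\<^sub>1 \<cdot> \<iota>\<^sub>1 = Ident D B" "\<pi>\<^sub>2 \<cdot> \<iota>\<^sub>2 = Ident D B" "\<pi>\<^sub>2 \<cdot> \<iota>\<^sub>1 = Zero D B B" "\<pi>\<^sub>1 \<cdot> \<iota>\<^sub>2 = Zero D B B"
        "Plus D (\<iota>\<^sub>1 \<cdot> \<pi>\<^sub>1) (\<iota>\<^sub>2 \<cdot> \<pi>\<^sub>2) = Ident D P"
      and t: "(i', p', K) \<in> glue_triangles" "Dom D i' = P" "Cod D p' = A"
      and q1: "q\<^sub>1 \<in> Hom D (Cod D i') (Cod D i\<^sub>1)" "q\<^sub>1 \<cdot> i' = i\<^sub>1 \<cdot> \<pi>\<^sub>1" "p\<^sub>1 \<cdot> q\<^sub>1 = p'"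
      and q2: "q\<^sub>2 \<in> Hom D (Cod D i') (Cod D i\<^sub>2)" "q\<^sub>2 \<cdot> i' = i\<^sub>2 \<cdot> \<pi>\<^sub>2" "p\<^sub>2 \<cdot> q\<^sub>2 = p'"
      and \<pi>K: "\<sigma> \<pi>\<^sub>1 \<cdot> K = k\<^sub>1" "\<sigma> \<pi>\<^sub>2 \<cdot> K = k\<^sub>2"
      and pb: "is_pullback gl p\<^sub>1 p\<^sub>2 q\<^sub>1 q\<^sub>2"
      by (rule fibre_product [OF t1(1) t2(1) t1(2) t2(2) t1(3) t2(3)])
    note [simp] = glue_simps [OF t(1)] t(2,3)
    have [simp]: "\<iota>\<^sub>1 \<in> Arr D" "Dom D \<iota>\<^sub>1 = B" "Cod D \<iota>\<^sub>1 = P" "\<iota>\<^sub>2 \<in> Arr D" "Dom D \<iota>\<^sub>2 = B" "Cod D \<iota>\<^sub>2 = P"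
      "\<pi>\<^sub>1 \<in> Arr D" "Dom D \<pi>\<^sub>1 = P" "Cod D \<pi>\<^sub>1 = B" "\<pi>\<^sub>2 \<in> Arr D" "Dom D \<pi>\<^sub>2 = P" "Cod D \<pi>\<^sub>2 = B"
      "q\<^sub>1 \<in> Arr D" "Dom D q\<^sub>1 = Cod D i'" "Cod D q\<^sub>1 = Cod D i\<^sub>1"
      "q\<^sub>2 \<in> Arr D" "Dom D q\<^sub>2 = Cod D i'" "Cod D q\<^sub>2 = Cod D i\<^sub>2"
      using bi q1 q2 by auto
    define \<delta> where "\<delta> = Plus D \<iota>\<^sub>1 (Neg D \<iota>\<^sub>2)"
    have \<delta> [simp]: "\<delta> \<in> Arr D" "Dom D \<delta> = B" "Cod D \<delta> = P" "\<pi>\<^sub>1 \<cdot> \<delta> = Ident D B" "\<pi>\<^sub>2 \<cdot> \<delta> = Neg D (Ident D B)"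
      by (simp_all add: \<delta>_def bi2)
    have Neg_i2: "Neg gl i\<^sub>2 = Neg D i\<^sub>2" by (rule Neg_full_subcat) auto
    have qi: "q\<^sub>1 \<cdot> (i' \<cdot> x) = i\<^sub>1 \<cdot> (\<pi>\<^sub>1 \<cdot> x)" "q\<^sub>2 \<cdot> (i' \<cdot> x) = i\<^sub>2 \<cdot> (\<pi>\<^sub>2 \<cdot> x)" if "x \<in> Hom D B P" for x
      using that assoc [of x i' q\<^sub>1] assoc [of x i' q\<^sub>2] by (simp_all add: q1 q2 assoc)
    \<comment> \<open>The codiagonal: it sends \<open>K\<close> to the sum of the two classes, and
      so induces an arrow from the fibre product to the given extension.\<close>
    define \<tau> where "\<tau> = Plus D \<pi>\<^sub>1 \<pi>\<^sub>2"
    have \<tau> [simp]: "\<tau> \<in> Arr D" "Dom D \<tau> = P" "Cod D \<tau> = B" "\<tau> \<cdot> \<iota>\<^sub>1 = Ident D B" "\<tau> \<cdot> \<delta> = Zero D B B"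
      by (simp_all add: \<tau>_def bi2)
    have "\<sigma> \<tau> \<cdot> K = Plus D k\<^sub>1 k\<^sub>2"
      by (simp add: \<tau>_def shift_Plus \<pi>K)
    then obtain c where c: "c \<in> Hom D (Cod D i') (Cod D i)" "c \<cdot> i' = i \<cdot> \<tau>" "p \<cdot> c = p'"
      using glue_fill [OF t(1) t0(1), of \<tau> "Ident D A"] by auto
    have [simp]: "c \<in> Arr D" "Dom D c = Cod D i'" "Cod D c = Cod D i" using c by auto
    have po: "is_pushout gl i' \<tau> c i"
      using glue_pushout [OF t(1) t0(1)] c by auto
    have ci: "c \<cdot> (i' \<cdot> x) = i \<cdot> (\<tau> \<cdot> x)" if "x \<in> Hom D B P" for x
      using that assoc [of x i' c] by (simp add: c assoc)
    \<comment> \<open>An arrow killing the skew diagonal agrees on the two summands, so its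
      restriction to the biproduct factors through \<tau>; the pushout property then gives the
      factorization through \<open>c\<close>.\<close>
    have "\<exists>!u. u \<in> Hom gl (Cod D c) (Cod D g) \<and> u \<cdot> c = g"
      if g: "g \<in> Arr D" "Cod D g \<in> H" "Dom D g = Cod D i'" "g \<cdot> (i' \<cdot> \<delta>) = Zero D B (Cod D g)" for g
    proof -
      note [simp] = g(1-3)
      define m where "m = g \<cdot> i'"
      have [simp]: "m \<in> Arr D" "Dom D m = P" "Cod D m = Cod D g" by (simp_all add: m_def)
      have "Plus D (m \<cdot> \<iota>\<^sub>1) (Neg D (m \<cdot> \<iota>\<^sub>2)) = m \<cdot> \<delta>"
        by (simp add: \<delta>_def)
      also have "\<dots> = Zero D B (Cod D g)"
        using g(4) by (simp add: m_def assoc)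
      finally have m12: "m \<cdot> \<iota>\<^sub>1 = m \<cdot> \<iota>\<^sub>2"
        by - (rule Minus_eq_Zero, simp_all)
      have "m = m \<cdot> Plus D (\<iota>\<^sub>1 \<cdot> \<pi>\<^sub>1) (\<iota>\<^sub>2 \<cdot> \<pi>\<^sub>2)"
        unfolding bi2 by simp
      also have "\<dots> = Plus D ((m \<cdot> \<iota>\<^sub>1) \<cdot> \<pi>\<^sub>1) ((m \<cdot> \<iota>\<^sub>2) \<cdot> \<pi>\<^sub>2)"
        by (simp add: assoc)
      also have "\<dots> = (m \<cdot> \<iota>\<^sub>1) \<cdot> \<tau>"
        by (simp add: m12 \<tau>_def)
      finally have gi: "g \<cdot> i' = (g \<cdot> (i' \<cdot> \<iota>\<^sub>1)) \<cdot> \<tau>"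
        by (simp add: m_def assoc)
      define w where "w = g \<cdot> (i' \<cdot> \<iota>\<^sub>1)"
      have w [simp]: "w \<in> Arr D" "Dom D w = B" "Cod D w = Cod D g" by (simp_all add: w_def)
      have "\<forall>a \<in> Arr gl. \<forall>b \<in> Arr gl. Cod D a = Cod D b \<and> Dom D a = Cod D i' \<and> Dom D b = Cod D \<tau> \<and>
          a \<cdot> i' = b \<cdot> \<tau> \<longrightarrow> (\<exists>!u. u \<in> Hom gl (Cod D c) (Cod D a) \<and> u \<cdot> c = a \<and> u \<cdot> i = b)"
        using po unfolding is_pushout_def full_subcat_simps by blast
      from bspec [OF bspec [OF this, of g], of w] gi
      have ex1: "\<exists>!u. u \<in> Hom gl (Cod D c) (Cod D g) \<and> u \<cdot> c = g \<and> u \<cdot> i = w"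
        by (simp add: w_def del: in_Hom_iff)
      \<comment> \<open>Uniqueness in the pushout also asks for this equation; it is automatic
        because \<open>i\<close> equals
        \<open>c \<cdot> (i' \<cdot> \<iota>\<^sub>1)\<close>.\<close>
      have "u \<cdot> i = w" if u: "u \<in> Hom gl (Cod D c) (Cod D g)" "u \<cdot> c = g" for u
      proof -
        have "w = (u \<cdot> c) \<cdot> (i' \<cdot> \<iota>\<^sub>1)" using u by (simp add: w_def)
        also have "\<dots> = u \<cdot> (c \<cdot> (i' \<cdot> \<iota>\<^sub>1))" using u(1) by (intro assoc) auto
        also have "\<dots> = u \<cdot> i" by (simp add: ci)
        finally show ?thesis ..
      qed
      with ex1 show ?thesis by blast
    qed
    then have coker: "is_cokernel gl c (i' \<cdot> \<delta>)"
      unfolding is_cokernel_def by (auto simp: ci)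
    show ?thesis
      unfolding baer_sum_def mem_Collect_eq prod.case full_subcat_simps full_subcat_additive_simps
    proof (intro exI conjI)
      show "(i\<^sub>1, p\<^sub>1) \<in> ext_class A B k\<^sub>1" "(i\<^sub>2, p\<^sub>2) \<in> ext_class A B k\<^sub>2" "is_pullback gl p\<^sub>1 p\<^sub>2 q\<^sub>1 q\<^sub>2"
        "is_cokernel gl c (i' \<cdot> \<delta>)"
        by fact+
      show "i' \<cdot> \<delta> \<in> Hom gl (Dom D i\<^sub>1) (Dom D q\<^sub>1)" "i' \<cdot> \<iota>\<^sub>1 \<in> Hom gl (Dom D i\<^sub>1) (Dom D q\<^sub>1)"
        by simp_all
      show "q\<^sub>1 \<cdot> (i' \<cdot> \<delta>) = i\<^sub>1" "q\<^sub>2 \<cdot> (i' \<cdot> \<delta>) = Neg gl i\<^sub>2" "q\<^sub>1 \<cdot> (i' \<cdot> \<iota>\<^sub>1) = i\<^sub>1"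
        "q\<^sub>2 \<cdot> (i' \<cdot> \<iota>\<^sub>1) = Zero D (Dom D i\<^sub>1) (Cod D q\<^sub>2)"
        by (simp_all add: qi Neg_i2 bi2)
      show "(i, p) \<in> extensions gl (Cod D p\<^sub>1) (Dom D i\<^sub>1)"
        using ext_class_extension [OF ip A B] by simp
      show "i = c \<cdot> (i' \<cdot> \<iota>\<^sub>1)" "p \<cdot> c = p\<^sub>1 \<cdot> q\<^sub>1"
        by (simp_all add: ci c q1)
    qed
  qed
  ultimately show ?thesis by auto
qed

end

section \<open>The glued category\<close>

lemma glued_category_simps:
  "(X, Y, \<mu>) \<in> Obj (glued_category C C' M) \<longleftrightarrow> X \<in> Obj C \<and> Y \<in> Obj C' \<and> \<mu> \<in> carrier (bgrp M X Y)"
  "((X, Y, \<mu>), (X', Y', \<mu>'), f, g) \<in> Arr (glued_category C C' M) \<longleftrightarrow>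
     (X, Y, \<mu>) \<in> Obj (glued_category C C' M) \<and> (X', Y', \<mu>') \<in> Obj (glued_category C C' M) \<and>
     f \<in> Hom C X X' \<and> g \<in> Hom C' Y Y' \<and> bact M (Ident C X) g \<mu> = bact M f (Ident C' Y') \<mu>'"
  "Dom (glued_category C C' M) (P, Q, f, g) = P"
  "Cod (glued_category C C' M) (P, Q, f, g) = Q"
  "Ident (glued_category C C' M) (X, Y, \<mu>) = ((X, Y, \<mu>), (X, Y, \<mu>), Ident C X, Ident C' Y)"
  "Comp (glued_category C C' M) (P', Q', f', g') (P, Q, f, g) = (P, Q', f' \<cdot>\<^bsub>C\<^esub> f, g' \<cdot>\<^bsub>C'\<^esub> g)"
  by (simp_all add: glued_category_def Let_def del: in_Hom_iff)

text \<open>Bifunctoriality makes composition well defined: both sides of the compatibility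
  condition for a composite are equal to M(f, g') applied to the element \<mu>' of the middle
  object.\<close>

lemma (in bimodule) glued_category_category: "category (glued_category C C' M)"
proof -
  let ?G = "glued_category C C' M"
  have Arr_cases: "\<exists>X Y \<mu> X' Y' \<mu>' f g. h = ((X, Y, \<mu>), (X', Y', \<mu>'), f, g)" for h :: "('o \<times> 'p \<times> 'e) \<times> ('o \<times> 'p \<times> 'e) \<times> 'm \<times> 'n"
    by (metis prod.exhaust)
  have bact_assoc: "bact M f g (bact M f' g' \<mu>) = bact M (f' \<cdot>\<^bsub>C\<^esub> f) (g \<cdot>\<^bsub>C'\<^esub> g') \<mu>"
    if "f \<in> Arr C" "f' \<in> Arr C" "Cod C f = Dom C f'" "g \<in> Arr C'" "g' \<in> Arr C'" "Cod C' g' = Dom C' g"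
      "\<mu> \<in> carrier (bgrp M (Cod C f') (Dom C' g'))" for f g f' g' \<mu>
    using bact_Comp [of f "Dom C f" "Dom C f'" f' "Cod C f'" g' "Dom C' g'" "Dom C' g" g "Cod C' g" \<mu>] that
    by simp
  have Comp: "h' \<cdot>\<^bsub>?G\<^esub> h \<in> Hom ?G P R" if "h \<in> Hom ?G P Q" "h' \<in> Hom ?G Q R" for h h' P Q R
  proof -
    obtain X Y \<mu> X' Y' \<mu>' f g where h: "h = ((X, Y, \<mu>), (X', Y', \<mu>'), f, g)" using Arr_cases by blast
    obtain W V \<nu> X'' Y'' \<mu>'' f' g' where h': "h' = ((W, V, \<nu>), (X'', Y'', \<mu>''), f', g')" using Arr_cases by blast
    have Q: "W = X'" "V = Y'" "\<nu> = \<mu>'"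
      using that by (auto simp: h h' glued_category_simps)
    have 1: "X \<in> Obj C" "Y \<in> Obj C'" "\<mu> \<in> carrier (bgrp M X Y)" "X' \<in> Obj C" "Y' \<in> Obj C'"
      "\<mu>' \<in> carrier (bgrp M X' Y')" "f \<in> Arr C" "Dom C f = X" "Cod C f = X'" "g \<in> Arr C'" "Dom C' g = Y" "Cod C' g = Y'"
      "bact M (Ident C X) g \<mu> = bact M f (Ident C' Y') \<mu>'"
      using that(1) by (auto simp: h glued_category_simps)
    have 2: "X'' \<in> Obj C" "Y'' \<in> Obj C'"
      "\<mu>'' \<in> carrier (bgrp M X'' Y'')" "f' \<in> Arr C" "Dom C f' = X'" "Cod C f' = X''"
      "g' \<in> Arr C'" "Dom C' g' = Y'" "Cod C' g' = Y''"
      "bact M (Ident C X') g' \<mu>' = bact M f' (Ident C' Y'') \<mu>''"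
      using that(2) by (auto simp: h' Q glued_category_simps)
    have "bact M (Ident C X) (g' \<cdot>\<^bsub>C'\<^esub> g) \<mu> = bact M (Ident C X) g' (bact M (Ident C X) g \<mu>)"
      using 1(1-12) 2 by (simp add: bact_assoc)
    also have "\<dots> = bact M f g' \<mu>'"
      using 1 2 by (simp add: bact_assoc)
    also have "\<dots> = bact M f (Ident C' Y'') (bact M (Ident C X') g' \<mu>')"
      using 1 2(1-9) by (simp add: bact_assoc)
    also have "\<dots> = bact M f (Ident C' Y'') (bact M f' (Ident C' Y'') \<mu>'')"
      by (simp only: 2)
    also have "\<dots> = bact M (f' \<cdot>\<^bsub>C\<^esub> f) (Ident C' Y'') \<mu>''"
      using 1 2 by (simp add: bact_assoc)
    finally show ?thesis
      using 1 2 that by (auto simp: h h' glued_category_simps)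
  qed
  show ?thesis
  proof
    fix h P Q R S h' h'' assume "h \<in> Hom ?G P Q" "h' \<in> Hom ?G Q R" "h'' \<in> Hom ?G R S"
    moreover obtain X Y \<mu> X' Y' \<mu>' f g where "h = ((X, Y, \<mu>), (X', Y', \<mu>'), f, g)"
      using Arr_cases by blast
    moreover obtain V W \<nu> V' W' \<nu>' f' g' where "h' = ((V, W, \<nu>), (V', W', \<nu>'), f', g')"
      using Arr_cases by blast
    moreover obtain S T \<rho> S' T' \<rho>' f'' g'' where "h'' = ((S, T, \<rho>), (S', T', \<rho>'), f'', g'')"
      using Arr_cases by blast
    ultimately show "(h'' \<cdot>\<^bsub>?G\<^esub> h') \<cdot>\<^bsub>?G\<^esub> h = h'' \<cdot>\<^bsub>?G\<^esub> h' \<cdot>\<^bsub>?G\<^esub> h"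
      by (auto simp: glued_category_simps left.assoc right.assoc)
  next
    fix P assume "P \<in> Obj ?G"
    then show "Ident ?G P \<in> Hom ?G P P"
      by (cases P) (auto simp: glued_category_simps)
  qed (use Comp in \<open>auto simp: glued_category_simps\<close>)
qed

section \<open>The Ext bimodule and the equivalence\<close>

context glued_hearts
begin

abbreviation "M\<^sub>0 \<equiv> ext1_bimodule gl"

lemma bact_ext_class:
  assumes "f \<in> Hom D A' A" "A' \<in> A\<^sub>0" "A \<in> A\<^sub>0" "g \<in> Hom D B B'" "B \<in> B\<^sub>0" "B' \<in> B\<^sub>0" "k \<in> Hom D A (\<Sigma> B)"
  shows "bact M\<^sub>0 f g (ext_class A B k) = ext_class A' B' (\<sigma> g \<cdot> (k \<cdot> f))"
proof -
  have "k \<cdot> f \<in> Hom D A' (\<Sigma> B)" using assms by auto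
  then show ?thesis
    using assms by (simp add: ext1_bimodule_def ext_pull_ext_class ext_push_ext_class del: in_Hom_iff)
qed

lemma carrier_bgrp: "\<lbrakk>A \<in> A\<^sub>0; B \<in> B\<^sub>0\<rbrakk> \<Longrightarrow> carrier (bgrp M\<^sub>0 A B) = ext_class A B ` Hom D A (\<Sigma> B)"
  by (simp add: ext1_bimodule_def Ext1_eq)

text \<open>Carries the group laws over from hom groups: associativity, commutativity and inverses
  for Baer sums are obtained by transport.\<close>

lemma ext_class_iso:
  assumes A: "A \<in> A\<^sub>0" and B: "B \<in> B\<^sub>0"
  shows "ext_class A B \<in> iso (hom_group D A (\<Sigma> B)) (bgrp M\<^sub>0 A B)"
proof (rule isoI)
  show "ext_class A B \<in> hom (hom_group D A (\<Sigma> B)) (bgrp M\<^sub>0 A B)"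
    using carrier_bgrp [OF A B] baer_sum_ext_class [OF A B]
    by (intro homI) (auto simp: ext1_bimodule_def)
  show "bij_betw (ext_class A B) (carrier (hom_group D A (\<Sigma> B))) (carrier (bgrp M\<^sub>0 A B))"
    using ext_class_eq [OF A B] by (auto simp: bij_betw_def inj_on_def carrier_bgrp [OF A B] simp del: in_Hom_iff)
qed

lemma ext1_bimodule: "bimodule (full_subcat D A\<^sub>0) (full_subcat D B\<^sub>0) M\<^sub>0"
proof -
  interpret A: category "full_subcat D A\<^sub>0"
    by (rule full_subcat_category) auto
  interpret B: category "full_subcat D B\<^sub>0"
    by (rule full_subcat_category) auto
  show ?thesis
  proof (rule bimodule.intro [OF A.category_axioms B.category_axioms bimodule_axioms.intro])
    fix X Y assume "X \<in> Obj (full_subcat D A\<^sub>0)" "Y \<in> Obj (full_subcat D B\<^sub>0)"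
    then have XY: "X \<in> A\<^sub>0" "Y \<in> B\<^sub>0" by simp_all
    interpret G: comm_group "hom_group D X (\<Sigma> Y)"
      using XY by (intro hom_comm_group) auto
    \<comment> \<open>Transport along an isomorphism yields the target with its unit replaced by the
      image of zero; that image is the split class, so the record update changes nothing.\<close>
    have "(bgrp M\<^sub>0 X Y)\<lparr>one := ext_class X Y \<one>\<^bsub>hom_group D X (\<Sigma> Y)\<^esub>\<rparr> = bgrp M\<^sub>0 X Y"
      using split_class_eq [OF XY] by (simp add: ext1_bimodule_def)
    then show "comm_group (bgrp M\<^sub>0 X Y)"
      using G.iso_imp_img_comm_group [OF ext_class_iso [OF XY]] by simp
  next
    fix f g assume fg: "f \<in> Arr (full_subcat D A\<^sub>0)" "g \<in> Arr (full_subcat D B\<^sub>0)"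
    show "bact M\<^sub>0 f g \<in> hom (bgrp M\<^sub>0 (Cod (full_subcat D A\<^sub>0) f) (Dom (full_subcat D B\<^sub>0) g))
        (bgrp M\<^sub>0 (Dom (full_subcat D A\<^sub>0) f) (Cod (full_subcat D B\<^sub>0) g))"
    proof (rule homI)
      fix x assume "x \<in> carrier (bgrp M\<^sub>0 (Cod (full_subcat D A\<^sub>0) f) (Dom (full_subcat D B\<^sub>0) g))"
      then show "bact M\<^sub>0 f g x \<in> carrier (bgrp M\<^sub>0 (Dom (full_subcat D A\<^sub>0) f) (Cod (full_subcat D B\<^sub>0) g))"
        using fg by (auto simp: carrier_bgrp bact_ext_class)
    next
      fix x y assume "x \<in> carrier (bgrp M\<^sub>0 (Cod (full_subcat D A\<^sub>0) f) (Dom (full_subcat D B\<^sub>0) g))"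
        "y \<in> carrier (bgrp M\<^sub>0 (Cod (full_subcat D A\<^sub>0) f) (Dom (full_subcat D B\<^sub>0) g))"
      then obtain k l where kl: "k \<in> Hom D (Cod D f) (\<Sigma> (Dom D g))" "l \<in> Hom D (Cod D f) (\<Sigma> (Dom D g))"
        and x: "x = ext_class (Cod D f) (Dom D g) k" and y: "y = ext_class (Cod D f) (Dom D g) l"
        using fg by (auto simp: carrier_bgrp)
      show "bact M\<^sub>0 f g (x \<otimes>\<^bsub>bgrp M\<^sub>0 (Cod (full_subcat D A\<^sub>0) f) (Dom (full_subcat D B\<^sub>0) g)\<^esub> y)
          = bact M\<^sub>0 f g x \<otimes>\<^bsub>bgrp M\<^sub>0 (Dom (full_subcat D A\<^sub>0) f) (Cod (full_subcat D B\<^sub>0) g)\<^esub> bact M\<^sub>0 f g y"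
        using fg kl by (simp add: x y bact_ext_class)
          (simp add: ext1_bimodule_def baer_sum_ext_class bact_ext_class [unfolded ext1_bimodule_def, simplified])
    qed
  next
    fix X Y \<mu> assume "X \<in> Obj (full_subcat D A\<^sub>0)" "Y \<in> Obj (full_subcat D B\<^sub>0)" "\<mu> \<in> carrier (bgrp M\<^sub>0 X Y)"
    then show "bact M\<^sub>0 (Ident (full_subcat D A\<^sub>0) X) (Ident (full_subcat D B\<^sub>0) Y) \<mu> = \<mu>"
      by (auto simp: carrier_bgrp bact_ext_class shift.fmap_Ident)
  next
    fix f' X'' X' f X g Y Y' g' Y'' \<mu>
    assume *: "f' \<in> Hom (full_subcat D A\<^sub>0) X'' X'" "f \<in> Hom (full_subcat D A\<^sub>0) X' X"
      "g \<in> Hom (full_subcat D B\<^sub>0) Y Y'" "g' \<in> Hom (full_subcat D B\<^sub>0) Y' Y''" "\<mu> \<in> carrier (bgrp M\<^sub>0 X Y)"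
    then obtain k where "k \<in> Hom D X (\<Sigma> Y)" "\<mu> = ext_class X Y k"
      by (auto simp: carrier_bgrp)
    with * show "bact M\<^sub>0 (f \<cdot>\<^bsub>full_subcat D A\<^sub>0\<^esub> f') (g' \<cdot>\<^bsub>full_subcat D B\<^sub>0\<^esub> g) \<mu> = bact M\<^sub>0 f' g' (bact M\<^sub>0 f g \<mu>)"
      by (auto simp: bact_ext_class assoc shift_Comp)
  qed
qed

abbreviation "Gl \<equiv> glued_category (full_subcat D A\<^sub>0) (full_subcat D B\<^sub>0) M\<^sub>0"

text \<open>Injectivity of \<open>ext_class\<close> turns the required equation of Yoneda classes
  into an equation of arrows from \<open>A\<close> to \<open>\<Sigma> B'\<close>.\<close>

lemma Gl_Arr_iff:
  assumes "A \<in> A\<^sub>0" "A' \<in> A\<^sub>0" "B \<in> B\<^sub>0" "B' \<in> B\<^sub>0" "k \<in> Hom D A (\<Sigma> B)" "k' \<in> Hom D A' (\<Sigma> B')"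
  shows "((A, B, ext_class A B k), (A', B', ext_class A' B' k'), f, g) \<in> Arr Gl \<longleftrightarrow>
    f \<in> Hom D A A' \<and> g \<in> Hom D B B' \<and> \<sigma> g \<cdot> k = k' \<cdot> f"
proof -
  have "ext_class A B' (\<sigma> g \<cdot> k) = ext_class A B' (k' \<cdot> f) \<longleftrightarrow> \<sigma> g \<cdot> k = k' \<cdot> f"
    if "f \<in> Hom D A A'" "g \<in> Hom D B B'"
    using ext_class_eq [of A B' "\<sigma> g \<cdot> k" "k' \<cdot> f"] that assms by auto
  moreover have "bact M\<^sub>0 (Ident D A) g (ext_class A B k) = ext_class A B' (\<sigma> g \<cdot> k)"
    "bact M\<^sub>0 f (Ident D B') (ext_class A' B' k') = ext_class A B' (k' \<cdot> f)"
    if "f \<in> Hom D A A'" "g \<in> Hom D B B'"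
    using that assms bact_ext_class [of "Ident D A" A A g B B' k] bact_ext_class [of f A A' "Ident D B'" B' B' k']
    by (auto simp: shift.fmap_Ident)
  ultimately show ?thesis
    using assms by (auto simp: glued_category_simps carrier_bgrp)
qed

theorem gl_equivalent_Gl: "equivalent_categories gl Gl"
proof -
  interpret gl: category gl
    by (rule full_subcat_category) (rule H_subset)
  interpret M: bimodule "full_subcat D A\<^sub>0" "full_subcat D B\<^sub>0" M\<^sub>0
    by (rule ext1_bimodule)
  interpret Gl: category Gl
    by (rule M.glued_category_category)
  \<comment> \<open>One decomposition triangle is fixed for each object; the functor depends on this
    choice, with outer terms \<alpha> and \<beta>.\<close>
  have "\<forall>E. \<exists>i p k. E \<in> H \<longrightarrow> (i, p, k) \<in> glue_triangles \<and> Cod D i = E"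
    using H_decomposition unfolding glue_triangles_def by blast
  then obtain \<iota> \<pi> \<kappa> where *: "\<And>E. E \<in> H \<Longrightarrow> (\<iota> E, \<pi> E, \<kappa> E) \<in> glue_triangles \<and> Cod D (\<iota> E) = E"
    by metis
  then have t: "E \<in> H \<Longrightarrow> (\<iota> E, \<pi> E, \<kappa> E) \<in> glue_triangles" and Cod_\<iota> [simp]: "E \<in> H \<Longrightarrow> Cod D (\<iota> E) = E" for E
    by auto
  define \<beta> \<alpha> where "\<beta> E = Dom D (\<iota> E)" and "\<alpha> E = Cod D (\<pi> E)" for E
  have [simp]: "\<iota> E \<in> Arr D" "Dom D (\<iota> E) = \<beta> E" "\<beta> E \<in> B\<^sub>0" "\<pi> E \<in> Arr D" "Dom D (\<pi> E) = E" "Cod D (\<pi> E) = \<alpha> E"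
    "\<alpha> E \<in> A\<^sub>0" "\<kappa> E \<in> Arr D" "Dom D (\<kappa> E) = \<alpha> E" "Cod D (\<kappa> E) = \<Sigma> (\<beta> E)" if "E \<in> H" for E
    using glue_simps [OF t [OF that]] that by (auto simp: \<alpha>_def \<beta>_def)
  note compat = glue_compat [OF t t, simplified]
    and uniq = glue_unique [OF t t, simplified]
  have epi: "u = v" if "E \<in> H" "W \<in> A\<^sub>0" "u \<in> Hom D (\<alpha> E) W" "v \<in> Hom D (\<alpha> E) W" "u \<cdot> \<pi> E = v \<cdot> \<pi> E" for E W u v
    using glue_epi [OF t, of E W u v] that by simp
  have mono: "u = v" if "E \<in> H" "T \<in> B\<^sub>0" "u \<in> Hom D T (\<beta> E)" "v \<in> Hom D T (\<beta> E)" "\<iota> E \<cdot> u = \<iota> E \<cdot> v" for E T u v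
    using glue_mono [OF t, of E T u v] that by simp
  have "\<exists>c. c \<in> Hom D (\<alpha> (Dom D \<phi>)) (\<alpha> (Cod D \<phi>)) \<and> \<pi> (Cod D \<phi>) \<cdot> \<phi> = c \<cdot> \<pi> (Dom D \<phi>)"
    "\<exists>a. a \<in> Hom D (\<beta> (Dom D \<phi>)) (\<beta> (Cod D \<phi>)) \<and> \<phi> \<cdot> \<iota> (Dom D \<phi>) = \<iota> (Cod D \<phi>) \<cdot> a"
    if \<phi>: "\<phi> \<in> Arr gl" for \<phi>
  proof -
    have b: "\<phi> \<in> Hom D (Cod D (\<iota> (Dom D \<phi>))) (Cod D (\<iota> (Cod D \<phi>)))" and [simp]: "Dom D \<phi> \<in> H" "Cod D \<phi> \<in> H"
      using \<phi> by auto
    show "\<exists>c. c \<in> Hom D (\<alpha> (Dom D \<phi>)) (\<alpha> (Cod D \<phi>)) \<and> \<pi> (Cod D \<phi>) \<cdot> \<phi> = c \<cdot> \<pi> (Dom D \<phi>)"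
      by (rule glue_corestrict [OF t t b]) auto
    show "\<exists>a. a \<in> Hom D (\<beta> (Dom D \<phi>)) (\<beta> (Cod D \<phi>)) \<and> \<phi> \<cdot> \<iota> (Dom D \<phi>) = \<iota> (Cod D \<phi>) \<cdot> a"
      by (rule glue_restrict [OF t t b]) auto
  qed
  then obtain fa fb where "\<And>\<phi>. \<phi> \<in> Arr gl \<Longrightarrow> fa \<phi> \<in> Hom D (\<alpha> (Dom D \<phi>)) (\<alpha> (Cod D \<phi>)) \<and>
      \<pi> (Cod D \<phi>) \<cdot> \<phi> = fa \<phi> \<cdot> \<pi> (Dom D \<phi>)"
    "\<And>\<phi>. \<phi> \<in> Arr gl \<Longrightarrow> fb \<phi> \<in> Hom D (\<beta> (Dom D \<phi>)) (\<beta> (Cod D \<phi>)) \<and> \<phi> \<cdot> \<iota> (Dom D \<phi>) = \<iota> (Cod D \<phi>) \<cdot> fb \<phi>"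
    by metis
  then have fa_fb [simp]: "fa \<phi> \<in> Arr D" "Dom D (fa \<phi>) = \<alpha> (Dom D \<phi>)" "Cod D (fa \<phi>) = \<alpha> (Cod D \<phi>)"
      "fb \<phi> \<in> Arr D" "Dom D (fb \<phi>) = \<beta> (Dom D \<phi>)" "Cod D (fb \<phi>) = \<beta> (Cod D \<phi>)"
    and fa: "\<pi> (Cod D \<phi>) \<cdot> \<phi> = fa \<phi> \<cdot> \<pi> (Dom D \<phi>)"
    and fb: "\<phi> \<cdot> \<iota> (Dom D \<phi>) = \<iota> (Cod D \<phi>) \<cdot> fb \<phi>"
    if "\<phi> \<in> Arr D" "Dom D \<phi> \<in> H" "Cod D \<phi> \<in> H" for \<phi>
    using that by auto
  \<comment> \<open>The arrows on the outer terms were merely chosen. As \<pi> is epic and \<iota>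
    monic on the heart, they are unique, and functoriality follows from that.\<close>
  have fa_eq: "fa \<phi> = c" if "\<phi> \<in> Arr D" "Dom D \<phi> \<in> H" "Cod D \<phi> \<in> H" "c \<in> Hom D (\<alpha> (Dom D \<phi>)) (\<alpha> (Cod D \<phi>))"
    "\<pi> (Cod D \<phi>) \<cdot> \<phi> = c \<cdot> \<pi> (Dom D \<phi>)" for \<phi> c
    using that fa [of \<phi>] by - (rule epi [of "Dom D \<phi>" "\<alpha> (Cod D \<phi>)"], auto)
  have fb_eq: "fb \<phi> = a" if "\<phi> \<in> Arr D" "Dom D \<phi> \<in> H" "Cod D \<phi> \<in> H" "a \<in> Hom D (\<beta> (Dom D \<phi>)) (\<beta> (Cod D \<phi>))"
    "\<phi> \<cdot> \<iota> (Dom D \<phi>) = \<iota> (Cod D \<phi>) \<cdot> a" for \<phi> a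
    using that fb [of \<phi>] by - (rule mono [of "Cod D \<phi>" "\<beta> (Dom D \<phi>)"], auto)
  define Fo where "Fo E = (\<alpha> E, \<beta> E, ext_class (\<alpha> E) (\<beta> E) (\<kappa> E))" for E
  define F where "F = \<lparr>fobj = Fo, fmap = \<lambda>\<phi>. (Fo (Dom D \<phi>), Fo (Cod D \<phi>), fa \<phi>, fb \<phi>)\<rparr>"
  have F [simp]: "fobj F = Fo" "fmap F \<phi> = (Fo (Dom D \<phi>), Fo (Cod D \<phi>), fa \<phi>, fb \<phi>)" for \<phi>
    by (simp_all add: F_def)
  have Fo [simp]: "Fo E \<in> Obj Gl" if "E \<in> H" for E
    using that by (auto simp: Fo_def glued_category_simps carrier_bgrp)
  have Fo_Arr: "(Fo E, Fo E', f, g) \<in> Arr Gl \<longleftrightarrow>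
      f \<in> Hom D (\<alpha> E) (\<alpha> E') \<and> g \<in> Hom D (\<beta> E) (\<beta> E') \<and> \<sigma> g \<cdot> \<kappa> E = \<kappa> E' \<cdot> f" if "E \<in> H" "E' \<in> H" for E E' f g
    unfolding Fo_def using that by (intro Gl_Arr_iff) auto
  interpret F: covariant_functor gl Gl F
  proof
    fix \<phi> X Y assume "\<phi> \<in> Hom gl X Y"
    then have \<phi> [simp]: "\<phi> \<in> Arr D" "Dom D \<phi> = X" "Cod D \<phi> = Y" "X \<in> H" "Y \<in> H" by auto
    have "\<sigma> (fb \<phi>) \<cdot> \<kappa> X = \<kappa> Y \<cdot> fa \<phi>"
      using compat [of X Y "fb \<phi>" \<phi> "fa \<phi>"] fa [of \<phi>] fb [of \<phi>] by simp
    then show "fmap F \<phi> \<in> Hom Gl (fobj F X) (fobj F Y)"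
      by (simp add: glued_category_simps(3,4) Fo_Arr)
  next
    fix X assume "X \<in> Obj gl"
    then have X [simp]: "X \<in> H" by simp
    have "fa (Ident D X) = Ident D (\<alpha> X)" "fb (Ident D X) = Ident D (\<beta> X)"
      by (auto intro!: fa_eq fb_eq)
    then show "fmap F (Ident gl X) = Ident Gl (fobj F X)"
      by (simp add: Fo_def glued_category_simps)
  next
    fix \<phi> \<psi> X Y Z assume "\<phi> \<in> Hom gl X Y" "\<psi> \<in> Hom gl Y Z"
    then have \<phi> [simp]: "\<phi> \<in> Arr D" "Dom D \<phi> = X" "Cod D \<phi> = Y" "\<psi> \<in> Arr D" "Dom D \<psi> = Y" "Cod D \<psi> = Z"
      "X \<in> H" "Y \<in> H" "Z \<in> H" by auto
    have "\<pi> Z \<cdot> (\<psi> \<cdot> \<phi>) = (\<pi> Z \<cdot> \<psi>) \<cdot> \<phi>" by (simp add: assoc)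
    also have "\<dots> = fa \<psi> \<cdot> (\<pi> Y \<cdot> \<phi>)" using fa [of \<psi>] by (simp add: assoc)
    also have "\<dots> = (fa \<psi> \<cdot> fa \<phi>) \<cdot> \<pi> X" using fa [of \<phi>] by (simp add: assoc)
    finally have 1: "fa (\<psi> \<cdot> \<phi>) = fa \<psi> \<cdot> fa \<phi>" by (intro fa_eq) auto
    have "(\<psi> \<cdot> \<phi>) \<cdot> \<iota> X = \<psi> \<cdot> (\<iota> Y \<cdot> fb \<phi>)" using fb [of \<phi>] by (simp add: assoc)
    also have "\<dots> = (\<psi> \<cdot> \<iota> Y) \<cdot> fb \<phi>" by (simp add: assoc)
    also have "\<dots> = \<iota> Z \<cdot> (fb \<psi> \<cdot> fb \<phi>)" using fb [of \<psi>] by (simp add: assoc)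
    finally have 2: "fb (\<psi> \<cdot> \<phi>) = fb \<psi> \<cdot> fb \<phi>" by (intro fb_eq) auto
    show "fmap F (\<psi> \<cdot>\<^bsub>gl\<^esub> \<phi>) = fmap F \<psi> \<cdot>\<^bsub>Gl\<^esub> fmap F \<phi>"
      using 1 2 by (simp add: glued_category_simps)
  qed simp
  have "equivalence gl Gl F"
  proof (rule F.fully_faithful_essentially_surjective_equivalence)
    fix X Y h assume XY: "X \<in> Obj gl" "Y \<in> Obj gl" "h \<in> Hom Gl (fobj F X) (fobj F Y)"
    then have [simp]: "X \<in> H" "Y \<in> H" by simp_all
    obtain f g where h: "h = (Fo X, Fo Y, f, g)"
      using XY(3) by (cases h) (auto simp: glued_category_simps)
    have fg: "f \<in> Hom D (\<alpha> X) (\<alpha> Y)" "g \<in> Hom D (\<beta> X) (\<beta> Y)" "\<sigma> g \<cdot> \<kappa> X = \<kappa> Y \<cdot> f"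
      using XY(3) Fo_Arr [of X Y f g] by (auto simp: h)
    obtain \<phi> where \<phi>: "\<phi> \<in> Hom D X Y" "\<phi> \<cdot> \<iota> X = \<iota> Y \<cdot> g" "\<pi> Y \<cdot> \<phi> = f \<cdot> \<pi> X"
      using glue_fill [OF t t, of X Y g f] fg by auto
    show "\<exists>!\<phi>. \<phi> \<in> Hom gl X Y \<and> fmap F \<phi> = h"
    proof (rule ex1I [of _ \<phi>])
      show "\<phi> \<in> Hom gl X Y \<and> fmap F \<phi> = h"
        using \<phi> fg fa_eq [of \<phi> f] fb_eq [of \<phi> g] by (simp add: h)
    next
      fix \<psi> assume "\<psi> \<in> Hom gl X Y \<and> fmap F \<psi> = h"
      then have \<psi>: "\<psi> \<in> Hom D X Y" "fa \<psi> = f" "fb \<psi> = g" by (auto simp: h)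
      then have "\<psi> \<cdot> \<iota> X = \<iota> Y \<cdot> g" "\<pi> Y \<cdot> \<psi> = f \<cdot> \<pi> X"
        using fa [of \<psi>] fb [of \<psi>] by auto
      with \<phi> \<psi> show "\<psi> = \<phi>"
        by - (rule uniq [of X Y], simp_all)
    qed
  next
    fix Z assume "Z \<in> Obj Gl"
    moreover obtain A B \<mu> where Z: "Z = (A, B, \<mu>)" by (cases Z)
    ultimately have AB [simp]: "A \<in> A\<^sub>0" "B \<in> B\<^sub>0" and "\<mu> \<in> carrier (bgrp M\<^sub>0 A B)"
      by (simp_all add: glued_category_simps)
    then obtain k where k: "k \<in> Hom D A (\<Sigma> B)" and \<mu>: "\<mu> = ext_class A B k"
      by (auto simp: carrier_bgrp)
    obtain i p where t': "(i, p, k) \<in> glue_triangles" "Dom D i = B" "Cod D p = A"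
      using ext_class_nonempty [OF AB k] by blast
    note [simp] = glue_simps [OF t'(1)] t'(2,3)
    define E where "E = Cod D i"
    have E [simp]: "E \<in> H" "Cod D i = E" "Dom D p = E" by (simp_all add: E_def)
    \<comment> \<open>The triangle fixed for \<open>E\<close> may differ from the one on
      \<open>k\<close>. The identity of \<open>E\<close>, restricted and corestricted in both
      directions, compares their outer terms by mutually inverse arrows.\<close>
    have b: "Ident D E \<in> Hom D (Cod D i) (Cod D (\<iota> E))" "Ident D E \<in> Hom D (Cod D (\<iota> E)) (Cod D i)" by simp_all
    obtain a where a: "a \<in> Hom D B (\<beta> E)" "i = \<iota> E \<cdot> a"
      using glue_restrict [OF t'(1) t b(1)] by auto
    obtain a' where a': "a' \<in> Hom D (\<beta> E) B" "\<iota> E = i \<cdot> a'"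
      using glue_restrict [OF t t'(1) b(2)] by auto
    obtain c where c: "c \<in> Hom D A (\<alpha> E)" "\<pi> E = c \<cdot> p"
      using glue_corestrict [OF t'(1) t b(1)] by auto
    obtain c' where c': "c' \<in> Hom D (\<alpha> E) A" "p = c' \<cdot> \<pi> E"
      using glue_corestrict [OF t t'(1) b(2)] by auto
    have [simp]: "a \<in> Arr D" "Dom D a = B" "Cod D a = \<beta> E" "a' \<in> Arr D" "Dom D a' = \<beta> E" "Cod D a' = B"
      "c \<in> Arr D" "Dom D c = A" "Cod D c = \<alpha> E" "c' \<in> Arr D" "Dom D c' = \<alpha> E" "Cod D c' = A"
      using a(1) a'(1) c(1) c'(1) by auto
    note factor = a(2) [symmetric] a'(2) [symmetric] c(2) [symmetric] c'(2) [symmetric]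
    have "i \<cdot> (a' \<cdot> a) = i \<cdot> Ident D B"
      by (simp add: assoc [symmetric] factor)
    then have 1: "a' \<cdot> a = Ident D B"
      by - (rule glue_mono [OF t'(1), of B], simp_all)
    have "\<iota> E \<cdot> (a \<cdot> a') = \<iota> E \<cdot> Ident D (\<beta> E)"
      by (simp add: assoc [symmetric] factor)
    then have 2: "a \<cdot> a' = Ident D (\<beta> E)"
      by - (rule mono [of E "\<beta> E"], simp_all)
    have "(c' \<cdot> c) \<cdot> p = Ident D A \<cdot> p"
      by (simp add: assoc factor)
    then have 3: "c' \<cdot> c = Ident D A"
      by - (rule glue_epi [OF t'(1), of A], simp_all)
    have "(c \<cdot> c') \<cdot> \<pi> E = Ident D (\<alpha> E) \<cdot> \<pi> E"
      by (simp add: assoc factor)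
    then have 4: "c \<cdot> c' = Ident D (\<alpha> E)"
      by - (rule epi [of E "\<alpha> E"], simp_all)
    have "\<sigma> a' \<cdot> \<kappa> E = k \<cdot> c'"
      using glue_compat [OF t t'(1), of E a' "Ident D E" c'] by (simp add: factor)
    then have 5: "(Fo E, Z, c', a') \<in> Arr Gl"
      unfolding Fo_def Z \<mu> by (subst Gl_Arr_iff) simp_all
    have "\<sigma> a \<cdot> k = \<kappa> E \<cdot> c"
      using glue_compat [OF t'(1) t, of E a "Ident D E" c] by (simp add: factor)
    then have 6: "(Z, Fo E, c, a) \<in> Arr Gl"
      unfolding Fo_def Z \<mu> by (subst Gl_Arr_iff) simp_all
    have "isomorphic Gl (Fo E) Z"
      using 5 6 by (intro Gl.isomorphicI [of "(Fo E, Z, c', a')" _ _ "(Z, Fo E, c, a)"])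
        (simp_all add: glued_category_simps(3-6) 1 2 3 4, simp_all add: Fo_def Z glued_category_simps)
    then show "\<exists>X \<in> Obj gl. isomorphic Gl (fobj F X) Z"
      by (intro bexI [of _ E]) simp_all
  qed
  then show ?thesis
    unfolding equivalent_categories_def by blast
qed

end

section \<open>Hearts and semiorthogonal decompositions\<close>

lemma tri_subcat_simps [simp]:
  "Obj (tri_subcat D S) = S"
  "f \<in> Arr (tri_subcat D S) \<longleftrightarrow> f \<in> Arr D \<and> Dom D f \<in> S \<and> Cod D f \<in> S"
  "Dom (tri_subcat D S) = Dom D" "Cod (tri_subcat D S) = Cod D"
  "Ident (tri_subcat D S) = Ident D" "Comp (tri_subcat D S) = Comp D"
  "Plus (tri_subcat D S) = Plus D" "Zero (tri_subcat D S) = Zero D" "Shift (tri_subcat D S) = Shift D"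
  by (auto simp: tri_subcat_def full_subcat_def)

lemma isomorphic_tri_subcat:
  assumes "X \<in> S" "Y \<in> S"
  shows "isomorphic (tri_subcat D S) X Y \<longleftrightarrow> isomorphic D X Y"
proof -
  have "isomorphic (tri_subcat D S) X Y \<longleftrightarrow> isomorphic (full_subcat D S) X Y"
    unfolding isomorphic_def is_iso_def Bex_def in_Hom_iff tri_subcat_simps full_subcat_simps by simp
  then show ?thesis
    using isomorphic_full_subcat [OF assms] by simp
qed

section \<open>Orthogonality and hearts of t-structures\<close>

context t_structure
begin

notation shift_obj ("\<Sigma>") and shift_arr ("\<sigma>")

lemma vanish: "\<lbrakk>X \<in> L; fobj (Shift T) Y \<in> G; f \<in> Arr T; Dom T f = X; Cod T f = Y\<rbrakk> \<Longrightarrow> f = Zero T X Y"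
  using Hom_vanish [of X Y] by (metis Cod_in in_Hom_iff singletonD)

text \<open>\<open>Y\<close> is written as a shift up to isomorphism, which reduces the claim to
  \<open>vanish\<close> because the shift is full.\<close>

lemma shift_vanish:
  assumes X: "X \<in> L" and Y: "Y \<in> G" and f: "f \<in> Arr T" "Dom T f = \<Sigma> X" "Cod T f = Y"
  shows "f = Zero T (\<Sigma> X) Y"
proof -
  have [simp]: "X \<in> Obj T" "Y \<in> Obj T" using X Y L_subset G_subset by auto
  obtain V where V [simp]: "V \<in> Obj T" and iso: "isomorphic T (\<Sigma> V) Y"
    using shift_ess_surj [of Y] by auto
  obtain e d where e: "e \<in> Hom T (\<Sigma> V) Y" "d \<in> Hom T Y (\<Sigma> V)" "e \<cdot>\<^bsub>T\<^esub> d = Ident T Y"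
    using isomorphicE [OF iso] by metis
  have "\<Sigma> V \<in> G" using G_iso Y isomorphic_sym [OF iso] by blast
  obtain g where g: "g \<in> Hom T X V" "\<sigma> g = d \<cdot>\<^bsub>T\<^esub> f"
    using shift_full [of X V "d \<cdot>\<^bsub>T\<^esub> f"] e f by auto
  have "g = Zero T X V"
    using vanish [OF X \<open>\<Sigma> V \<in> G\<close>] g by auto
  then have "d \<cdot>\<^bsub>T\<^esub> f = Zero T (\<Sigma> X) (\<Sigma> V)"
    using g by simp
  then have "(e \<cdot>\<^bsub>T\<^esub> d) \<cdot>\<^bsub>T\<^esub> f = Zero T (\<Sigma> X) Y"
    using e(1,2) f by (simp add: assoc)
  then show ?thesis
    using e(3) f by simp
qed

text \<open>In the truncation triangle of \<open>E\<close> the second arrow vanishes, so the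
  identity of \<open>E\<close> lifts along \<open>f\<close>. Orthogonality makes \<open>f\<close>
  monic against its own source, so the section is an inverse of \<open>f\<close>.\<close>

lemma L_if_left_orthogonal:
  assumes E: "E \<in> Obj T"
    and orth: "\<And>Y f. \<lbrakk>\<Sigma> Y \<in> G; f \<in> Arr T; Dom T f = E; Cod T f = Y\<rbrakk> \<Longrightarrow> f = Zero T E Y"
  shows "E \<in> L"
proof -
  obtain f g h where fgh: "(f, g, h) \<in> Dist T" "Dom T f \<in> L" "Dom T g = E" "\<Sigma> (Dom T h) \<in> G"
    using truncation [OF E] by auto
  note [simp] = Dist_Arr [OF fgh(1)] E
  have [simp]: "Cod T f = E" using fgh(3) by simp
  have "g = Zero T E (Cod T g)"
    using fgh by (intro orth) auto
  then have "\<exists>s \<in> Hom T (Dom T (Ident T E)) (Dom T f). f \<cdot>\<^bsub>T\<^esub> s = Ident T E"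
    by - (rule weak_kernel [OF fgh(1)], simp_all)
  then obtain s where s: "s \<in> Hom T E (Dom T f)" "f \<cdot>\<^bsub>T\<^esub> s = Ident T E"
    by auto
  have [simp]: "s \<in> Arr T" "Dom T s = E" "Cod T s = Dom T f"
    using s by auto
  have "s \<cdot>\<^bsub>T\<^esub> f = Ident T (Dom T f)"
  proof (rule mono_of_vanish [OF fgh(1)])
    show "f \<cdot>\<^bsub>T\<^esub> (s \<cdot>\<^bsub>T\<^esub> f) = f \<cdot>\<^bsub>T\<^esub> Ident T (Dom T f)"
      by (simp add: assoc [symmetric] s)
    show "w = Zero T (\<Sigma> (Dom T f)) (Cod T g)" if "w \<in> Arr T" "Dom T w = \<Sigma> (Dom T f)" "Cod T w = Cod T g" for w
      using that fgh by (intro vanish L_shift) auto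
  qed auto
  then have "isomorphic T (Dom T f) E"
    using s by (intro isomorphicI [of f _ _ s]) auto
  then show ?thesis
    using L_iso fgh(2) by blast
qed

text \<open>Dual to \<open>L_if_left_orthogonal\<close>. Truncation separates \<open>L\<close> from
  the desuspension of \<open>G\<close>, so it is applied to a desuspension \<open>V\<close> of
  \<open>E\<close>: there \<open>f\<close> vanishes and \<open>g\<close> becomes an
  isomorphism.\<close>

lemma G_if_right_orthogonal:
  assumes E: "E \<in> Obj T"
    and orth: "\<And>X f. \<lbrakk>X \<in> L; f \<in> Arr T; Dom T f = \<Sigma> X; Cod T f = E\<rbrakk> \<Longrightarrow> f = Zero T (\<Sigma> X) E"
  shows "E \<in> G"
proof -
  obtain V where V [simp]: "V \<in> Obj T" and iso: "isomorphic T (\<Sigma> V) E"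
    using shift_ess_surj [OF E] by auto
  obtain e d where e: "e \<in> Hom T (\<Sigma> V) E" "d \<in> Hom T E (\<Sigma> V)" "d \<cdot>\<^bsub>T\<^esub> e = Ident T (\<Sigma> V)"
    using isomorphicE [OF iso] by metis
  obtain f g h where fgh: "(f, g, h) \<in> Dist T" "Dom T f \<in> L" "Dom T g = V" "\<Sigma> (Dom T h) \<in> G"
    using truncation [OF V] by auto
  note [simp] = Dist_Arr [OF fgh(1)] E
  have [simp]: "Cod T f = V" "e \<in> Arr T" "Dom T e = \<Sigma> V" "Cod T e = E" "d \<in> Arr T" "Dom T d = E" "Cod T d = \<Sigma> V"
    using fgh(3) e by auto
  have "e \<cdot>\<^bsub>T\<^esub> \<sigma> f = Zero T (\<Sigma> (Dom T f)) E"
    using fgh by (intro orth) auto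
  then have "(d \<cdot>\<^bsub>T\<^esub> e) \<cdot>\<^bsub>T\<^esub> \<sigma> f = Zero T (\<Sigma> (Dom T f)) (\<Sigma> V)"
    by (simp add: assoc)
  then have "f = Zero T (Dom T f) V"
    using e(3) by - (rule shift_eq_Zero, simp_all)
  then have "\<exists>s \<in> Hom T (Cod T g) (Cod T (Ident T V)). s \<cdot>\<^bsub>T\<^esub> g = Ident T V"
    by - (rule weak_cokernel [OF fgh(1)], simp_all)
  then obtain s where s: "s \<in> Hom T (Cod T g) V" "s \<cdot>\<^bsub>T\<^esub> g = Ident T V"
    by auto
  have [simp]: "s \<in> Arr T" "Dom T s = Cod T g" "Cod T s = V"
    using s by auto
  have "g \<cdot>\<^bsub>T\<^esub> s = Ident T (Cod T g)"
  proof (rule epi_of_vanish [OF fgh(1)])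
    show "(g \<cdot>\<^bsub>T\<^esub> s) \<cdot>\<^bsub>T\<^esub> g = Ident T (Cod T g) \<cdot>\<^bsub>T\<^esub> g"
      using fgh(3) by (simp add: assoc s)
    show "w = Zero T (\<Sigma> (Dom T f)) (Cod T g)" if "w \<in> Arr T" "Dom T w = \<Sigma> (Dom T f)" "Cod T w = Cod T g" for w
      using that fgh by (intro vanish L_shift) auto
  qed (use fgh(3) in auto)
  then have "isomorphic T (Cod T g) V"
    using s fgh(3) by (intro isomorphicI [of s _ _ g]) auto
  then have "isomorphic T (\<Sigma> (Cod T g)) E"
    using shift.fobj_isomorphic isomorphic_trans iso by blast
  then show ?thesis
    using G_iso fgh(4) by simp
qed

lemma heart_zero_object:
  assumes "zero_object T Z"
  shows "Z \<in> heart L G"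
proof -
  have Z: "Z \<in> Obj T" using assms by (simp add: zero_object_def)
  have "Z \<in> L"
    using Z by (intro L_if_left_orthogonal zero_object_Dom [OF assms]) auto
  moreover have "Z \<in> G"
  proof (rule G_if_right_orthogonal [OF Z])
    fix X f assume "X \<in> L" "f \<in> Arr T" "Dom T f = \<Sigma> X" "Cod T f = Z"
    then show "f = Zero T (\<Sigma> X) Z"
      using L_subset by (intro zero_object_Cod [OF assms]) auto
  qed
  ultimately show ?thesis by (simp add: heart_def)
qed

text \<open>The identity of the ambient biproduct is
  \<open>Plus T (i \<cdot> p) (j \<cdot> q)\<close>, so the two orthogonality criteria for
  \<open>P\<close> reduce to vanishing for \<open>X\<close> and \<open>Y\<close>.\<close>

lemma heart_biproduct:
  assumes X: "X \<in> heart L G" and Y: "Y \<in> heart L G"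
  shows "\<exists>P \<in> heart L G. \<exists>i \<in> Hom T X P. \<exists>j \<in> Hom T Y P. \<exists>p \<in> Hom T P X. \<exists>q \<in> Hom T P Y.
        p \<cdot>\<^bsub>T\<^esub> i = Ident T X \<and> q \<cdot>\<^bsub>T\<^esub> j = Ident T Y \<and> q \<cdot>\<^bsub>T\<^esub> i = Zero T X Y \<and> p \<cdot>\<^bsub>T\<^esub> j = Zero T Y X \<and>
        Plus T (i \<cdot>\<^bsub>T\<^esub> p) (j \<cdot>\<^bsub>T\<^esub> q) = Ident T P"
proof -
  have XY: "X \<in> Obj T" "Y \<in> Obj T" "X \<in> L" "X \<in> G" "Y \<in> L" "Y \<in> G"
    using X Y L_subset by (auto simp: heart_def)
  obtain P i j p q where P: "P \<in> Obj T" "i \<in> Hom T X P" "j \<in> Hom T Y P" "p \<in> Hom T P X" "q \<in> Hom T P Y"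
    "p \<cdot>\<^bsub>T\<^esub> i = Ident T X" "q \<cdot>\<^bsub>T\<^esub> j = Ident T Y" "q \<cdot>\<^bsub>T\<^esub> i = Zero T X Y" "p \<cdot>\<^bsub>T\<^esub> j = Zero T Y X"
    "Plus T (i \<cdot>\<^bsub>T\<^esub> p) (j \<cdot>\<^bsub>T\<^esub> q) = Ident T P"
    using ex_biproduct [OF XY(1,2)] by blast
  have [simp]: "P \<in> Obj T" "i \<in> Arr T" "Dom T i = X" "Cod T i = P" "j \<in> Arr T" "Dom T j = Y" "Cod T j = P"
    "p \<in> Arr T" "Dom T p = P" "Cod T p = X" "q \<in> Arr T" "Dom T q = P" "Cod T q = Y"
    using P by auto
  note [simp] = XY(1,2)
  have "P \<in> L"
  proof (rule L_if_left_orthogonal)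
    fix W f assume W: "\<Sigma> W \<in> G" and f: "f \<in> Arr T" "Dom T f = P" "Cod T f = W"
    then have [simp]: "W \<in> Obj T" by auto
    have "f \<cdot>\<^bsub>T\<^esub> i = Zero T X W" "f \<cdot>\<^bsub>T\<^esub> j = Zero T Y W"
      using vanish [OF XY(3) W, of "f \<cdot>\<^bsub>T\<^esub> i"] vanish [OF XY(5) W, of "f \<cdot>\<^bsub>T\<^esub> j"] f by simp_all
    then have "f \<cdot>\<^bsub>T\<^esub> Plus T (i \<cdot>\<^bsub>T\<^esub> p) (j \<cdot>\<^bsub>T\<^esub> q) = Zero T P W"
      using f by (simp flip: assoc)
    then show "f = Zero T P W" using f by (simp add: P)
  qed simp
  moreover have "P \<in> G"
  proof (rule G_if_right_orthogonal)
    fix W f assume W: "W \<in> L" and f: "f \<in> Arr T" "Dom T f = \<Sigma> W" "Cod T f = P"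
    then have [simp]: "W \<in> Obj T" using L_subset by auto
    have "p \<cdot>\<^bsub>T\<^esub> f = Zero T (\<Sigma> W) X" "q \<cdot>\<^bsub>T\<^esub> f = Zero T (\<Sigma> W) Y"
      using shift_vanish [OF W XY(4), of "p \<cdot>\<^bsub>T\<^esub> f"] shift_vanish [OF W XY(6), of "q \<cdot>\<^bsub>T\<^esub> f"] f by simp_all
    then have "Plus T (i \<cdot>\<^bsub>T\<^esub> p) (j \<cdot>\<^bsub>T\<^esub> q) \<cdot>\<^bsub>T\<^esub> f = Zero T (\<Sigma> W) P"
      using f by (simp add: assoc)
    then show "f = Zero T (\<Sigma> W) P" using f by (simp add: P)
  qed simp
  ultimately have "P \<in> heart L G" by (simp add: heart_def)
  then show ?thesis
    using P by blast
qed

end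

section \<open>Decomposition triangles and the adjoints of the inclusions\<close>

context semiorthogonal_decomposition
begin

lemma A_Obj [simp]: "X \<in> A \<Longrightarrow> X \<in> Obj D" and B_Obj [simp]: "X \<in> B \<Longrightarrow> X \<in> Obj D"
  using A_subcat B_subcat by (auto simp: full_triangulated_subcategory_def)

lemma A_Shift [simp]: "X \<in> A \<Longrightarrow> \<Sigma> X \<in> A"
proof -
  assume "X \<in> A"
  interpret A: triangulated_category "tri_subcat D A"
    using A_subcat by (simp add: full_triangulated_subcategory_def)
  show "\<Sigma> X \<in> A" using A.shift.fobj_in [of X] \<open>X \<in> A\<close> by simp
qed

lemma B_Shift [simp]: "X \<in> B \<Longrightarrow> \<Sigma> X \<in> B"
proof -
  assume "X \<in> B"
  interpret B: triangulated_category "tri_subcat D B"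
    using B_subcat by (simp add: full_triangulated_subcategory_def)
  show "\<Sigma> X \<in> B" using B.shift.fobj_in [of X] \<open>X \<in> B\<close> by simp
qed

lemma Hom_BA: "\<lbrakk>f \<in> Arr D; Dom D f = Y; Cod D f = X; Y \<in> B; X \<in> A\<rbrakk> \<Longrightarrow> f = Zero D Y X"
  using semiorthogonal [of Y X] by (metis in_Hom_iff singletonD)

text \<open>Factorizations exist because there are no arrows from \<open>B\<close> to
  \<open>A\<close>; they are unique because \<open>B\<close> is closed under the shift, so that
  arrows from shifts of objects of \<open>B\<close> to \<open>A\<close> vanish as well.\<close>

lemma decomposition_universal:
  assumes fgh: "(f, g, h) \<in> Dist D" and B: "Dom D f \<in> B" and A: "Cod D g \<in> A"
  shows "left_universal A (Cod D f) (Cod D g) g" "right_universal B (Cod D f) (Dom D f) f"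
proof -
  note [simp] = Dist_Arr [OF fgh] A B
  have "\<exists>!u. u \<in> Hom D (Cod D g) Y \<and> u \<cdot>\<^bsub>D\<^esub> g = v" if Y: "Y \<in> A" and v: "v \<in> Hom D (Cod D f) Y" for Y v
  proof (rule ex_ex1I)
    have "v \<cdot>\<^bsub>D\<^esub> f = Zero D (Dom D f) Y"
      using v Y by (intro Hom_BA) auto
    then show "\<exists>u. u \<in> Hom D (Cod D g) Y \<and> u \<cdot>\<^bsub>D\<^esub> g = v"
      using weak_cokernel [OF fgh, of v] v by (auto simp: Bex_def)
  next
    fix u u' assume u: "u \<in> Hom D (Cod D g) Y \<and> u \<cdot>\<^bsub>D\<^esub> g = v" "u' \<in> Hom D (Cod D g) Y \<and> u' \<cdot>\<^bsub>D\<^esub> g = v"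
    show "u = u'"
      by (rule epi_of_vanish [OF fgh, of Y]) (use u Y in \<open>auto intro: Hom_BA\<close>)
  qed
  note ex = this
  show "left_universal A (Cod D f) (Cod D g) g"
    unfolding left_universal_def by (intro conjI ballI ex) simp_all
  have "\<exists>!u. u \<in> Hom D Y (Dom D f) \<and> f \<cdot>\<^bsub>D\<^esub> u = v" if Y: "Y \<in> B" and v: "v \<in> Hom D Y (Cod D f)" for Y v
  proof (rule ex_ex1I)
    have "g \<cdot>\<^bsub>D\<^esub> v = Zero D Y (Cod D g)"
      using v Y by (intro Hom_BA) auto
    then show "\<exists>u. u \<in> Hom D Y (Dom D f) \<and> f \<cdot>\<^bsub>D\<^esub> u = v"
      using weak_kernel [OF fgh, of v] v by (auto simp: Bex_def)
  next
    fix u u' assume u: "u \<in> Hom D Y (Dom D f) \<and> f \<cdot>\<^bsub>D\<^esub> u = v" "u' \<in> Hom D Y (Dom D f) \<and> f \<cdot>\<^bsub>D\<^esub> u' = v"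
    show "u = u'"
      by (rule mono_of_vanish [OF fgh, of Y]) (use u Y in \<open>auto intro: Hom_BA\<close>)
  qed
  note ex = this
  show "right_universal B (Cod D f) (Dom D f) f"
    unfolding right_universal_def by (intro conjI ballI ex) simp_all
qed

lemma decomposition_triangle:
  assumes "E \<in> Obj D"
  obtains f g h where "(f, g, h) \<in> Dist D" "Dom D f \<in> B" "Cod D f = E" "Cod D g \<in> A"
  using decomposition [OF assms] Dist_Arr by metis

text \<open>The adjoints take the values \<open>X\<close> and \<open>Y\<close> only up to
  isomorphism, but closure of the two hearts under isomorphism within \<open>A\<close> and
  \<open>B\<close> lets membership be read off from any universal arrows.\<close>

lemma glued_heart_iff:
  assumes A0: "A\<^sub>0 \<subseteq> A" "\<And>X Y. \<lbrakk>X \<in> A\<^sub>0; Y \<in> A; isomorphic D X Y\<rbrakk> \<Longrightarrow> Y \<in> A\<^sub>0"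
    and B0: "B\<^sub>0 \<subseteq> B" "\<And>X Y. \<lbrakk>X \<in> B\<^sub>0; Y \<in> B; isomorphic D X Y\<rbrakk> \<Longrightarrow> Y \<in> B\<^sub>0"
    and E: "E \<in> Obj D" and X: "left_universal A E X a" and Y: "right_universal B E Y b"
  shows "E \<in> glued_heart D A B A\<^sub>0 B\<^sub>0 \<longleftrightarrow> X \<in> A\<^sub>0 \<and> Y \<in> B\<^sub>0"
proof -
  have exA: "\<exists>X a. left_universal A E X a" and exB: "\<exists>Y b. right_universal B E Y b" if E: "E \<in> Obj D" for E
  proof -
    obtain f g h where "(f, g, h) \<in> Dist D" "Dom D f \<in> B" "Cod D f = E" "Cod D g \<in> A"
      using decomposition_triangle [OF E] .
    then show "\<exists>X a. left_universal A E X a" "\<exists>Y b. right_universal B E Y b"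
      using decomposition_universal by blast+
  qed
  have AB: "A \<subseteq> Obj D" "B \<subseteq> Obj D" by auto
  have XY: "X \<in> A" "Y \<in> B"
    using X Y by (simp_all add: left_universal_def right_universal_def)
  have "fobj (left_adjoint_of_inclusion D A) E \<in> A\<^sub>0 \<longleftrightarrow> X \<in> A\<^sub>0"
    using left_adjoint_of_inclusion_isomorphic [OF AB(1) exA X E] A0 XY isomorphic_sym by blast
  moreover have "fobj (right_adjoint_of_inclusion D B) E \<in> B\<^sub>0 \<longleftrightarrow> Y \<in> B\<^sub>0"
    using right_adjoint_of_inclusion_isomorphic [OF AB(2) exB Y E] B0 XY isomorphic_sym by blast
  ultimately show ?thesis
    using E by (simp add: glued_heart_def)
qed

end

section \<open>Verification of the gluing axioms\<close>

lemma (in triangulated_category) unshift: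
  assumes "X \<in> Obj D"
  shows "unshift D X \<in> Obj D" "isomorphic D (\<Sigma> (unshift D X)) X"
proof -
  have "\<exists>Y. Y \<in> Obj D \<and> isomorphic D (\<Sigma> Y) X"
    using shift_ess_surj [OF assms] by blast
  then have "unshift D X \<in> Obj D \<and> isomorphic D (\<Sigma> (unshift D X)) X"
    unfolding unshift_def by (rule someI_ex)
  then show "unshift D X \<in> Obj D" "isomorphic D (\<Sigma> (unshift D X)) X" by auto
qed

text \<open>The bridge from the hypotheses to the locale: all memberships are decided on
  decomposition triangles, and all vanishing is reduced to pairs of objects of the two
  hearts.\<close>

lemma glued_hearts_glued_heart:
  fixes D :: "('o, 'm, 'z) tri_cat_scheme"
  assumes sod: "semiorthogonal_decomposition D A B"
    and tA: "t_structure (tri_subcat D A) A_le A_ge" and tB: "t_structure (tri_subcat D B) B_le B_ge"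
    and A0: "A\<^sub>0 = heart A_le A_ge" and B0: "B\<^sub>0 = heart B_le B_ge"
    and van: "\<And>X Y i. \<lbrakk>X \<in> A\<^sub>0; Y \<in> B\<^sub>0; i \<le> 0\<rbrakk>
      \<Longrightarrow> Hom D X (shift_by D i Y) = {Zero D X (shift_by D i Y)}"
  shows "glued_hearts D A\<^sub>0 B\<^sub>0 (glued_heart D A B A\<^sub>0 B\<^sub>0)"
proof -
  interpret semiorthogonal_decomposition D A B by (rule sod)
  interpret tA: t_structure "tri_subcat D A" A_le A_ge by (rule tA)
  interpret tB: t_structure "tri_subcat D B" B_le B_ge by (rule tB)
  let ?H = "glued_heart D A B A\<^sub>0 B\<^sub>0"
  have A0A: "A\<^sub>0 \<subseteq> A" and B0B: "B\<^sub>0 \<subseteq> B"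
    using tA.L_subset tB.L_subset by (auto simp: A0 B0 heart_def)
  have A0_iso: "Y \<in> A\<^sub>0" if "X \<in> A\<^sub>0" "Y \<in> A" "isomorphic D X Y" for X Y
    using that tA.L_iso [of X Y] tA.G_iso [of X Y] isomorphic_tri_subcat [of X A Y D] A0A
    by (auto simp: A0 heart_def)
  have B0_iso: "Y \<in> B\<^sub>0" if "X \<in> B\<^sub>0" "Y \<in> B" "isomorphic D X Y" for X Y
    using that tB.L_iso [of X Y] tB.G_iso [of X Y] isomorphic_tri_subcat [of X B Y D] B0B
    by (auto simp: B0 heart_def)
  have H_iff: "E \<in> ?H \<longleftrightarrow> X \<in> A\<^sub>0 \<and> Y \<in> B\<^sub>0"
    if "E \<in> Obj D" "left_universal A E X a" "right_universal B E Y b" for E X Y a b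
    by (rule glued_heart_iff [OF A0A _ B0B _ that]) (fact A0_iso B0_iso)+
  have triangle_iff: "Cod D f \<in> ?H \<longleftrightarrow> Cod D g \<in> A\<^sub>0 \<and> Dom D f \<in> B\<^sub>0"
    if "(f, g, h) \<in> Dist D" "Dom D f \<in> B" "Cod D g \<in> A" for f g h
    using H_iff [OF _ decomposition_universal [OF that]] Dist_Arr [OF that(1)] by auto
  have vA: "w = Zero D (\<Sigma> X) Y" if "X \<in> A\<^sub>0" "Y \<in> A\<^sub>0" "w \<in> Arr D" "Dom D w = \<Sigma> X" "Cod D w = Y" for w X Y
  proof -
    have "X \<in> A" "Y \<in> A" using that A0A by auto
    then show ?thesis
      using tA.shift_vanish [of X Y w] that by (simp add: A0 heart_def)
  qed
  have vB: "w = Zero D (\<Sigma> X) Y" if "X \<in> B\<^sub>0" "Y \<in> B\<^sub>0" "w \<in> Arr D" "Dom D w = \<Sigma> X" "Cod D w = Y" for w X Y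
  proof -
    have "X \<in> B" "Y \<in> B" using that B0B by auto
    then show ?thesis
      using tB.shift_vanish [of X Y w] that by (simp add: B0 heart_def)
  qed
  \<comment> \<open>Arrows from \<open>\<Sigma> X\<close> to \<open>Y\<close> correspond to arrows
    from \<open>X\<close> to \<open>unshift D Y\<close>, which is \<open>shift_by D (-1) Y\<close>;
    this is the hypothesis at i = -1.\<close>
  have vAB: "w = Zero D (\<Sigma> X) Y" if X: "X \<in> A\<^sub>0" and Y: "Y \<in> B\<^sub>0" and w: "w \<in> Arr D" "Dom D w = \<Sigma> X" "Cod D w = Y" for w X Y
  proof -
    have [simp]: "X \<in> Obj D" "Y \<in> Obj D" using X Y A0A B0B by auto
    note U [simp] = unshift(1) [of Y]
    obtain e d where e: "e \<in> Hom D (\<Sigma> (unshift D Y)) Y" "d \<in> Hom D Y (\<Sigma> (unshift D Y))" "e \<cdot>\<^bsub>D\<^esub> d = Ident D Y"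
      using isomorphicE [OF unshift(2) [OF \<open>Y \<in> Obj D\<close>]] by metis
    have [simp]: "e \<in> Arr D" "Dom D e = \<Sigma> (unshift D Y)" "Cod D e = Y"
      "d \<in> Arr D" "Dom D d = Y" "Cod D d = \<Sigma> (unshift D Y)"
      using e by auto
    obtain z where z: "z \<in> Hom D X (unshift D Y)" "\<sigma> z = d \<cdot>\<^bsub>D\<^esub> w"
      using shift_full [of X "unshift D Y" "d \<cdot>\<^bsub>D\<^esub> w"] w by auto
    have "Hom D X (unshift D Y) = {Zero D X (unshift D Y)}"
      using van [OF X Y, of "-1"] by (simp add: shift_by_def)
    then have "z = Zero D X (unshift D Y)" using z by blast
    then have "d \<cdot>\<^bsub>D\<^esub> w = Zero D (\<Sigma> X) (\<Sigma> (unshift D Y))"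
      using z(2) by simp
    then have "(e \<cdot>\<^bsub>D\<^esub> d) \<cdot>\<^bsub>D\<^esub> w = Zero D (\<Sigma> X) Y"
      using w by (simp add: assoc)
    then show ?thesis using w by (simp add: e)
  qed
  \<comment> \<open>The source is dissected by its decomposition triangle: \<open>w\<close> vanishes
    on the shifted \<open>B\<close>-part, by semiorthogonality or by \<open>vB\<close>, and so comes
    from an arrow on the shifted \<open>A\<close>-part, where \<open>vA\<close> or
    \<open>vAB\<close> applies.\<close>
  have vH: "w = Zero D (\<Sigma> X) V" if X: "X \<in> ?H" and V: "V \<in> A\<^sub>0 \<or> V \<in> B\<^sub>0"
    and w: "w \<in> Arr D" "Dom D w = \<Sigma> X" "Cod D w = V" for w X V
  proof -
    have [simp]: "X \<in> Obj D" "V \<in> Obj D" using X V A0A B0B by (auto simp: glued_heart_def)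
    obtain f g h where fgh: "(f, g, h) \<in> Dist D" "Dom D f \<in> B" "Cod D f = X" "Cod D g \<in> A"
      using decomposition_triangle [OF \<open>X \<in> Obj D\<close>] by blast
    note [simp] = Dist_Arr [OF fgh(1)] w fgh(3)
    have fg: "Cod D g \<in> A\<^sub>0" "Dom D f \<in> B\<^sub>0"
      using triangle_iff [OF fgh(1,2,4)] X by auto
    have "w \<cdot>\<^bsub>D\<^esub> \<sigma> f = Zero D (\<Sigma> (Dom D f)) V"
      using V
    proof
      assume "V \<in> A\<^sub>0"
      then show ?thesis using A0A fgh(2) by (intro Hom_BA) auto
    next
      assume "V \<in> B\<^sub>0"
      then show ?thesis using fg by (intro vB) auto
    qed
    then have "\<exists>y \<in> Hom D (Cod D (Neg D (\<sigma> g))) (Cod D w). y \<cdot>\<^bsub>D\<^esub> Neg D (\<sigma> g) = w"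
      by - (rule weak_cokernel [OF rotate [OF rotate [OF rotate [OF fgh(1)]]]], simp_all)
    then obtain y where y: "y \<in> Hom D (\<Sigma> (Cod D g)) V" "y \<cdot>\<^bsub>D\<^esub> Neg D (\<sigma> g) = w"
      by auto
    have "y = Zero D (\<Sigma> (Cod D g)) V"
      using V vA [OF fg(1)] vAB [OF fg(1)] y(1) by auto
    then show ?thesis using y(2) by simp
  qed
  show ?thesis
  proof (intro glued_hearts.intro glued_hearts_axioms.intro)
    show "triangulated_category D" ..
    show "?H \<subseteq> Obj D" by (auto simp: glued_heart_def)
  next
    \<comment> \<open>The \<open>B\<close>-component of an object of \<open>A\<^sub>0\<close> is
      zero. A zero object of \<open>B\<close> therefore serves as right universal object, and
      membership in the glued heart asks that it lie in \<open>B\<^sub>0\<close>.\<close>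
    obtain Z where Z: "zero_object (tri_subcat D B) Z" using tB.ex_zero_object by auto
    then have ZB0: "Z \<in> B\<^sub>0" using tB.heart_zero_object by (simp add: B0)
    then have [simp]: "Z \<in> B" "Z \<in> Obj D" using B0B by auto
    show "A\<^sub>0 \<subseteq> ?H"
    proof
      fix X assume X: "X \<in> A\<^sub>0"
      then have [simp]: "X \<in> A" "X \<in> Obj D" using A0A by auto
      have "left_universal A X X (Ident D X)"
        unfolding left_universal_def by auto
      moreover have "right_universal B X Z (Zero D Z X)"
        unfolding right_universal_def
      proof (intro conjI ballI)
        fix Y f assume Y: "Y \<in> B" and f: "f \<in> Hom D Y X"
        have "f = Zero D Y X" using Hom_BA f Y by auto
        moreover have "u = Zero D Y Z" if "u \<in> Hom D Y Z" for u
          using tB.zero_object_Cod [OF Z, of Y u] that Y by auto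
        ultimately show "\<exists>!u. u \<in> Hom D Y Z \<and> Zero D Z X \<cdot>\<^bsub>D\<^esub> u = f"
          using Y by (intro ex1I [of _ "Zero D Y Z"]) auto
      qed auto
      ultimately show "X \<in> ?H"
        using H_iff [of X X _ Z] X ZB0 by auto
    qed
  next
    obtain Z where Z: "zero_object (tri_subcat D A) Z" using tA.ex_zero_object by auto
    then have ZA0: "Z \<in> A\<^sub>0" using tA.heart_zero_object by (simp add: A0)
    then have [simp]: "Z \<in> A" "Z \<in> Obj D" using A0A by auto
    show "B\<^sub>0 \<subseteq> ?H"
    proof
      fix X assume X: "X \<in> B\<^sub>0"
      then have [simp]: "X \<in> B" "X \<in> Obj D" using B0B by auto
      have "right_universal B X X (Ident D X)"
        unfolding right_universal_def by auto
      moreover have "left_universal A X Z (Zero D X Z)"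
        unfolding left_universal_def
      proof (intro conjI ballI)
        fix Y f assume Y: "Y \<in> A" and f: "f \<in> Hom D X Y"
        have "f = Zero D X Y" using Hom_BA f Y by auto
        moreover have "u = Zero D Z Y" if "u \<in> Hom D Z Y" for u
          using tA.zero_object_Dom [OF Z, of Y u] that Y by auto
        ultimately show "\<exists>!u. u \<in> Hom D Z Y \<and> u \<cdot>\<^bsub>D\<^esub> Zero D X Z = f"
          using Y by (intro ex1I [of _ "Zero D Z Y"]) auto
      qed auto
      ultimately show "X \<in> ?H"
        using H_iff [of X Z _ X] X ZA0 by auto
    qed
  next
    fix w X assume w: "w \<in> Arr D" "Dom D w = \<Sigma> X" "X \<in> ?H" "Cod D w \<in> ?H"
    then have [simp]: "X \<in> Obj D" by (simp add: glued_heart_def)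
    note [simp] = w(1,2)
    \<comment> \<open>Now the target is dissected: by \<open>vH\<close> the arrow dies in the
      \<open>A\<close>-part, hence factors through the \<open>B\<close>-part, where
      \<open>vH\<close> applies again.\<close>
    obtain f g h where fgh: "(f, g, h) \<in> Dist D" "Dom D f \<in> B" "Cod D f = Cod D w" "Cod D g \<in> A"
      using decomposition_triangle [OF Cod_in [OF w(1)]] by blast
    note [simp] = Dist_Arr [OF fgh(1)] fgh(3)
    have fg: "Cod D g \<in> A\<^sub>0" "Dom D f \<in> B\<^sub>0"
      using triangle_iff [OF fgh(1,2,4)] w(4) by auto
    have "g \<cdot>\<^bsub>D\<^esub> w = Zero D (\<Sigma> X) (Cod D g)"
      using fg by (intro vH [OF w(3)]) auto
    then obtain y where y: "y \<in> Hom D (\<Sigma> X) (Dom D f)" "f \<cdot>\<^bsub>D\<^esub> y = w"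
      using weak_kernel [OF fgh(1), of w] by auto
    have "y = Zero D (\<Sigma> X) (Dom D f)"
      using fg y by (intro vH [OF w(3)]) auto
    then show "w = Zero D (Dom D w) (Cod D w)" using y(2) by auto
  next
    fix w assume "w \<in> Arr D" "Dom D w \<in> B\<^sub>0" "Cod D w \<in> A\<^sub>0"
    then show "w = Zero D (Dom D w) (Cod D w)"
      using A0A B0B by (intro Hom_BA) auto
  next
    fix w assume w: "w \<in> Arr D" "Dom D w \<in> A\<^sub>0" "Cod D w \<in> B\<^sub>0"
    have "Hom D (Dom D w) (Cod D w) = {Zero D (Dom D w) (Cod D w)}"
      using van [OF w(2,3), of 0] by (simp add: shift_by_def)
    with w(1) show "w = Zero D (Dom D w) (Cod D w)" by (auto simp: Hom_def)
  next
    fix E assume E: "E \<in> ?H"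
    then have "E \<in> Obj D" by (simp add: glued_heart_def)
    then obtain f g h where fgh: "(f, g, h) \<in> Dist D" "Dom D f \<in> B" "Cod D f = E" "Cod D g \<in> A"
      using decomposition_triangle by blast
    then show "\<exists>i p k. (i, p, k) \<in> Dist D \<and> Dom D i \<in> B\<^sub>0 \<and> Cod D i = E \<and> Cod D p \<in> A\<^sub>0"
      using triangle_iff [OF fgh(1,2,4)] E by blast
  next
    fix i p k assume "(i, p, k) \<in> Dist D" "Dom D i \<in> B\<^sub>0" "Cod D p \<in> A\<^sub>0"
    then show "Cod D i \<in> ?H"
      using triangle_iff [of i p k] A0A B0B by blast
  next
    fix X Y assume XY: "X \<in> B\<^sub>0" "Y \<in> B\<^sub>0"
    have sub: "Hom (tri_subcat D B) X Y \<subseteq> Hom D X Y" for X Y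
      by auto
    obtain P i j p q where P: "P \<in> B\<^sub>0" "i \<in> Hom (tri_subcat D B) X P" "j \<in> Hom (tri_subcat D B) Y P"
        "p \<in> Hom (tri_subcat D B) P X" "q \<in> Hom (tri_subcat D B) P Y"
      and eqs: "p \<cdot>\<^bsub>D\<^esub> i = Ident D X" "q \<cdot>\<^bsub>D\<^esub> j = Ident D Y" "q \<cdot>\<^bsub>D\<^esub> i = Zero D X Y"
        "p \<cdot>\<^bsub>D\<^esub> j = Zero D Y X" "Plus D (i \<cdot>\<^bsub>D\<^esub> p) (j \<cdot>\<^bsub>D\<^esub> q) = Ident D P"
      using tB.heart_biproduct [of X Y] XY unfolding B0 [symmetric] tri_subcat_simps by blast
    show "\<exists>P \<in> B\<^sub>0. \<exists>i \<in> Hom D X P. \<exists>j \<in> Hom D Y P. \<exists>p \<in> Hom D P X. \<exists>q \<in> Hom D P Y.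
        p \<cdot>\<^bsub>D\<^esub> i = Ident D X \<and> q \<cdot>\<^bsub>D\<^esub> j = Ident D Y \<and> q \<cdot>\<^bsub>D\<^esub> i = Zero D X Y \<and> p \<cdot>\<^bsub>D\<^esub> j = Zero D Y X \<and>
        Plus D (i \<cdot>\<^bsub>D\<^esub> p) (j \<cdot>\<^bsub>D\<^esub> q) = Ident D P"
      using P(1) P(2-5) [THEN subsetD [OF sub]] eqs by blast
  qed
qed

theorem corollary1p4:
  fixes D :: "('o, 'm, 'z) tri_cat_scheme"
    and A B A_le A_ge B_le B_ge A\<^sub>0 B\<^sub>0 :: "'o set"
  assumes "semiorthogonal_decomposition D A B"
    and "t_structure (tri_subcat D A) A_le A_ge"
    and "t_structure (tri_subcat D B) B_le B_ge"
    and "A\<^sub>0 = heart A_le A_ge"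
    and "B\<^sub>0 = heart B_le B_ge"
    and "\<And>X Y i. \<lbrakk>X \<in> A\<^sub>0; Y \<in> B\<^sub>0; i \<le> 0\<rbrakk>
      \<Longrightarrow> Hom D X (shift_by D i Y) = {Zero D X (shift_by D i Y)}"
  shows "let gl = full_subcat D (glued_heart D A B A\<^sub>0 B\<^sub>0);
             M\<^sub>0 = ext1_bimodule gl
         in bimodule (full_subcat D A\<^sub>0) (full_subcat D B\<^sub>0) M\<^sub>0 \<and>
            equivalent_categories gl
              (glued_category (full_subcat D A\<^sub>0) (full_subcat D B\<^sub>0) M\<^sub>0)"
proof -
  interpret glued_hearts D A\<^sub>0 B\<^sub>0 "glued_heart D A B A\<^sub>0 B\<^sub>0"
    by (rule glued_hearts_glued_heart) fact+
  show ?thesis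
    unfolding Let_def using ext1_bimodule gl_equivalent_Gl by blast
qed

end
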